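(* Let $H_*$ be a homology theory satisfying the Eilenberg–Steenrod axioms, let $n\in\mathbb N$, and for a CW complex $X$ let $B_n(X)=\mathrm{rk}(H_n(X))$ be its $n$-th Betti number. Then the $n$-th Betti number $B_n$ is an $(\mathbb N_\infty,+)$-valued dimension on $\mathrm{CW}^{\mathrm{op}}$, the opposite of the category $\mathrm{CW}$ of CW complexes and cellular maps.
   Context: $\mathrm{CW}$ is the category whose objects are CW complexes $X=\bigcup_k X^k$ ($X^k$ the $k$-skeleton) and whose morphisms are cellular maps, i.e. continuous maps $f:X\to Y$ with $f(X^k)\subseteq Y^k$ for all $k\in\mathbb N$. $\mathbb N_\infty=\mathbb N\cup\{\infty\}$ with $\mathbb N=\{0,1,2,\dots\}$; addition extends the usual addition, with $a+\infty=\infty+a=\infty$ for all $a$; the neutral element is $0$. The rank $\mathrm{rk}(H)\in\mathbb N_\infty$ of an abelian group $H$ is the cardinality of any maximal $\mathbb Z$-linearly independent subset, and $\infty$ if there is no finite one. (The motivating example of $H_*$ is singular homology with integer coefficients, in which case $B_n(X)=\dim_{\mathbb Q}H_n(X;\mathbb Q)$.) $M$-valued dimension. Let $M$ be a commutative monoid, written additively, and $\mathbb X$ a category; $\pi_0(\mathbb X)$ denotes the collection of isomorphism classes of objects of $\mathbb X$. An $M$-valued dimension on $\mathbb X$ is a function $\dim:\pi_0(\mathbb X)\to M$ such that for every pullback $A\times_B C$ in $\mathbb X$ of a morphism $f:C\to B$ along a retraction (split epimorphism) $r:A\to B$, if $f$ is a retraction or $f$ is a section (split monomorphism), then $\dim(A\times_B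 C)+\dim(B)=\dim(A)+\dim(C)$. *)

theory Defs
  imports
    "HOL-Homology.Homology"
    "HOL-Library.Extended_Nat"
begin

section \<open>Categories and valued dimensions\<close>

text \<open>
  Morphisms are only meaningful relative to a hom-set, so the hom-sets need not be disjoint and
  composition takes the three objects involved: \<open>Comp C X Y Z g f\<close> is the composite
  of \<open>f : X \<rightarrow> Y\<close> and \<open>g : Y \<rightarrow> Z\<close>.
\<close>

record ('o, 'm) cat =
  Obj :: "'o set"
  Hom :: "'o \<Rightarrow> 'o \<Rightarrow> 'm set"
  Comp :: "'o \<Rightarrow> 'o \<Rightarrow> 'o \<Rightarrow> 'm \<Rightarrow> 'm \<Rightarrow> 'm"
  Ident :: "'o \<Rightarrow> 'm"

locale category =
  fixes C :: "('o, 'm) cat"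
  assumes Ident_in: "X \<in> Obj C \<Longrightarrow> Ident C X \<in> Hom C X X"
    and Comp_in: "\<lbrakk>X \<in> Obj C; Y \<in> Obj C; Z \<in> Obj C; f \<in> Hom C X Y; g \<in> Hom C Y Z\<rbrakk>
                    \<Longrightarrow> Comp C X Y Z g f \<in> Hom C X Z"
    and Comp_Ident_right: "\<lbrakk>X \<in> Obj C; Y \<in> Obj C; f \<in> Hom C X Y\<rbrakk>
                    \<Longrightarrow> Comp C X X Y f (Ident C X) = f"
    and Comp_Ident_left: "\<lbrakk>X \<in> Obj C; Y \<in> Obj C; f \<in> Hom C X Y\<rbrakk>
                    \<Longrightarrow> Comp C X Y Y (Ident C Y) f = f"
    and Comp_assoc: "\<lbrakk>W \<in> Obj C; X \<in> Obj C; Y \<in> Obj C; Z \<in> Obj C;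
                      f \<in> Hom C W X; g \<in> Hom C X Y; h \<in> Hom C Y Z\<rbrakk>
                    \<Longrightarrow> Comp C W X Z (Comp C X Y Z h g) f = Comp C W Y Z h (Comp C W X Y g f)"

definition opposite :: "('o, 'm) cat \<Rightarrow> ('o, 'm) cat" where
  "opposite C = \<lparr>Obj = Obj C, Hom = (\<lambda>X Y. Hom C Y X),
                 Comp = (\<lambda>X Y Z g f. Comp C Z Y X f g), Ident = Ident C\<rparr>"

lemma category_opposite: "category C \<Longrightarrow> category (opposite C)"
  unfolding category_def opposite_def by simp

definition isomorphic_objects :: "('o, 'm) cat \<Rightarrow> 'o \<Rightarrow> 'o \<Rightarrow> bool" where
  "isomorphic_objects C X Y \<longleftrightarrow>
     (\<exists>f \<in> Hom C X Y. \<exists>g \<in> Hom C Y X. Comp C X Y X g f = Ident C X \<and> Comp C Y X Y f g = Ident C Y)"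

definition is_retraction :: "('o, 'm) cat \<Rightarrow> 'o \<Rightarrow> 'o \<Rightarrow> 'm \<Rightarrow> bool" where
  "is_retraction C X Y f \<longleftrightarrow> f \<in> Hom C X Y \<and> (\<exists>s \<in> Hom C Y X. Comp C Y X Y f s = Ident C Y)"

definition is_section :: "('o, 'm) cat \<Rightarrow> 'o \<Rightarrow> 'o \<Rightarrow> 'm \<Rightarrow> bool" where
  "is_section C X Y f \<longleftrightarrow> f \<in> Hom C X Y \<and> (\<exists>r \<in> Hom C Y X. Comp C X Y X r f = Ident C X)"

text \<open>\<open>P\<close> with projections \<open>p : P \<rightarrow> A\<close>, \<open>q : P \<rightarrow> D\<close> is a pullback of
  \<open>r : A \<rightarrow> B\<close> and \<open>f : D \<rightarrow> B\<close>.\<close>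

definition is_pullback ::
  "('o, 'm) cat \<Rightarrow> 'o \<Rightarrow> 'o \<Rightarrow> 'o \<Rightarrow> 'm \<Rightarrow> 'm \<Rightarrow> 'o \<Rightarrow> 'm \<Rightarrow> 'm \<Rightarrow> bool" where
  "is_pullback C A B D r f P p q \<longleftrightarrow>
     A \<in> Obj C \<and> B \<in> Obj C \<and> D \<in> Obj C \<and> P \<in> Obj C \<and>
     r \<in> Hom C A B \<and> f \<in> Hom C D B \<and> p \<in> Hom C P A \<and> q \<in> Hom C P D \<and>
     Comp C P A B r p = Comp C P D B f q \<and>
     (\<forall>Q \<in> Obj C. \<forall>u \<in> Hom C Q A. \<forall>v \<in> Hom C Q D. Comp C Q A B r u = Comp C Q D B f v \<longrightarrow>
        (\<exists>!w. w \<in> Hom C Q P \<and> Comp C Q P A p w = u \<and> Comp C Q P D q w = v))"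

text \<open>A function on isomorphism classes of objects is given as a function on objects that is
  constant on isomorphism classes.\<close>

definition valued_dimension :: "('o, 'm) cat \<Rightarrow> ('o \<Rightarrow> 'v::comm_monoid_add) \<Rightarrow> bool" where
  "valued_dimension C d \<longleftrightarrow>
     (\<forall>X \<in> Obj C. \<forall>Y \<in> Obj C. isomorphic_objects C X Y \<longrightarrow> d X = d Y) \<and>
     (\<forall>A B D r f P p q.
        is_pullback C A B D r f P p q \<and> is_retraction C A B r \<and>
        (is_retraction C D B f \<or> is_section C D B f) \<longrightarrow>
        d P + d B = d A + d D)"


section \<open>CW complexes and cellular maps\<close>

definition unit_disc :: "nat \<Rightarrow> (nat \<Rightarrow> real) topology" where
  "unit_disc n = subtopology (Euclidean_space n) {x. (\<Sum>i<n. (x i)\<^sup>2) \<le> 1}"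

definition open_disc :: "nat \<Rightarrow> (nat \<Rightarrow> real) set" where
  "open_disc n = {x \<in> topspace (unit_disc n). (\<Sum>i<n. (x i)\<^sup>2) < 1}"

definition disc_boundary :: "nat \<Rightarrow> (nat \<Rightarrow> real) set" where
  "disc_boundary n = {x \<in> topspace (unit_disc n). (\<Sum>i<n. (x i)\<^sup>2) = 1}"

text \<open>
  \<open>Y\<close> arises from its subspace \<open>A\<close> by attaching \<open>n\<close>-cells: there is a family \<open>\<Phi>\<close> of
  characteristic maps, sending boundaries into \<open>A\<close>, such that \<open>Y\<close> is the disjoint union
  of \<open>A\<close> and the open cells as a set, and carries the quotient topology of the disjoint sum of
  \<open>A\<close> and the discs. The cells are indexed by their characteristic maps.
\<close>

definition arises_by_attaching_cells :: "nat \<Rightarrow> 'a topology \<Rightarrow> 'a set \<Rightarrow> bool" where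
  "arises_by_attaching_cells n Y A \<longleftrightarrow>
     A \<subseteq> topspace Y \<and>
     (\<exists>\<Phi> :: ((nat \<Rightarrow> real) \<Rightarrow> 'a) set.
        (\<forall>\<phi> \<in> \<Phi>. continuous_map (unit_disc n) Y \<phi> \<and> \<phi> ` disc_boundary n \<subseteq> A) \<and>
        bij_betw (\<lambda>(\<phi>, x). \<phi> x) (\<Phi> \<times> open_disc n) (topspace Y - A) \<and>
        (\<forall>S \<subseteq> topspace Y.
           closedin Y S \<longleftrightarrow>
             closedin (subtopology Y A) (S \<inter> A) \<and>
             (\<forall>\<phi> \<in> \<Phi>. closedin (unit_disc n) {x \<in> topspace (unit_disc n). \<phi> x \<in> S})))"

text \<open>A CW complex is a space together with its filtration by skeleta; the characteristic maps are
  required to exist but are not part of the data, as cellular maps do not refer to them.\<close>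

type_synonym 'a filtered_space = "'a topology \<times> (nat \<Rightarrow> 'a set)"

abbreviation space :: "'a filtered_space \<Rightarrow> 'a topology" where
  "space K \<equiv> fst K"

abbreviation skeleton :: "'a filtered_space \<Rightarrow> nat \<Rightarrow> 'a set" where
  "skeleton K \<equiv> snd K"

definition CW_complex :: "'a filtered_space \<Rightarrow> bool" where
  "CW_complex K \<longleftrightarrow>
     (\<Union>k. skeleton K k) = topspace (space K) \<and>
     subtopology (space K) (skeleton K 0) = discrete_topology (skeleton K 0) \<and>
     (\<forall>k. skeleton K k \<subseteq> skeleton K (Suc k) \<and>
          arises_by_attaching_cells (Suc k) (subtopology (space K) (skeleton K (Suc k))) (skeleton K k)) \<and>
     (\<forall>S \<subseteq> topspace (space K).
        closedin (space K) S \<longleftrightarrow>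
          (\<forall>k. closedin (subtopology (space K) (skeleton K k)) (S \<inter> skeleton K k)))"

text \<open>Maps are made extensional (\<open>undefined\<close> outside the underlying set of the domain) so
  that equality of morphisms is equality of maps on the domain.\<close>

definition cellular_maps :: "'a filtered_space \<Rightarrow> 'a filtered_space \<Rightarrow> ('a \<Rightarrow> 'a) set" where
  "cellular_maps K L =
     {f \<in> extensional (topspace (space K)).
        continuous_map (space K) (space L) f \<and> (\<forall>k. f ` skeleton K k \<subseteq> skeleton L k)}"

text \<open>The type \<open>'a\<close> plays the role of the universe: points of complexes are taken from it. If
  \<open>'a\<close> is infinite, a pushout of CW complexes over \<open>'a\<close> along a split monomorphism
  again fits into \<open>'a\<close> up to isomorphism, since its cardinality is bounded by the sum of two
  cardinalities of subsets of \<open>'a\<close>.\<close>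

definition CW :: "('a filtered_space, 'a \<Rightarrow> 'a) cat" where
  "CW = \<lparr>Obj = {K. CW_complex K}, Hom = cellular_maps,
         Comp = (\<lambda>K L M g f. compose (topspace (space K)) g f),
         Ident = (\<lambda>K. restrict id (topspace (space K)))\<rparr>"

lemma CW_complex_skeleton_subset: "CW_complex K \<Longrightarrow> skeleton K k \<subseteq> topspace (space K)"
  unfolding CW_complex_def by blast

lemma category_CW: "category CW"
proof
  fix K L M :: "'a filtered_space" and f g
  assume K: "K \<in> Obj CW" and "L \<in> Obj CW" "M \<in> Obj CW"
    and f: "f \<in> Hom CW K L" and g: "g \<in> Hom CW L M"
  have "continuous_map (space K) (space M) (compose (topspace (space K)) g f)"
    using f g by (auto simp: CW_def cellular_maps_def compose_def
        intro: continuous_map_eq [OF continuous_map_compose])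
  moreover have "compose (topspace (space K)) g f ` skeleton K k \<subseteq> skeleton M k" for k
    using f g K CW_complex_skeleton_subset [of K k]
    by (fastforce simp: CW_def cellular_maps_def compose_def subset_iff image_subset_iff)
  ultimately show "Comp CW K L M g f \<in> Hom CW K M"
    by (simp add: CW_def cellular_maps_def)
next
  fix K :: "'a filtered_space"
  assume K: "K \<in> Obj CW"
  have "continuous_map (space K) (space K) (restrict id (topspace (space K)))"
    by (rule continuous_map_eq [OF continuous_map_id]) simp
  moreover have "restrict id (topspace (space K)) ` skeleton K k \<subseteq> skeleton K k" for k
    using K CW_complex_skeleton_subset [of K k] by (auto simp: CW_def)
  ultimately show "Ident CW K \<in> Hom CW K K"
    by (simp add: CW_def cellular_maps_def)
next
  fix K L :: "'a filtered_space" and f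
  assume f: "f \<in> Hom CW K L"
  then have "x \<in> topspace (space K) \<Longrightarrow> f x \<in> topspace (space L)" for x
    by (auto simp: CW_def cellular_maps_def continuous_map_def)
  with f show "Comp CW K K L f (Ident CW K) = f" "Comp CW K L L (Ident CW L) f = f"
    by (auto simp: CW_def cellular_maps_def compose_def fun_eq_iff extensional_def)
next
  fix K L M N :: "'a filtered_space" and f g h
  assume "f \<in> Hom CW K L"
  then have "x \<in> topspace (space K) \<Longrightarrow> f x \<in> topspace (space L)" for x
    by (auto simp: CW_def cellular_maps_def continuous_map_def)
  then show "Comp CW K L N (Comp CW L M N h g) f = Comp CW K M N h (Comp CW K L M g f)"
    by (auto simp: CW_def compose_def fun_eq_iff)
qed


section \<open>Homology theories and Betti numbers\<close>

text \<open>
  The Eilenberg--Steenrod axioms, for pairs \<open>(X, S)\<close> of a space \<open>X\<close> and a subset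
  \<open>S\<close> of \<open>X\<close>. Here \<open>H p X S\<close> is the \<open>p\<close>-th homology group of \<open>(X, S)\<close>,
  \<open>ind p X S Y T f\<close> the map induced by \<open>f : (X, S) \<rightarrow> (Y, T)\<close>, and
  \<open>bd p X S\<close> the boundary map to the homology of \<open>S\<close>. Groups are written
  multiplicatively, as in HOL-Algebra and HOL-Homology. Additivity is not part of the original list of
  axioms and is not assumed.
\<close>

definition pair_map :: "'a topology \<Rightarrow> 'a set \<Rightarrow> 'a topology \<Rightarrow> 'a set \<Rightarrow> ('a \<Rightarrow> 'a) \<Rightarrow> bool" where
  "pair_map X S Y T f \<longleftrightarrow>
     S \<subseteq> topspace X \<and> T \<subseteq> topspace Y \<and> continuous_map X Y f \<and> f \<in> S \<rightarrow> T"

locale homology_theory =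
  fixes H :: "int \<Rightarrow> 'a topology \<Rightarrow> 'a set \<Rightarrow> 'g monoid"
    and ind :: "int \<Rightarrow> 'a topology \<Rightarrow> 'a set \<Rightarrow> 'a topology \<Rightarrow> 'a set \<Rightarrow> ('a \<Rightarrow> 'a) \<Rightarrow> 'g \<Rightarrow> 'g"
    and bd :: "int \<Rightarrow> 'a topology \<Rightarrow> 'a set \<Rightarrow> 'g \<Rightarrow> 'g"
  assumes abelian: "S \<subseteq> topspace X \<Longrightarrow> comm_group (H p X S)"
    and ind_hom: "pair_map X S Y T f \<Longrightarrow> ind p X S Y T f \<in> hom (H p X S) (H p Y T)"
    and bd_hom: "S \<subseteq> topspace X \<Longrightarrow> bd p X S \<in> hom (H p X S) (H (p - 1) (subtopology X S) {})"
    and ind_id: "\<lbrakk>S \<subseteq> topspace X; c \<in> carrier (H p X S)\<rbrakk> \<Longrightarrow> ind p X S X S id c = c"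
    and ind_compose: "\<lbrakk>pair_map X S Y T f; pair_map Y T Z U g; c \<in> carrier (H p X S)\<rbrakk>
          \<Longrightarrow> ind p X S Z U (g \<circ> f) c = ind p Y T Z U g (ind p X S Y T f c)"
    and bd_natural: "\<lbrakk>pair_map X S Y T f; c \<in> carrier (H p X S)\<rbrakk>
          \<Longrightarrow> bd p Y T (ind p X S Y T f c) =
              ind (p - 1) (subtopology X S) {} (subtopology Y T) {} f (bd p X S c)"
    and exact_pair: "S \<subseteq> topspace X \<Longrightarrow>
          exact_seq ([H (p - 1) (subtopology X S) {}, H p X S, H p X {}],
                     [bd p X S, ind p X {} X S id])"
    and exact_boundary: "S \<subseteq> topspace X \<Longrightarrow>
          exact_seq ([H (p - 1) X {}, H (p - 1) (subtopology X S) {}, H p X S],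
                     [ind (p - 1) (subtopology X S) {} X {} id, bd p X S])"
    and exact_space: "S \<subseteq> topspace X \<Longrightarrow>
          exact_seq ([H p X S, H p X {}, H p (subtopology X S) {}],
                     [ind p X {} X S id, ind p (subtopology X S) {} X {} id])"
    and homotopy: "\<lbrakk>S \<subseteq> topspace X; T \<subseteq> topspace Y; homotopic_with (\<lambda>h. h \<in> S \<rightarrow> T) X Y f g;
                    c \<in> carrier (H p X S)\<rbrakk>
          \<Longrightarrow> ind p X S Y T f c = ind p X S Y T g c"
    and excision: "\<lbrakk>U \<subseteq> S; S \<subseteq> topspace X; X closure_of U \<subseteq> X interior_of S\<rbrakk>
          \<Longrightarrow> ind p (subtopology X (topspace X - U)) (S - U) X S id
              \<in> iso (H p (subtopology X (topspace X - U)) (S - U)) (H p X S)"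
    and dimension: "\<lbrakk>topspace X = {a}; p \<noteq> 0\<rbrakk> \<Longrightarrow> trivial_group (H p X {})"

lemma homology_theory_singular:
  "homology_theory relative_homology_group hom_induced hom_boundary"
proof (rule homology_theory.intro)
  show "hom_induced p (subtopology X (topspace X - U)) (S - U) X S id
        \<in> iso (relative_homology_group p (subtopology X (topspace X - U)) (S - U))
              (relative_homology_group p X S)"
    if "U \<subseteq> S" "S \<subseteq> topspace X" "X closure_of U \<subseteq> X interior_of S" for p X and U S :: "'a set"
    using homology_excision_axiom [of X U S "topspace X" p] that by simp
  show "hom_induced p X S Z U (g \<circ> f) c = hom_induced p Y T Z U g (hom_induced p X S Y T f c)"
    if "pair_map X S Y T f" "pair_map Y T Z U g"
    for p X Y Z and S T U :: "'a set" and f g c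
    using that by (simp add: pair_map_def hom_induced_compose')
  show "hom_boundary p Y T (hom_induced p X S Y T f c) =
        hom_induced (p - 1) (subtopology X S) {} (subtopology Y T) {} f (hom_boundary p X S c)"
    if "pair_map X S Y T f" for p X Y and S T :: "'a set" and f c
    using that naturality_hom_induced [of X Y f S T p] by (simp add: pair_map_def fun_eq_iff)
  show "hom_induced p X S Y T f c = hom_induced p X S Y T g c"
    if "homotopic_with (\<lambda>h. h \<in> S \<rightarrow> T) X Y f g" for p X Y and S T :: "'a set" and f g c
    using homology_homotopy_axiom [OF that] by simp
qed (simp_all add: pair_map_def abelian_homology_group hom_induced_hom hom_boundary_hom hom_induced_id
    homology_exactness_axiom_1 homology_exactness_axiom_2 homology_exactness_axiom_3 homology_dimension_axiom
    del: exact_seq_cons_iff exact_seq_end_iff)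

definition Z_independent :: "('g, 'b) monoid_scheme \<Rightarrow> 'g set \<Rightarrow> bool" where
  "Z_independent G S \<longleftrightarrow>
     S \<subseteq> carrier G \<and>
     (\<forall>T c. T \<subseteq> S \<and> finite T \<and> finprod G (\<lambda>x. x [^]\<^bsub>G\<^esub> (c x :: int)) T = \<one>\<^bsub>G\<^esub> \<longrightarrow>
            (\<forall>x \<in> T. c x = 0))"

definition max_Z_independent :: "('g, 'b) monoid_scheme \<Rightarrow> 'g set \<Rightarrow> bool" where
  "max_Z_independent G S \<longleftrightarrow>
     Z_independent G S \<and> (\<forall>T. Z_independent G T \<and> S \<subseteq> T \<longrightarrow> T = S)"

text \<open>The choice of a finite maximal independent set is immaterial, as they all have the same
  cardinality.\<close>

definition group_rank :: "('g, 'b) monoid_scheme \<Rightarrow> enat" where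
  "group_rank G =
     (if \<exists>S. max_Z_independent G S \<and> finite S
      then enat (card (SOME S. max_Z_independent G S \<and> finite S)) else \<infinity>)"

definition Betti :: "(int \<Rightarrow> 'a topology \<Rightarrow> 'a set \<Rightarrow> 'g monoid) \<Rightarrow> nat \<Rightarrow> 'a filtered_space \<Rightarrow> enat" where
  "Betti H n K = group_rank (H (int n) (space K) {})"

end

theory Submission
  imports Defs "HOL-Analysis.Abstract_Metric_Spaces"
begin

text \<open>
  A pullback in the opposite category is a pushout \<open>P\<close> of \<open>A \<leftarrow> B \<rightarrow> D\<close>, where \<open>r : B \<rightarrow> A\<close> has a
  cellular left inverse. By invariance of domain \<open>r\<close> maps \<open>B\<close> homeomorphically onto a subcomplex of
  \<open>A\<close>, so the topological pushout is again a CW complex and \<open>P\<close> is isomorphic to it. Homotopy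
  extension for CW pairs and excision give \<open>H\<^sub>n(A, B) \<cong> H\<^sub>n(P, D)\<close>. As \<open>B\<close> is a retract of \<open>A\<close> and \<open>D\<close> one of
  \<open>P\<close>, the exact sequences of the pairs split into short exact ones, and additivity of the rank yields
  \<open>rk H\<^sub>n(P) - rk H\<^sub>n(D) = rk H\<^sub>n(A, B) = rk H\<^sub>n(A) - rk H\<^sub>n(B)\<close> (read additively if ranks are infinite).
\<close>

section \<open>Rank of abelian groups\<close>

text \<open>Two obstacles shape the argument. The pullback is known by its universal property alone,
  so it has to be compared with a pushout built by hand, and the points of that pushout must lie in
  the same type \<open>'a\<close>. An infinite type contains two disjoint copies of itself: one
  holds \<open>D\<close>, the other the part of \<open>A\<close> outside the image of
  \<open>B\<close>. Secondly, cellular maps respect skeleta but not cells, and \<open>r\<close>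
  might a priori map a cell of \<open>B\<close> onto part of a cell of \<open>A\<close>. Invariance
  of domain shows that the image of \<open>B\<close> meets each open cell of \<open>A\<close> in an
  open set. That it is also closed rests on \<open>A\<close> being Hausdorff, which is not part of
  the definition of a complex and is itself extracted from homotopy extension. Homotopy extension in
  turn needs that crossing with the compact interval preserves quotient maps, since the homotopies
  are defined cell by cell. Ranks are compared through finite families that are independent, or that
  span up to nonzero multiples, so infinite ranks require no cardinal arithmetic.\<close>

lemma homogeneous_int_system_solvable:
  fixes c :: "'t \<Rightarrow> 'i \<Rightarrow> int"
  assumes "finite I" "finite T" "card I < card T"
  shows "\<exists>z. (\<exists>t\<in>T. z t \<noteq> 0) \<and> (\<forall>i\<in>I. (\<Sum>t\<in>T. z t * c t i) = 0)"
  using assms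
proof (induction I arbitrary: T c rule: finite_induct)
  case empty
  then obtain t where "t \<in> T" by fastforce
  then show ?case by (intro exI[of _ "\<lambda>_. 1"]) auto
next
  case (insert j I)
  show ?case
  proof (cases "\<forall>t\<in>T. c t j = 0")
    case True
    have "card I < card T" using insert by simp
    from insert.IH[OF \<open>finite T\<close> this, of c] True show ?thesis by auto
  next
    case False
    \<comment> \<open>Gaussian elimination without division: \<open>u\<close> is the pivot unknown
      of equation \<open>j\<close>, and cross-multiplication with \<open>c u j\<close> removes it
      from the other equations.\<close>
    then obtain u where u: "u \<in> T" "c u j \<noteq> 0" by blast
    have "card I < card (T - {u})" using insert u by simp
    from insert.IH[OF _ this, of "\<lambda>t i. c u j * c t i - c t j * c u i"] \<open>finite T\<close>
    obtain z where z: "\<exists>t\<in>T - {u}. z t \<noteq> 0"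
      "\<And>i. i \<in> I \<Longrightarrow> (\<Sum>t\<in>T - {u}. z t * (c u j * c t i - c t j * c u i)) = 0"
      by auto
    \<comment> \<open>Scaling the solution by the pivot keeps everything integral; the value at
      \<open>u\<close> is then the one forced by equation \<open>j\<close>.\<close>
    define y where "y t = (if t = u then - (\<Sum>t\<in>T - {u}. z t * c t j) else c u j * z t)" for t
    have sum: "(\<Sum>t\<in>T. y t * c t i) = (\<Sum>t\<in>T - {u}. z t * (c u j * c t i - c t j * c u i))" for i
    proof -
      have "(\<Sum>t\<in>T. y t * c t i) = y u * c u i + (\<Sum>t\<in>T - {u}. y t * c t i)"
        using u \<open>finite T\<close> by (simp add: sum.remove)
      also have "(\<Sum>t\<in>T - {u}. y t * c t i) = (\<Sum>t\<in>T - {u}. c u j * z t * c t i)"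
        by (intro sum.cong) (auto simp: y_def)
      also have "y u * c u i = - (\<Sum>t\<in>T - {u}. z t * c t j * c u i)"
        by (simp add: y_def sum_distrib_right)
      finally show ?thesis
        by (simp add: sum_subtractf algebra_simps)
    qed
    have "(\<Sum>t\<in>T. y t * c t i) = 0" if "i \<in> insert j I" for i
    proof (cases "i = j")
      case True
      then show ?thesis unfolding sum by (intro sum.neutral) (simp add: algebra_simps)
    next
      case False
      then show ?thesis unfolding sum using z that by auto
    qed
    moreover have "\<exists>t\<in>T. y t \<noteq> 0"
      using z(1) u by (auto simp: y_def)
    ultimately show ?thesis by blast
  qed
qed

definition zcomb :: "('g, 'b) monoid_scheme \<Rightarrow> ('i \<Rightarrow> 'g) \<Rightarrow> ('i \<Rightarrow> int) \<Rightarrow> 'i set \<Rightarrow> 'g" where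
  "zcomb G v c I = finprod G (\<lambda>i. v i [^]\<^bsub>G\<^esub> c i) I"

text \<open>Indexed families instead of sets, so that images under homomorphisms and families over
  \<open>I <+> J\<close> can be formed without checking that members stay distinct.\<close>

definition indep_family :: "('g, 'b) monoid_scheme \<Rightarrow> ('i \<Rightarrow> 'g) \<Rightarrow> 'i set \<Rightarrow> bool" where
  "indep_family G v I \<longleftrightarrow> finite I \<and> v \<in> I \<rightarrow> carrier G \<and>
     (\<forall>c. zcomb G v c I = \<one>\<^bsub>G\<^esub> \<longrightarrow> (\<forall>i\<in>I. c i = 0))"

text \<open>Spanning up to nonzero multiples, that is, spanning \<open>G\<close> tensored with the
  rationals.\<close>

definition spanning_family :: "('g, 'b) monoid_scheme \<Rightarrow> ('i \<Rightarrow> 'g) \<Rightarrow> 'i set \<Rightarrow> bool" where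
  "spanning_family G v I \<longleftrightarrow> finite I \<and> v \<in> I \<rightarrow> carrier G \<and>
     (\<forall>g\<in>carrier G. \<exists>a c. a \<noteq> 0 \<and> g [^]\<^bsub>G\<^esub> (a::int) = zcomb G v c I)"

lemma indep_familyD:
  "\<lbrakk>indep_family G v I; zcomb G v c I = \<one>\<^bsub>G\<^esub>; i \<in> I\<rbrakk> \<Longrightarrow> c i = 0"
  unfolding indep_family_def by blast

context comm_group
begin

lemma zcomb_closed: "v \<in> I \<rightarrow> carrier G \<Longrightarrow> zcomb G v c I \<in> carrier G"
  unfolding zcomb_def by (intro finprod_closed) auto

lemma zcomb_insert:
  "\<lbrakk>finite I; i \<notin> I; v \<in> insert i I \<rightarrow> carrier G\<rbrakk> \<Longrightarrow>
    zcomb G v c (insert i I) = v i [^] c i \<otimes> zcomb G v c I"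
  unfolding zcomb_def by (subst finprod_insert) auto

lemma zcomb_cong:
  "\<lbrakk>v \<in> I \<rightarrow> carrier G; \<And>i. i \<in> I \<Longrightarrow> v i = w i; \<And>i. i \<in> I \<Longrightarrow> c i = d i\<rbrakk> \<Longrightarrow>
    zcomb G v c I = zcomb G w d I"
  unfolding zcomb_def by (intro finprod_cong') (auto simp: Pi_iff)

lemma zcomb_zero: "zcomb G v (\<lambda>_. 0) I = \<one>"
  unfolding zcomb_def by simp

lemma zcomb_add:
  assumes "v \<in> I \<rightarrow> carrier G"
  shows "zcomb G v (\<lambda>i. c i + d i) I = zcomb G v c I \<otimes> zcomb G v d I"
proof -
  have "zcomb G v (\<lambda>i. c i + d i) I = finprod G (\<lambda>i. v i [^] c i \<otimes> v i [^] d i) I"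
    unfolding zcomb_def
  proof (rule finprod_cong')
    fix i assume "i \<in> I"
    then have "v i \<in> carrier G" using assms by auto
    then show "v i [^] (c i + d i) = v i [^] c i \<otimes> v i [^] d i"
      by (simp add: int_pow_mult)
  qed (use assms in auto)
  also have "\<dots> = zcomb G v c I \<otimes> zcomb G v d I"
    unfolding zcomb_def by (rule finprod_multf) (use assms in auto)
  finally show ?thesis .
qed

lemma zcomb_pow:
  "\<lbrakk>finite I; v \<in> I \<rightarrow> carrier G\<rbrakk> \<Longrightarrow> zcomb G v c I [^] (a::int) = zcomb G v (\<lambda>i. c i * a) I"
proof (induction I rule: finite_induct)
  case empty
  show ?case by (simp add: zcomb_def)
next
  case (insert x F)
  then have v: "v x \<in> carrier G" "v \<in> F \<rightarrow> carrier G" by auto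
  show ?case
    using insert v by (simp add: zcomb_insert int_pow_distrib zcomb_closed int_pow_pow)
qed

text \<open>Exchange of two summations; it feeds a solution \<open>z\<close> of an integer system
  back into the group.\<close>

lemma zcomb_sum:
  assumes "finite T" "finite I" "v \<in> I \<rightarrow> carrier G"
  shows "zcomb G v (\<lambda>i. \<Sum>t\<in>T. z t * c t i) I = zcomb G (\<lambda>t. zcomb G v (c t) I) z T"
  using assms(1)
proof (induction T rule: finite_induct)
  case empty
  show ?case by (simp add: zcomb_zero) (simp add: zcomb_def)
next
  case (insert x F)
  have "zcomb G v (\<lambda>i. \<Sum>t\<in>insert x F. z t * c t i) I
      = zcomb G v (\<lambda>i. c x i * z x + (\<Sum>t\<in>F. z t * c t i)) I"
    using insert.hyps by (simp add: mult.commute[of "c x _"])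
  also have "\<dots> = zcomb G v (c x) I [^] z x \<otimes> zcomb G v (\<lambda>i. \<Sum>t\<in>F. z t * c t i) I"
    unfolding zcomb_pow[OF assms(2,3)] by (rule zcomb_add[OF assms(3)])
  also have "\<dots> = zcomb G (\<lambda>t. zcomb G v (c t) I) z (insert x F)"
    unfolding insert.IH
    by (rule zcomb_insert[symmetric]) (use insert zcomb_closed assms in auto)
  finally show ?case .
qed

lemma zcomb_subset:
  assumes "finite I" "J \<subseteq> I" "v \<in> I \<rightarrow> carrier G" "\<And>i. i \<in> I - J \<Longrightarrow> c i = 0"
  shows "zcomb G v c I = zcomb G v c J"
  unfolding zcomb_def by (rule finprod_mono_neutral_cong_right) (use assms in auto)

lemma zcomb_Plus:
  assumes "finite I" "finite J" "v \<in> I <+> J \<rightarrow> carrier G"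
  shows "zcomb G v c (I <+> J) = zcomb G (v \<circ> Inl) (c \<circ> Inl) I \<otimes> zcomb G (v \<circ> Inr) (c \<circ> Inr) J"
proof -
  have "zcomb G v c (I <+> J) = zcomb G v c (Inl ` I) \<otimes> zcomb G v c (Inr ` J)"
    unfolding zcomb_def Plus_def by (rule finprod_Un_disjoint) (use assms in auto)
  moreover have "zcomb G v c (Inl ` I) = zcomb G (v \<circ> Inl) (c \<circ> Inl) I"
    unfolding zcomb_def o_def
    by (rule finprod_reindex) (use assms(3) in \<open>auto simp: Plus_def Pi_iff\<close>)
  moreover have "zcomb G v c (Inr ` J) = zcomb G (v \<circ> Inr) (c \<circ> Inr) J"
    unfolding zcomb_def o_def
    by (rule finprod_reindex) (use assms(3) in \<open>auto simp: Plus_def Pi_iff\<close>)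
  ultimately show ?thesis by simp
qed

lemma hom_zcomb:
  assumes "comm_group K" "h \<in> hom G K" "v \<in> I \<rightarrow> carrier G" "finite I"
  shows "h (zcomb G v c I) = zcomb K (h \<circ> v) c I"
  using assms(4,3)
proof (induction I rule: finite_induct)
  case empty
  interpret K: comm_group K by fact
  show ?case by (simp add: zcomb_def hom_one[OF assms(2)] K.is_group is_group)
next
  case (insert x F)
  interpret K: comm_group K by fact
  from insert have v: "v x \<in> carrier G" "v \<in> F \<rightarrow> carrier G" by auto
  have "h (v x) \<in> carrier K" "h \<circ> v \<in> F \<rightarrow> carrier K"
    using v hom_in_carrier[OF assms(2)] by (auto simp: Pi_iff)
  moreover have "h (v x [^] c x) = h (v x) [^]\<^bsub>K\<^esub> c x"
    by (rule hom_int_pow) (use assms v is_group K.is_group in auto)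
  ultimately show ?case
    using insert v K.zcomb_insert[of F x "h \<circ> v" c]
    by (simp add: zcomb_insert hom_mult[OF assms(2)] zcomb_closed Pi_iff o_def)
qed

text \<open>Counting unknowns: nonzero multiples \<open>a i\<close> of the \<open>v i\<close> are
  combinations of the \<open>w j\<close>. With more \<open>v i\<close> than \<open>w j\<close>, the
  coefficient system would have a nontrivial solution \<open>z\<close>, and the
  \<open>a i * z i\<close> would be a nontrivial relation among the \<open>v i\<close>.\<close>

lemma indep_card_le_spanning_card:
  assumes v: "indep_family G v I" and w: "spanning_family G w J"
  shows "card I \<le> card J"
proof (rule ccontr)
  assume "\<not> card I \<le> card J"
  have fin: "finite I" "finite J" and vI: "v \<in> I \<rightarrow> carrier G" and wJ: "w \<in> J \<rightarrow> carrier G"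
    using v w by (auto simp: indep_family_def spanning_family_def)
  have "\<forall>i\<in>I. \<exists>a c. a \<noteq> 0 \<and> v i [^] (a::int) = zcomb G w c J"
    using w vI by (auto simp: spanning_family_def Pi_iff)
  then obtain a c where ac: "\<And>i. i \<in> I \<Longrightarrow> a i \<noteq> 0 \<and> v i [^] (a i :: int) = zcomb G w (c i) J"
    by metis
  obtain z where z: "\<exists>i\<in>I. z i \<noteq> 0" "\<And>j. j \<in> J \<Longrightarrow> (\<Sum>i\<in>I. z i * c i j) = 0"
    using homogeneous_int_system_solvable[OF fin(2,1), of c] \<open>\<not> card I \<le> card J\<close>
    by (meson not_le)
  have "\<one> = zcomb G w (\<lambda>j. \<Sum>i\<in>I. z i * c i j) J"
  proof -
    have "zcomb G w (\<lambda>j. \<Sum>i\<in>I. z i * c i j) J = zcomb G w (\<lambda>_. 0) J"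
      by (rule zcomb_cong[OF wJ]) (auto simp: z(2))
    then show ?thesis by (simp only: zcomb_zero)
  qed
  also have "\<dots> = zcomb G (\<lambda>i. zcomb G w (c i) J) z I"
    by (rule zcomb_sum[OF fin wJ])
  also have "\<dots> = zcomb G v (\<lambda>i. a i * z i) I"
  proof -
    have "zcomb G w (c i) J [^] z i = v i [^] (a i * z i)" if "i \<in> I" for i
    proof -
      have "v i \<in> carrier G" using vI that by auto
      then show ?thesis using ac[OF that] int_pow_pow[of "v i" "a i" "z i"] by metis
    qed
    moreover have "(\<lambda>i. v i [^] (a i * z i)) \<in> I \<rightarrow> carrier G"
      using vI by auto
    ultimately show ?thesis
      unfolding zcomb_def by (intro finprod_cong') auto
  qed
  finally have "zcomb G v (\<lambda>i. a i * z i) I = \<one>" ..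
  with v have "\<forall>i\<in>I. a i * z i = 0"
    unfolding indep_family_def by blast
  then show False using z(1) ac by (meson mult_eq_0_iff)
qed

lemma Z_independent_finite_iff: "finite S \<Longrightarrow> Z_independent G S \<longleftrightarrow> indep_family G id S"
proof
  assume "finite S" "Z_independent G S"
  then show "indep_family G id S"
    unfolding Z_independent_def indep_family_def zcomb_def by auto
next
  assume fin: "finite S" and ind: "indep_family G id S"
  then have S: "S \<subseteq> carrier G" by (auto simp: indep_family_def Pi_iff)
  show "Z_independent G S"
    unfolding Z_independent_def
  proof (intro conjI S allI impI ballI)
    fix T c x
    assume *: "T \<subseteq> S \<and> finite T \<and> finprod G (\<lambda>x. x [^] (c x :: int)) T = \<one>" and "x \<in> T"
    \<comment> \<open>Coefficients outside \<open>T\<close> are set to zero, because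
      \<open>indep_family\<close> speaks of relations over the whole index set.\<close>
    let ?d = "\<lambda>x. if x \<in> T then c x else 0"
    have "zcomb G id ?d S = zcomb G id ?d T"
      by (rule zcomb_subset) (use fin S * in auto)
    also have "\<dots> = zcomb G id c T"
      by (rule zcomb_cong) (use S * in auto)
    also have "\<dots> = \<one>"
      using * unfolding zcomb_def id_apply by blast
    finally have "?d x = 0"
      using * \<open>x \<in> T\<close> by (intro indep_familyD[OF ind]) auto
    then show "c x = 0"
      using \<open>x \<in> T\<close> by simp
  qed
qed

lemma Z_independent_subset: "\<lbrakk>Z_independent G T; S \<subseteq> T\<rbrakk> \<Longrightarrow> Z_independent G S"
  unfolding Z_independent_def by (meson order_trans)

text \<open>For \<open>g\<close> outside \<open>S\<close>, maximality forces a relation in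
  \<open>insert g S\<close>. The coefficient of \<open>g\<close> cannot vanish, as \<open>S\<close>
  is independent, so the relation can be solved for a nonzero power of \<open>g\<close>.\<close>

lemma max_Z_independent_spanning:
  assumes "max_Z_independent G S" "finite S"
  shows "spanning_family G id S"
proof -
  have ind: "Z_independent G S" and S: "S \<subseteq> carrier G"
    using assms by (auto simp: max_Z_independent_def Z_independent_def)
  have "\<exists>a c. a \<noteq> 0 \<and> g [^] (a::int) = zcomb G id c S" if g: "g \<in> carrier G" for g
  proof (cases "g \<in> S")
    case True
    have "zcomb G id (\<lambda>x. if x = g then 1 else 0) S = zcomb G id (\<lambda>x. if x = g then 1 else 0) {g}"
      by (rule zcomb_subset) (use True S assms in auto)
    then have "g [^] (1::int) = zcomb G id (\<lambda>x. if x = g then 1 else 0) S"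
      using g by (simp add: zcomb_insert) (simp add: zcomb_def)
    then show ?thesis by (metis one_neq_zero)
  next
    case False
    then have "\<not> Z_independent G (insert g S)"
      using assms(1) unfolding max_Z_independent_def by blast
    then have "\<not> indep_family G id (insert g S)"
      using Z_independent_finite_iff assms by simp
    moreover have "id \<in> insert g S \<rightarrow> carrier G" using S g by auto
    ultimately obtain c x where c: "zcomb G id c (insert g S) = \<one>" "x \<in> insert g S" "c x \<noteq> 0"
      using assms(2) unfolding indep_family_def by blast
    have cl: "zcomb G id c S \<in> carrier G" by (rule zcomb_closed) (use S in auto)
    have eq: "g [^] c g \<otimes> zcomb G id c S = \<one>"
      using c(1) False assms(2) S g by (subst (asm) zcomb_insert) auto
    have "c g \<noteq> 0"
    proof
      assume "c g = 0"
      then have "zcomb G id c S = \<one>" using eq cl by simp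
      then have "\<forall>x\<in>S. c x = 0"
        using ind indep_familyD[of G id S c] Z_independent_finite_iff[OF assms(2)] by blast
      then show False using c \<open>c g = 0\<close> by auto
    qed
    moreover have "g [^] (- c g) = zcomb G id c S"
      using eq cl g by (metis int_pow_closed int_pow_neg inv_equality inv_inv inv_closed)
    ultimately show ?thesis
      by (metis neg_equal_0_iff_equal)
  qed
  then show ?thesis
    unfolding spanning_family_def using assms S by auto
qed

lemma group_rank_finite:
  assumes "group_rank G \<noteq> \<infinity>"
  shows "\<exists>S. max_Z_independent G S \<and> finite S \<and> group_rank G = enat (card S)"
  using assms someI_ex[of "\<lambda>S. max_Z_independent G S \<and> finite S"]
  unfolding group_rank_def by (metis (no_types, lifting))

lemma indep_family_card_le_rank:
  assumes "indep_family G v I"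
  shows "enat (card I) \<le> group_rank G"
proof (cases "group_rank G = \<infinity>")
  case False
  then obtain S where S: "max_Z_independent G S" "finite S" "group_rank G = enat (card S)"
    using group_rank_finite by blast
  then show ?thesis
    using indep_card_le_spanning_card[OF assms max_Z_independent_spanning] by auto
qed auto

text \<open>If the rank is infinite, no finite independent set is maximal, so such sets can be
  enlarged one element at a time. If it is finite, a subset of a maximal set serves.\<close>

lemma exists_indep_family_of_card:
  assumes "enat n \<le> group_rank G"
  shows "\<exists>S. indep_family G id S \<and> card S = n"
proof (cases "group_rank G = \<infinity>")
  case False
  then obtain S where S: "max_Z_independent G S" "finite S" "group_rank G = enat (card S)"
    using group_rank_finite by blast
  then obtain T where "T \<subseteq> S" "card T = n"
    using assms by (metis enat_ord_simps(1) obtain_subset_with_card_n)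
  then show ?thesis
    using Z_independent_subset[of S T] S Z_independent_finite_iff finite_subset
    unfolding max_Z_independent_def by blast
next
  case True
  have nomax: "\<not> max_Z_independent G S" if "finite S" for S
    using True that unfolding group_rank_def by (metis enat.distinct(1))
  have "\<exists>S. Z_independent G S \<and> finite S \<and> card S = n"
  proof (induction n)
    case 0
    have "Z_independent G {}" by (simp add: Z_independent_def)
    then show ?case by (intro exI[of _ "{}"]) simp
  next
    case (Suc n)
    then obtain S where S: "Z_independent G S" "finite S" "card S = n" by blast
    then obtain T where T: "Z_independent G T" "S \<subseteq> T" "T \<noteq> S"
      using nomax[of S] unfolding max_Z_independent_def by blast
    then obtain x where x: "x \<in> T" "x \<notin> S" by blast
    then have "Z_independent G (insert x S)"
      using T by (intro Z_independent_subset[OF T(1)]) auto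
    then show ?case using S x by (intro exI[of _ "insert x S"]) auto
  qed
  then show ?thesis
    using Z_independent_finite_iff by blast
qed

end

text \<open>Reduces the comparison of possibly infinite ranks to finite independent
  families.\<close>

lemma enat_le_all_nat: "(\<And>n. enat n \<le> x \<Longrightarrow> enat n \<le> y) \<Longrightarrow> x \<le> y"
proof (cases y)
  case (enat k)
  assume le: "\<And>n. enat n \<le> x \<Longrightarrow> enat n \<le> y"
  show ?thesis
  proof (rule ccontr)
    assume "\<not> x \<le> y"
    then have "enat (Suc k) \<le> x" using enat by (simp add: Suc_ile_eq)
    from le[OF this] enat show False by simp
  qed
qed simp

lemma group_rank_mono_inj:
  assumes "comm_group G" "comm_group K" "h \<in> hom G K" "inj_on h (carrier G)"
  shows "group_rank G \<le> group_rank K"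
proof (rule enat_le_all_nat)
  interpret G: comm_group G by fact
  interpret K: comm_group K by fact
  fix n assume "enat n \<le> group_rank G"
  then obtain S where S: "indep_family G id S" "card S = n"
    using G.exists_indep_family_of_card by blast
  have "indep_family K h S"
    unfolding indep_family_def
  proof (intro conjI allI impI)
    show "finite S" "h \<in> S \<rightarrow> carrier K"
      using S hom_in_carrier[OF assms(3)] by (auto simp: indep_family_def Pi_iff)
    fix c assume c: "zcomb K h c S = \<one>\<^bsub>K\<^esub>"
    have id: "id \<in> S \<rightarrow> carrier G" "finite S" using S by (auto simp: indep_family_def)
    have "h (zcomb G id c S) = h \<one>\<^bsub>G\<^esub>"
      using G.hom_zcomb[OF assms(2,3) id] c
      by (simp add: hom_one[OF assms(3) G.is_group K.is_group])
    then have "zcomb G id c S = \<one>\<^bsub>G\<^esub>"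
      using assms(4) G.zcomb_closed[OF id(1)] by (simp add: inj_on_eq_iff)
    then show "\<forall>i\<in>S. c i = 0" using S unfolding indep_family_def by blast
  qed
  from K.indep_family_card_le_rank[OF this] S show "enat n \<le> group_rank K" by simp
qed

lemma group_rank_iso:
  assumes "comm_group G" "comm_group K" "h \<in> iso G K"
  shows "group_rank G = group_rank K"
proof (rule antisym)
  show "group_rank G \<le> group_rank K"
    using assms by (intro group_rank_mono_inj) (auto simp: iso_def bij_betw_def)
  have "inv_into (carrier G) h \<in> iso K G"
    using assms by (simp add: group.iso_set_sym comm_group.axioms(2))
  then show "group_rank K \<le> group_rank G"
    using assms by (intro group_rank_mono_inj) (auto simp: iso_def bij_betw_def)
qed

text \<open>The images under \<open>i\<close> of a family in \<open>K\<close> and lifts of a family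
  in \<open>Q\<close> together form a family in \<open>G\<close>. It spans if both families do,
  which bounds the rank from above, and it is independent if both are, which bounds it from below.
  No splitting of the sequence enters.\<close>

theorem group_rank_short_exact:
  assumes groups: "comm_group K" "comm_group G" "comm_group Q"
    and i: "i \<in> hom K G" "inj_on i (carrier K)"
    and j: "j \<in> hom G Q" "j ` carrier G = carrier Q"
    and exact: "kernel G Q j = i ` carrier K"
  shows "group_rank G = group_rank K + group_rank Q"
proof (rule antisym)
  interpret K: comm_group K by fact
  interpret G: comm_group G by fact
  interpret Q: comm_group Q by fact
  interpret jhom: group_hom G Q j
    using j(1) by unfold_locales
  \<comment> \<open>A set-theoretic section of \<open>j\<close>, not a homomorphism; only its values
    on chosen elements of \<open>Q\<close> matter.\<close>
  define s where "s = inv_into (carrier G) j"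
  have s: "s y \<in> carrier G" "j (s y) = y" if "y \<in> carrier Q" for y
    using that j(2) by (auto simp: s_def inv_into_into f_inv_into_f)
  have ji: "j (i x) = \<one>\<^bsub>Q\<^esub>" if "x \<in> carrier K" for x
    using that exact unfolding kernel_def by blast
  have iG: "i x \<in> carrier G" if "x \<in> carrier K" for x
    using that hom_in_carrier[OF i(1)] by blast
  show "group_rank G \<le> group_rank K + group_rank Q"
  proof (cases "group_rank K = \<infinity> \<or> group_rank Q = \<infinity>")
    case False
    obtain S where S: "max_Z_independent K S" "finite S" "group_rank K = enat (card S)"
      using False K.group_rank_finite by blast
    obtain T where T: "max_Z_independent Q T" "finite T" "group_rank Q = enat (card T)"
      using False Q.group_rank_finite by blast
    have spS: "spanning_family K id S" and spT: "spanning_family Q id T"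
      using S T K.max_Z_independent_spanning Q.max_Z_independent_spanning by auto
    then have SK: "S \<subseteq> carrier K" and TQ: "T \<subseteq> carrier Q"
      by (auto simp: spanning_family_def Pi_iff)
    have span: "spanning_family G (case_sum i s) (S <+> T)"
      unfolding spanning_family_def
    proof (intro conjI ballI)
      show "finite (S <+> T)" using S T by simp
      show ist: "case_sum i s \<in> S <+> T \<rightarrow> carrier G"
        using SK TQ iG s by (auto simp: Plus_def)
      fix g assume g: "g \<in> carrier G"
      have jg: "j g \<in> carrier Q" using g j by blast
      obtain a c where a: "a \<noteq> 0" "j g [^]\<^bsub>Q\<^esub> (a::int) = zcomb Q id c T"
        using spT jg unfolding spanning_family_def by blast
      have sT: "s \<in> T \<rightarrow> carrier G" using TQ s by auto
      have zc: "zcomb G s c T \<in> carrier G" by (rule G.zcomb_closed[OF sT])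
      \<comment> \<open>The defect between the \<open>a\<close>-th power of \<open>g\<close> and the
        lifted combination dies in \<open>Q\<close>, so it comes from \<open>K\<close>. There a
        second multiplier \<open>b\<close> turns it into a combination of \<open>S\<close>; the
        total multiplier is \<open>a * b\<close>.\<close>
      let ?k = "g [^]\<^bsub>G\<^esub> a \<otimes>\<^bsub>G\<^esub> inv\<^bsub>G\<^esub> (zcomb G s c T)"
      have "j (zcomb G s c T) = zcomb Q (j \<circ> s) c T"
        by (rule G.hom_zcomb[OF groups(3) j(1) sT T(2)])
      also have "\<dots> = zcomb Q id c T"
        using TQ s by (intro Q.zcomb_cong) auto
      finally have jz: "j (zcomb G s c T) = j g [^]\<^bsub>Q\<^esub> a"
        by (simp only: a(2))
      have "j ?k = j g [^]\<^bsub>Q\<^esub> a \<otimes>\<^bsub>Q\<^esub> inv\<^bsub>Q\<^esub> (j g [^]\<^bsub>Q\<^esub> a)"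
        using g zc by (simp only: jhom.hom_mult jhom.hom_inv jhom.hom_int_pow jz
            G.int_pow_closed G.inv_closed)
      then have "j ?k = \<one>\<^bsub>Q\<^esub>"
        using jg by simp
      then have "?k \<in> kernel G Q j"
        using g zc by (simp add: kernel_def)
      then obtain k where k: "k \<in> carrier K" "i k = ?k"
        unfolding exact by (metis imageE)
      obtain b d where b: "b \<noteq> 0" "k [^]\<^bsub>K\<^esub> (b::int) = zcomb K id d S"
        using spS k unfolding spanning_family_def by blast
      have "g [^]\<^bsub>G\<^esub> a = i k \<otimes>\<^bsub>G\<^esub> zcomb G s c T"
        using k g zc by (simp add: G.m_assoc)
      then have "(g [^]\<^bsub>G\<^esub> a) [^]\<^bsub>G\<^esub> b = (i k) [^]\<^bsub>G\<^esub> b \<otimes>\<^bsub>G\<^esub> (zcomb G s c T) [^]\<^bsub>G\<^esub> b"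
        using iG[OF k(1)] zc by (simp only: G.int_pow_distrib)
      also have "(i k) [^]\<^bsub>G\<^esub> b = i (zcomb K id d S)"
        using hom_int_pow[OF i(1) k(1) K.is_group G.is_group, of b] b by simp
      also have "\<dots> = zcomb G i d S"
        using K.hom_zcomb[OF groups(2) i(1) _ S(2), of id d] SK by (simp add: Pi_iff subset_iff)
      also have "(zcomb G s c T) [^]\<^bsub>G\<^esub> b = zcomb G s (\<lambda>t. c t * b) T"
        by (rule G.zcomb_pow[OF T(2) sT])
      also have "zcomb G i d S \<otimes>\<^bsub>G\<^esub> zcomb G s (\<lambda>t. c t * b) T
          = zcomb G (case_sum i s) (case_sum d (\<lambda>t. c t * b)) (S <+> T)"
        using G.zcomb_Plus[OF S(2) T(2) ist] by (simp add: o_def)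
      finally have "g [^]\<^bsub>G\<^esub> (a * b) = zcomb G (case_sum i s) (case_sum d (\<lambda>t. c t * b)) (S <+> T)"
        using g by (simp add: G.int_pow_pow)
      then show "\<exists>a c. a \<noteq> 0 \<and> g [^]\<^bsub>G\<^esub> (a::int) = zcomb G (case_sum i s) c (S <+> T)"
        using a b by (metis mult_eq_0_iff)
    qed
    have card: "card (S <+> T) = card S + card T"
      using S T by (simp add: card_Plus)
    show ?thesis
    proof (rule enat_le_all_nat)
      fix n assume "enat n \<le> group_rank G"
      then obtain U where "indep_family G id U" "card U = n"
        using G.exists_indep_family_of_card by blast
      then show "enat n \<le> group_rank K + group_rank Q"
        using G.indep_card_le_spanning_card[OF _ span] S T card by fastforce
    qed
  qed auto
  have le: "enat (m + n) \<le> group_rank G" if mn: "enat m \<le> group_rank K" "enat n \<le> group_rank Q" for m n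
  proof -
    obtain S where S: "indep_family K id S" "card S = m"
      using mn K.exists_indep_family_of_card by blast
    obtain T where T: "indep_family Q id T" "card T = n"
      using mn Q.exists_indep_family_of_card by blast
    have fin: "finite S" "finite T" and SK: "S \<subseteq> carrier K" and TQ: "T \<subseteq> carrier Q"
      using S T by (auto simp: indep_family_def Pi_iff)
    have sT: "s \<in> T \<rightarrow> carrier G" using TQ s by auto
    have iS: "i \<in> S \<rightarrow> carrier G" using SK iG by auto
    have ist: "case_sum i s \<in> S <+> T \<rightarrow> carrier G"
      using SK TQ iG s by (auto simp: Plus_def)
    have "indep_family G (case_sum i s) (S <+> T)"
      unfolding indep_family_def
    proof (intro conjI allI impI)
      fix c assume "zcomb G (case_sum i s) c (S <+> T) = \<one>\<^bsub>G\<^esub>"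
      then have eq: "zcomb G i (c \<circ> Inl) S \<otimes>\<^bsub>G\<^esub> zcomb G s (c \<circ> Inr) T = \<one>\<^bsub>G\<^esub>"
        using G.zcomb_Plus[OF fin ist] by (simp add: o_def)
      have zS: "zcomb G i (c \<circ> Inl) S = i (zcomb K id (c \<circ> Inl) S)"
        using K.hom_zcomb[OF groups(2) i(1) _ fin(1), of id "c \<circ> Inl"] SK
        by (simp add: Pi_iff subset_iff)
      have zK: "zcomb K id (c \<circ> Inl) S \<in> carrier K"
        by (rule K.zcomb_closed) (use SK in auto)
      have zT: "j (zcomb G s (c \<circ> Inr) T) = zcomb Q id (c \<circ> Inr) T"
      proof -
        have "j (zcomb G s (c \<circ> Inr) T) = zcomb Q (j \<circ> s) (c \<circ> Inr) T"
          by (rule G.hom_zcomb[OF groups(3) j(1) sT fin(2)])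
        also have "\<dots> = zcomb Q id (c \<circ> Inr) T"
          using TQ s by (intro Q.zcomb_cong) auto
        finally show ?thesis .
      qed
      have zQ: "zcomb Q id (c \<circ> Inr) T \<in> carrier Q"
        by (rule Q.zcomb_closed) (use TQ in auto)
      have "j (zcomb G i (c \<circ> Inl) S \<otimes>\<^bsub>G\<^esub> zcomb G s (c \<circ> Inr) T) = \<one>\<^bsub>Q\<^esub>"
        using eq hom_one[OF j(1) G.is_group Q.is_group] by simp
      then have "zcomb Q id (c \<circ> Inr) T = \<one>\<^bsub>Q\<^esub>"
        using iG[OF zK] G.zcomb_closed[OF sT] zS zT ji[OF zK] zQ by simp
      then have cT: "\<forall>t\<in>T. c (Inr t) = 0"
        using indep_familyD[OF T(1), of "c \<circ> Inr"] by simp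
      then have "zcomb G s (c \<circ> Inr) T = zcomb G s (\<lambda>_. 0) T"
        using sT by (intro G.zcomb_cong) auto
      then have "i (zcomb K id (c \<circ> Inl) S) = i \<one>\<^bsub>K\<^esub>"
        using eq zS G.zcomb_zero[of s T] iG[OF zK] hom_one[OF i(1) K.is_group G.is_group] by simp
      then have "zcomb K id (c \<circ> Inl) S = \<one>\<^bsub>K\<^esub>"
        using i(2) zK by (simp add: inj_on_eq_iff)
      then have "\<forall>x\<in>S. c (Inl x) = 0"
        using indep_familyD[OF S(1), of "c \<circ> Inl"] by simp
      then show "\<forall>x\<in>S <+> T. c x = 0"
        using cT by (auto simp: Plus_def)
    qed (use fin ist in auto)
    from G.indep_family_card_le_rank[OF this] show ?thesis
      using S T fin by (simp add: card_Plus)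
  qed
  show "group_rank K + group_rank Q \<le> group_rank G"
  proof (rule enat_le_all_nat)
    fix n assume n: "enat n \<le> group_rank K + group_rank Q"
    consider "group_rank K = \<infinity>" | "group_rank Q = \<infinity>"
      | k q where "group_rank K = enat k" "group_rank Q = enat q"
      by (metis not_infinity_eq)
    then show "enat n \<le> group_rank G"
    proof cases
      case 1
      \<comment> \<open>One outer group of infinite rank supplies all \<open>n\<close> independent
        elements; the other contributes none.\<close>
      then show ?thesis using le[of n 0] by (simp add: zero_enat_def[symmetric])
    next
      case 2
      then show ?thesis using le[of 0 n] by (simp add: zero_enat_def[symmetric])
    next
      case 3
      then show ?thesis using le[of k q] n by (metis order_refl order_trans plus_enat_simps(1))
    qed
  qed
qed


section \<open>Discs and coherent topologies\<close>

lemma continuous_map_paste: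
  assumes "closedin X S" "closedin X T" "topspace X \<subseteq> S \<union> T"
    "continuous_map (subtopology X S) Y g" "continuous_map (subtopology X T) Y g"
  shows "continuous_map X Y g"
proof (rule pasting_lemma_closed[where I = "{S, T}" and T = id and f = "\<lambda>_. g"])
qed (use assms in auto)

abbreviation unit_interval :: "real topology" where
  "unit_interval \<equiv> top_of_set {0..1}"

lemma unit_disc_alt:
  "unit_disc n = subtopology (powertop_real UNIV) {x. (\<forall>i\<ge>n. x i = 0) \<and> (\<Sum>i<n. (x i)\<^sup>2) \<le> 1}"
  unfolding unit_disc_def Euclidean_space_def subtopology_subtopology
  by (simp add: Collect_conj_eq)

lemma topspace_unit_disc: "topspace (unit_disc n) = {x. (\<forall>i\<ge>n. x i = 0) \<and> (\<Sum>i<n. (x i)\<^sup>2) \<le> 1}"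
  unfolding unit_disc_alt by simp

lemma open_disc_eq: "open_disc n = {x. (\<forall>i\<ge>n. x i = 0) \<and> (\<Sum>i<n. (x i)\<^sup>2) < 1}"
  unfolding open_disc_def topspace_unit_disc by auto

lemma disc_boundary_eq: "disc_boundary n = {x. (\<forall>i\<ge>n. x i = 0) \<and> (\<Sum>i<n. (x i)\<^sup>2) = 1}"
  unfolding disc_boundary_def topspace_unit_disc by auto

lemma unit_disc_cases:
  "x \<in> topspace (unit_disc n) \<longleftrightarrow> x \<in> open_disc n \<or> x \<in> disc_boundary n"
  "x \<in> open_disc n \<Longrightarrow> x \<notin> disc_boundary n"
  unfolding topspace_unit_disc open_disc_eq disc_boundary_eq by auto

lemma continuous_map_into_unit_disc:
  "continuous_map Z (unit_disc n) f \<longleftrightarrow>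
    (\<forall>i. continuous_map Z euclideanreal (\<lambda>z. f z i)) \<and> f \<in> topspace Z \<rightarrow> topspace (unit_disc n)"
  unfolding unit_disc_alt continuous_map_in_subtopology continuous_map_componentwise_UNIV
  by (simp add: topspace_unit_disc)

lemma continuous_map_unit_disc_coord: "continuous_map (unit_disc n) euclideanreal (\<lambda>x. x i)"
  unfolding unit_disc_alt
  by (intro continuous_map_from_subtopology continuous_map_product_projection) simp

lemma continuous_map_unit_disc_sumsq: "continuous_map (unit_disc n) euclideanreal (\<lambda>x. \<Sum>i<n. (x i)\<^sup>2)"
  by (intro continuous_intros continuous_map_unit_disc_coord) simp

lemma openin_open_disc: "openin (unit_disc n) (open_disc n)"
proof -
  have "openin (unit_disc n) {x \<in> topspace (unit_disc n). (\<Sum>i<n. (x i)\<^sup>2) \<in> {..<1}}"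
    by (rule openin_continuous_map_preimage[OF continuous_map_unit_disc_sumsq]) simp
  then show ?thesis by (simp add: open_disc_def)
qed

lemma closedin_disc_boundary: "closedin (unit_disc n) (disc_boundary n)"
proof -
  have "closedin (unit_disc n) {x \<in> topspace (unit_disc n). (\<Sum>i<n. (x i)\<^sup>2) \<in> {1}}"
    by (rule closedin_continuous_map_preimage[OF continuous_map_unit_disc_sumsq]) simp
  then show ?thesis by (simp add: disc_boundary_def)
qed

text \<open>The open disc inherits the same topology from the disc, where the cells live, and from
  \<open>Euclidean_space n\<close>, where invariance of domain is applied.\<close>

lemma openin_Euclidean_open_disc:
  "openin (Euclidean_space n) (open_disc n)"
  "subtopology (Euclidean_space n) (open_disc n) = subtopology (unit_disc n) (open_disc n)"
proof -
  have "continuous_map (Euclidean_space n) euclideanreal (\<lambda>x. \<Sum>i<n. (x i)\<^sup>2)"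
    unfolding Euclidean_space_def
    by (intro continuous_intros continuous_map_from_subtopology continuous_map_product_projection) auto
  from openin_continuous_map_preimage[OF this, of "{..<1}"]
  show "openin (Euclidean_space n) (open_disc n)"
    by (simp add: open_disc_eq topspace_Euclidean_space)
  have "topspace (unit_disc n) \<inter> open_disc n = open_disc n"
    by (auto simp: open_disc_def)
  then show "subtopology (Euclidean_space n) (open_disc n) = subtopology (unit_disc n) (open_disc n)"
    unfolding unit_disc_def subtopology_subtopology
    by (metis (no_types, lifting) Int_commute inf_assoc subtopology_restrict topspace_subtopology subtopology_subtopology)
qed

lemma regular_space_unit_disc: "regular_space (unit_disc n)"
  unfolding unit_disc_alt
  by (rule regular_space_subtopology) (simp add: regular_space_product_topology regular_space_euclidean)

lemma Hausdorff_space_unit_disc: "Hausdorff_space (unit_disc n)"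
  unfolding unit_disc_def
  by (rule Hausdorff_space_subtopology) (rule Hausdorff_Euclidean_space)

lemma scale_unit_disc:
  assumes "x \<in> topspace (unit_disc n)" "t \<in> {0..1}"
  shows "(\<lambda>i. t * x i) \<in> topspace (unit_disc n)" "t < 1 \<Longrightarrow> (\<lambda>i. t * x i) \<in> open_disc n"
proof -
  have s: "(\<Sum>i<n. (t * x i)\<^sup>2) = t\<^sup>2 * (\<Sum>i<n. (x i)\<^sup>2)"
    by (simp add: power_mult_distrib sum_distrib_left)
  have t: "t\<^sup>2 \<le> 1" using assms by (simp add: power_le_one_iff abs_square_le_1)
  have x: "0 \<le> (\<Sum>i<n. (x i)\<^sup>2)" "(\<Sum>i<n. (x i)\<^sup>2) \<le> 1"
    using assms by (auto simp: topspace_unit_disc intro: sum_nonneg)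
  show "(\<lambda>i. t * x i) \<in> topspace (unit_disc n)"
    using assms x t mult_le_one[of "t\<^sup>2" "\<Sum>i<n. (x i)\<^sup>2"] by (auto simp: topspace_unit_disc s)
  assume "t < 1"
  then have "t\<^sup>2 < 1" using assms by (simp add: power_less_one_iff abs_square_less_1)
  then have "t\<^sup>2 * (\<Sum>i<n. (x i)\<^sup>2) < 1"
    using x by (metis mult_left_le zero_le_power2 order.strict_trans1)
  then show "(\<lambda>i. t * x i) \<in> open_disc n"
    using assms by (auto simp: topspace_unit_disc open_disc_eq s)
qed

lemma continuous_map_scale:
  assumes "x \<in> topspace (unit_disc n)"
  shows "continuous_map unit_interval (unit_disc n) (\<lambda>t i. t * x i)"
  unfolding continuous_map_into_unit_disc
proof (intro conjI allI)
  show "continuous_map unit_interval euclideanreal (\<lambda>t. t * x i)" for i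
    by (simp add: continuous_intros)
  show "(\<lambda>t i. t * x i) \<in> topspace unit_interval \<rightarrow> topspace (unit_disc n)"
    using scale_unit_disc(1)[OF assms] by auto
qed

text \<open>Density of the open disc: along the segment from the origin to \<open>x\<close>, the
  parameters that lead into \<open>T\<close> form a closed set containing all \<open>t < 1\<close>,
  hence also \<open>t = 1\<close>.\<close>

lemma closedin_unit_disc_superset:
  assumes T: "closedin (unit_disc n) T" and sub: "open_disc n \<subseteq> T"
  shows "T = topspace (unit_disc n)"
proof
  show "topspace (unit_disc n) \<subseteq> T"
  proof
    fix x assume x: "x \<in> topspace (unit_disc n)"
    have "closedin unit_interval {t \<in> topspace unit_interval. (\<lambda>i. t * x i) \<in> T}"
      by (rule closedin_continuous_map_preimage[OF continuous_map_scale[OF x] T])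
    then have cl: "closed {t \<in> {0..1}. (\<lambda>i. t * x i) \<in> T}"
      by (simp add: closedin_closed_eq)
    have "{0..<1} \<subseteq> {t \<in> {0..1}. (\<lambda>i. t * x i) \<in> T}"
      using scale_unit_disc(2)[OF x] sub by auto
    then have "closure {0..<1} \<subseteq> {t \<in> {0..1}. (\<lambda>i. t * x i) \<in> T}"
      using cl by (rule closure_minimal)
    then have "(1::real) \<in> {t \<in> {0..1}. (\<lambda>i. t * x i) \<in> T}"
      by (rule subsetD) simp
    then show "x \<in> T" by simp
  qed
qed (use T in \<open>simp add: closedin_subset\<close>)

text \<open>The open disc is star-shaped: it is a union of segments that share the origin.\<close>

lemma connectedin_open_disc: "connectedin (unit_disc n) (open_disc n)"
proof -
  let ?seg = "\<lambda>x. (\<lambda>t i. t * x i) ` {0..1::real}"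
  have disc: "x \<in> topspace (unit_disc n)" if "x \<in> open_disc n" for x
    using that by (simp add: open_disc_def)
  have 1: "connectedin (unit_disc n) S" if S: "S \<in> ?seg ` open_disc n" for S
  proof -
    obtain x where x: "x \<in> open_disc n" "S = ?seg x" using S by (elim imageE)
    have "connectedin unit_interval {0..1}" by (simp add: connectedin_subtopology)
    then show ?thesis
      unfolding x(2) using connectedin_continuous_map_image[OF continuous_map_scale[OF disc[OF x(1)]]] by blast
  qed
  have "(\<lambda>_. 0) \<in> S" if "S \<in> ?seg ` open_disc n" for S
    using that by (auto intro!: image_eqI[of _ _ 0])
  then have "(\<lambda>_. 0) \<in> \<Inter>(?seg ` open_disc n)"
    by (rule InterI)
  then have "\<Inter>(?seg ` open_disc n) \<noteq> {}"
    by (rule ex_in_conv[THEN iffD1, OF exI])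
  then have "connectedin (unit_disc n) (\<Union>(?seg ` open_disc n))"
    by (intro connectedin_Union 1)
  moreover have "\<Union>(?seg ` open_disc n) = open_disc n"
  proof
    show "\<Union>(?seg ` open_disc n) \<subseteq> open_disc n"
    proof clarify
      fix x and t :: real assume x: "x \<in> open_disc n" and t: "t \<in> {0..1}"
      show "(\<lambda>i. t * x i) \<in> open_disc n"
      proof (cases "t = 1")
        case False
        then show ?thesis using scale_unit_disc(2)[OF disc[OF x] t] t by auto
      qed (use x in simp)
    qed
    show "open_disc n \<subseteq> \<Union>(?seg ` open_disc n)"
      by (force intro: image_eqI[of _ _ 1])
  qed
  ultimately show ?thesis by simp
qed

text \<open>The map below is the radial projection of the cylinder over the disc from the point at height
  2 on its axis.\<close>

lemma disc_cylinder_retraction: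
  obtains \<rho> where
    "continuous_map (prod_topology unit_interval (unit_disc n)) (prod_topology unit_interval (unit_disc n)) \<rho>"
    "\<And>x. x \<in> topspace (unit_disc n) \<Longrightarrow> \<rho> (0, x) = (0, x)"
    "\<And>t x. \<lbrakk>t \<in> {0..1}; x \<in> disc_boundary n\<rbrakk> \<Longrightarrow> \<rho> (t, x) = (t, x)"
    "\<And>t x. \<lbrakk>t \<in> {0..1}; x \<in> topspace (unit_disc n)\<rbrakk> \<Longrightarrow>
       fst (\<rho> (t, x)) = 0 \<or> snd (\<rho> (t, x)) \<in> disc_boundary n"
proof -
  \<comment> \<open>The ray from height 2 on the axis through \<open>(t, x)\<close> consists of the
    points \<open>(2 - l * (2 - t), l * x)\<close>. It reaches the bottom at
    \<open>l = 2 / (2 - t)\<close> and the side at \<open>l = 1 / m x\<close>. The smaller value is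
    \<open>c\<close>, and \<open>u\<close> is the height reached there.\<close>
  define m where "m x = sqrt (\<Sum>i<n. (x i)\<^sup>2)" for x :: "nat \<Rightarrow> real"
  \<comment> \<open>The truncation keeps the denominator away from zero without changing the
    projection: if \<open>m x \<le> 1/2\<close>, the ray reaches the bottom no later than the side,
    because \<open>t \<le> 1\<close> gives \<open>2 / (2 - t) \<le> 2\<close>.\<close>
  define M where "M x = max (m x) (1/2)" for x
  define u where "u p = max 0 (2 - (2 - fst p) / M (snd p))" for p
  define c where "c p = min (2 / (2 - fst p)) (1 / M (snd p))" for p
  define \<rho> where "\<rho> p = (u p, \<lambda>i. c p * snd p i)" for p :: "real \<times> (nat \<Rightarrow> real)"
  let ?P = "prod_topology unit_interval (unit_disc n)"
  have m: "0 \<le> m x" "m x \<le> 1" "(m x)\<^sup>2 = (\<Sum>i<n. (x i)\<^sup>2)"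
    if "x \<in> topspace (unit_disc n)" for x
    using that by (auto simp: m_def topspace_unit_disc sum_nonneg)
  have M: "1/2 \<le> M x" "M x \<le> 1" "m x \<le> M x" if "x \<in> topspace (unit_disc n)" for x
    using m[OF that] by (auto simp: M_def)
  have contfst: "continuous_map ?P euclideanreal fst"
    using continuous_map_fst continuous_map_into_fulltopology by blast
  have contx: "continuous_map ?P euclideanreal (\<lambda>p. snd p i)" for i
    using continuous_map_compose[OF continuous_map_snd continuous_map_unit_disc_coord]
    by (simp add: o_def)
  have contM: "continuous_map ?P euclideanreal (\<lambda>p. M (snd p))"
    unfolding M_def m_def by (intro continuous_intros contx) simp
  have Mpos: "M x > 0" for x by (simp add: M_def)
  have contu: "continuous_map ?P euclideanreal u"
    unfolding u_def using Mpos
    by (intro continuous_intros contM contfst) (metis less_irrefl)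
  have contc: "continuous_map ?P euclideanreal c"
    unfolding c_def using Mpos
    by (intro continuous_intros contM contfst) (force, metis less_irrefl)
  have u01: "u (t, x) \<in> {0..1}" if t: "t \<in> {0..1}" and x: "x \<in> topspace (unit_disc n)" for t x
  proof -
    have "(2 - t) * M x \<le> 2 - t" using M[OF x] t by (simp add: mult_left_le)
    then have "2 - t \<le> (2 - t) / M x" using Mpos[of x] by (simp add: field_simps)
    then show ?thesis using t by (auto simp: u_def)
  qed
  have sq: "(\<Sum>i<n. (a * x i)\<^sup>2) = (a * m x)\<^sup>2" if x: "x \<in> topspace (unit_disc n)" for a x
    by (simp add: power_mult_distrib sum_distrib_left m(3)[OF x])
  have c0: "0 \<le> c (t, x)" "c (t, x) * m x \<le> 1" if t: "t \<in> {0..1}" and x: "x \<in> topspace (unit_disc n)" for t x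
  proof -
    show "0 \<le> c (t, x)" using t Mpos[of x] by (auto simp: c_def)
    have "c (t, x) * m x \<le> 1 / M x * m x"
      by (rule mult_right_mono) (auto simp: c_def m[OF x])
    also have "\<dots> \<le> 1" using M[OF x] Mpos[of x] by (simp add: field_simps)
    finally show "c (t, x) * m x \<le> 1" .
  qed
  have cx: "(\<lambda>i. c (t, x) * x i) \<in> topspace (unit_disc n)"
    if t: "t \<in> {0..1}" and x: "x \<in> topspace (unit_disc n)" for t x
    using x c0[OF t x] m[OF x] by (auto simp: topspace_unit_disc sq[OF x] power_le_one)
  show ?thesis
  proof (rule that[of \<rho>])
    show "continuous_map ?P ?P \<rho>"
      unfolding \<rho>_def continuous_map_pairwise o_def fst_conv snd_conv continuous_map_in_subtopology
        continuous_map_into_unit_disc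
      using u01 cx by (auto simp: contu intro!: continuous_map_real_mult contc contx)
    show "\<rho> (0, x) = (0, x)" if x: "x \<in> topspace (unit_disc n)" for x
    proof -
      have "1 / M x \<ge> 1" using M[OF x] Mpos[of x] by (simp add: field_simps)
      then show ?thesis by (auto simp: \<rho>_def u_def c_def)
    qed
    show "\<rho> (t, x) = (t, x)" if t: "t \<in> {0..1}" and x: "x \<in> disc_boundary n" for t x
    proof -
      have "m x = 1" using x by (simp add: m_def disc_boundary_eq)
      then have "M x = 1" by (simp add: M_def)
      moreover have "2 / (2 - t) \<ge> 1" using t by (simp add: field_simps)
      ultimately show ?thesis using t by (auto simp: \<rho>_def u_def c_def)
    qed
    show "fst (\<rho> (t, x)) = 0 \<or> snd (\<rho> (t, x)) \<in> disc_boundary n"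
      if t: "t \<in> {0..1}" and x: "x \<in> topspace (unit_disc n)" for t x
    proof (cases "u (t, x) = 0")
      case False
      then have "(2 - t) / M x < 2" by (auto simp: u_def)
      then have *: "2 - t < 2 * M x" using Mpos[of x] by (simp add: field_simps)
      then have "M x > 1/2" using t by auto
      then have eq: "M x = m x" by (auto simp: M_def)
      have "1 / M x \<le> 2 / (2 - t)" using * t Mpos[of x] by (simp add: field_simps)
      then have "c (t, x) * m x = 1" using eq Mpos[of x] by (auto simp: c_def)
      then have "(\<Sum>i<n. (c (t, x) * x i)\<^sup>2) = 1" by (simp only: sq[OF x]) simp
      then show ?thesis using x by (auto simp: \<rho>_def disc_boundary_eq topspace_unit_disc)
    qed (simp add: \<rho>_def)
  qed
qed

section \<open>Final topologies for jointly surjective families of maps, and their products with a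
  compact space\<close>

definition coherent :: "'a topology \<Rightarrow> ('b topology \<times> ('b \<Rightarrow> 'a)) set \<Rightarrow> bool" where
  "coherent X F \<longleftrightarrow>
     (\<forall>(Z, g)\<in>F. continuous_map Z X g) \<and>
     (\<forall>x\<in>topspace X. \<exists>(Z, g)\<in>F. x \<in> g ` topspace Z) \<and>
     (\<forall>S\<subseteq>topspace X. (\<forall>(Z, g)\<in>F. openin Z {z \<in> topspace Z. g z \<in> S}) \<longrightarrow> openin X S)"

lemma coherent_continuous_map: "\<lbrakk>coherent X F; (Z, g) \<in> F\<rbrakk> \<Longrightarrow> continuous_map Z X g"
  by (auto simp: coherent_def)

lemma coherent_cover:
  assumes "coherent X F" "x \<in> topspace X"
  obtains Z g z where "(Z, g) \<in> F" "z \<in> topspace Z" "x = g z"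
  using assms unfolding coherent_def by fastforce

lemma coherent_openin:
  assumes F: "coherent X F" and S: "S \<subseteq> topspace X"
    and op: "\<And>Z g. (Z, g) \<in> F \<Longrightarrow> openin Z {z \<in> topspace Z. g z \<in> S}"
  shows "openin X S"
proof -
  have "\<forall>(Z, g)\<in>F. openin Z {z \<in> topspace Z. g z \<in> S}"
    using op by auto
  with F S show ?thesis by (simp add: coherent_def)
qed

lemma coherentI_closedin:
  assumes cont: "\<And>Z g. (Z, g) \<in> F \<Longrightarrow> continuous_map Z X g"
    and cover: "\<And>x. x \<in> topspace X \<Longrightarrow> \<exists>(Z, g)\<in>F. x \<in> g ` topspace Z"
    and closed: "\<And>S. \<lbrakk>S \<subseteq> topspace X; \<And>Z g. (Z, g) \<in> F \<Longrightarrow> closedin Z {z \<in> topspace Z. g z \<in> S}\<rbrakk> \<Longrightarrow>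
      closedin X S"
  shows "coherent X F"
  unfolding coherent_def
proof (intro conjI allI impI)
  fix S assume S: "S \<subseteq> topspace X" and op: "\<forall>(Z, g)\<in>F. openin Z {z \<in> topspace Z. g z \<in> S}"
  have "closedin X (topspace X - S)"
  proof (rule closed)
    fix Z g assume Zg: "(Z, g) \<in> F"
    have "{z \<in> topspace Z. g z \<in> topspace X - S} = topspace Z - {z \<in> topspace Z. g z \<in> S}"
      using continuous_map_funspace[OF cont[OF Zg]] by auto
    then show "closedin Z {z \<in> topspace Z. g z \<in> topspace X - S}"
      using op Zg by auto
  qed auto
  then show "openin X S" using S by (simp add: openin_closedin)
qed (use cont cover in auto)

lemma continuous_map_coherent:
  assumes "coherent X F" "\<And>Z g. (Z, g) \<in> F \<Longrightarrow> continuous_map Z Y (h \<circ> g)"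
  shows "continuous_map X Y h"
  unfolding continuous_map_def
proof (intro conjI allI impI)
  show "h \<in> topspace X \<rightarrow> topspace Y"
  proof
    fix x assume "x \<in> topspace X"
    with assms(1) obtain Z g z where "(Z, g) \<in> F" "z \<in> topspace Z" "x = g z"
      by (rule coherent_cover)
    then show "h x \<in> topspace Y"
      using continuous_map_funspace[OF assms(2)] by fastforce
  qed
next
  fix U assume U: "openin Y U"
  have "openin Z {z \<in> topspace Z. g z \<in> {x \<in> topspace X. h x \<in> U}}" if "(Z, g) \<in> F" for Z g
  proof -
    have "continuous_map Z X g" using assms(1) that by (rule coherent_continuous_map)
    then have "{z \<in> topspace Z. g z \<in> {x \<in> topspace X. h x \<in> U}} = {z \<in> topspace Z. (h \<circ> g) z \<in> U}"
      using continuous_map_funspace by fastforce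
    then show ?thesis using openin_continuous_map_preimage[OF assms(2)[OF that] U] by simp
  qed
  then show "openin X {x \<in> topspace X. h x \<in> U}"
    by (intro coherent_openin[OF assms(1)]) auto
qed

text \<open>Whitehead's argument that crossing with a compact regular space preserves quotient maps.
  The slice of \<open>W\<close> through \<open>(t0, x0)\<close> is open in \<open>K\<close>, so by
  regularity it contains a compact neighbourhood \<open>L\<close> of \<open>t0\<close>. The tube
  lemma then shows that the points \<open>x\<close> with \<open>L \<times> {x}\<close> inside
  \<open>W\<close> form an open set.\<close>

lemma coherent_prod:
  assumes F: "coherent X F" and K: "compact_space K" "regular_space K"
  shows "coherent (prod_topology K X) ((\<lambda>(Z, g). (prod_topology K Z, \<lambda>(t, z). (t, g z))) ` F)"
proof -
  have cont: "continuous_map Z X g" if "(Z, g) \<in> F" for Z g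
    using F that by (rule coherent_continuous_map)
  have cont': "continuous_map (prod_topology K Z) (prod_topology K X) (\<lambda>(t, z). (t, g z))"
    if "(Z, g) \<in> F" for Z g
    using continuous_map_compose[OF continuous_map_snd cont[OF that]]
    by (auto simp: continuous_map_pairwise o_def case_prod_unfold continuous_map_fst)
  show ?thesis
    unfolding coherent_def
  proof (intro conjI allI impI)
    show "\<forall>x\<in>topspace (prod_topology K X).
        \<exists>(Z, g)\<in>(\<lambda>(Z, g). (prod_topology K Z, \<lambda>(t, z). (t, g z))) ` F. x \<in> g ` topspace Z"
    proof clarsimp
      fix t x assume t: "t \<in> topspace K" "x \<in> topspace X"
      from F t(2) obtain Z g z where "(Z, g) \<in> F" "z \<in> topspace Z" "x = g z"
        by (rule coherent_cover)
      then show "\<exists>p\<in>F. case case p of (Z, g) \<Rightarrow> (prod_topology K Z, \<lambda>(t, z). (t, g z)) of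
          (Z, g) \<Rightarrow> (t, x) \<in> g ` topspace Z"
        using t by (force intro: bexI[of _ "(Z, g)"])
    qed
    fix W assume W: "W \<subseteq> topspace (prod_topology K X)" and
      op: "\<forall>(Z, g)\<in>(\<lambda>(Z, g). (prod_topology K Z, \<lambda>(t, z). (t, g z))) ` F.
              openin Z {z \<in> topspace Z. g z \<in> W}"
    have opW: "openin (prod_topology K Z) {p \<in> topspace (prod_topology K Z). (fst p, g (snd p)) \<in> W}"
      if "(Z, g) \<in> F" for Z g
      using bspec[OF op imageI[OF that]] by (simp add: case_prod_unfold)
    show "openin (prod_topology K X) W"
      unfolding openin_prod_topology_alt
    proof (intro allI impI)
      fix t0 x0 assume tx: "(t0, x0) \<in> W"
      then have t0: "t0 \<in> topspace K" and x0: "x0 \<in> topspace X" using W by auto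
      from F x0 obtain Z0 g0 z0 where z0: "(Z0, g0) \<in> F" "z0 \<in> topspace Z0" "x0 = g0 z0"
        by (rule coherent_cover)
      have "continuous_map K (prod_topology K Z0) (\<lambda>t. (t, z0))"
        using z0 by (simp add: continuous_map_pairwise o_def)
      from openin_continuous_map_preimage[OF this opW[OF z0(1)]]
      have "openin K {t \<in> topspace K. (t, x0) \<in> W}"
        using z0 by (simp cong: conj_cong)
      then obtain U L where UL: "openin K U" "closedin K L" "t0 \<in> U" "U \<subseteq> L"
        "L \<subseteq> {t \<in> topspace K. (t, x0) \<in> W}"
        using K(2) t0 tx unfolding neighbourhood_base_of_closedin[symmetric] neighbourhood_base_of
        by (smt (verit) mem_Collect_eq)
      have L: "compactin K L" using K(1) UL(2) by (rule closedin_compact_space)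
      define V where "V = {x \<in> topspace X. \<forall>t\<in>L. (t, x) \<in> W}"
      have "openin Z {z \<in> topspace Z. g z \<in> V}" if Zg: "(Z, g) \<in> F" for Z g
      proof (subst openin_subopen, intro ballI)
        fix z assume z: "z \<in> {z \<in> topspace Z. g z \<in> V}"
        then have "L \<times> {z} \<subseteq> {p \<in> topspace (prod_topology K Z). (fst p, g (snd p)) \<in> W}"
          using UL(5) by (auto simp: V_def)
        from tube_lemma_left[OF opW[OF Zg] L _ this] z
        obtain A B where AB: "openin K A" "openin Z B" "L \<subseteq> A" "z \<in> B"
          "A \<times> B \<subseteq> {p \<in> topspace (prod_topology K Z). (fst p, g (snd p)) \<in> W}" by blast
        have "B \<subseteq> {z \<in> topspace Z. g z \<in> V}"
          using AB openin_subset[OF AB(2)] continuous_map_funspace[OF cont[OF Zg]]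
          by (fastforce simp: V_def)
        then show "\<exists>T. openin Z T \<and> z \<in> T \<and> T \<subseteq> {z \<in> topspace Z. g z \<in> V}"
          using AB by blast
      qed
      then have "openin X V"
        by (intro coherent_openin[OF F]) (auto simp: V_def)
      moreover have "x0 \<in> V" using UL(5) x0 by (auto simp: V_def)
      moreover have "U \<times> V \<subseteq> W" using UL(4) by (auto simp: V_def)
      ultimately show "\<exists>U V. openin K U \<and> openin X V \<and> t0 \<in> U \<and> x0 \<in> V \<and> U \<times> V \<subseteq> W"
        using UL by blast
    qed
  qed (use cont' in auto)
qed


section \<open>Complexes with chosen cells\<close>

text \<open>The skeleton one dimension down, empty below dimension 0, so that 0-cells are treated as
  discs attached to the empty set.\<close>

definition lower :: "(nat \<Rightarrow> 'a set) \<Rightarrow> nat \<Rightarrow> 'a set" where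
  "lower sk k = (case k of 0 \<Rightarrow> {} | Suc j \<Rightarrow> sk j)"

lemma lower_simps [simp]: "lower sk 0 = {}" "lower sk (Suc k) = sk k"
  by (simp_all add: lower_def)

text \<open>A complex with its characteristic maps chosen, and with closedness always tested in
  \<open>X\<close> rather than in nested subspaces. Only one direction of the two closedness
  criteria is assumed; the converses follow from continuity of the cells and closedness of the
  skeleta.\<close>

locale cell_complex =
  fixes X :: "'a topology" and sk :: "nat \<Rightarrow> 'a set" and \<Phi> :: "nat \<Rightarrow> ((nat \<Rightarrow> real) \<Rightarrow> 'a) set"
  assumes Union_sk: "(\<Union>k. sk k) = topspace X"
    and sk_Suc: "sk k \<subseteq> sk (Suc k)"
    and cell_continuous: "\<phi> \<in> \<Phi> k \<Longrightarrow> continuous_map (unit_disc k) X \<phi>"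
    and cell_boundary: "\<lbrakk>\<phi> \<in> \<Phi> k; x \<in> disc_boundary k\<rbrakk> \<Longrightarrow> \<phi> x \<in> lower sk k"
    and cell_bij: "bij_betw (\<lambda>(\<phi>, x). \<phi> x) (\<Phi> k \<times> open_disc k) (sk k - lower sk k)"
    and closedin_stage: "\<lbrakk>S \<subseteq> sk k; closedin X (S \<inter> lower sk k);
        \<And>\<phi>. \<phi> \<in> \<Phi> k \<Longrightarrow> closedin (unit_disc k) {x \<in> topspace (unit_disc k). \<phi> x \<in> S}\<rbrakk>
        \<Longrightarrow> closedin X S"
    and closedin_weak: "\<lbrakk>S \<subseteq> topspace X; \<And>k. closedin X (S \<inter> sk k)\<rbrakk> \<Longrightarrow> closedin X S"
begin

lemma sk_subset: "sk k \<subseteq> topspace X"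
  using Union_sk by blast

lemma sk_mono: "j \<le> k \<Longrightarrow> sk j \<subseteq> sk k"
  using sk_Suc by (rule lift_Suc_mono_le)

lemma lower_subset: "lower sk k \<subseteq> sk k"
  using sk_Suc by (cases k) auto

lemma lower_mono: "j \<le> k \<Longrightarrow> lower sk j \<subseteq> lower sk k"
  using sk_mono by (cases j; cases k) auto

lemma sk_subset_lower: "j < k \<Longrightarrow> sk j \<subseteq> lower sk k"
  using sk_mono by (cases k) auto

lemma cell_open:
  assumes "\<phi> \<in> \<Phi> k" "x \<in> open_disc k"
  shows "\<phi> x \<in> sk k" "\<phi> x \<notin> lower sk k"
  using bij_betwE[OF cell_bij[of k]] assms by auto

lemma cell_in_sk:
  assumes "\<phi> \<in> \<Phi> k" "x \<in> topspace (unit_disc k)"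
  shows "\<phi> x \<in> sk k"
  using assms cell_open(1) cell_boundary lower_subset[of k] unit_disc_cases(1)[of x k] by blast

lemma cell_inj:
  assumes "\<phi> \<in> \<Phi> k" "\<psi> \<in> \<Phi> k" "x \<in> open_disc k" "y \<in> open_disc k" "\<phi> x = \<psi> y"
  shows "\<phi> = \<psi>" "x = y"
  using inj_onD[OF bij_betw_imp_inj_on[OF cell_bij[of k]], of "(\<phi>, x)" "(\<psi>, y)"] assms by simp_all

lemma cell_cases:
  assumes "y \<in> sk k" "y \<notin> lower sk k"
  obtains \<phi> x where "\<phi> \<in> \<Phi> k" "x \<in> open_disc k" "y = \<phi> x"
proof -
  have "y \<in> (\<lambda>(\<phi>, x). \<phi> x) ` (\<Phi> k \<times> open_disc k)"
    using assms bij_betw_imp_surj_on[OF cell_bij[of k]] by simp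
  then show ?thesis using that by auto
qed

lemma closedin_sk: "closedin X (sk k)"
proof (induction k)
  case 0
  show ?case
  proof (rule closedin_stage[OF subset_refl])
    fix \<phi> assume "\<phi> \<in> \<Phi> 0"
    then have "{x \<in> topspace (unit_disc 0). \<phi> x \<in> sk 0} = topspace (unit_disc 0)"
      using cell_in_sk by blast
    then show "closedin (unit_disc 0) {x \<in> topspace (unit_disc 0). \<phi> x \<in> sk 0}"
      by simp
  qed simp
next
  case (Suc k)
  show ?case
  proof (rule closedin_stage[OF subset_refl])
    fix \<phi> assume "\<phi> \<in> \<Phi> (Suc k)"
    then have "{x \<in> topspace (unit_disc (Suc k)). \<phi> x \<in> sk (Suc k)} = topspace (unit_disc (Suc k))"
      using cell_in_sk by blast
    then show "closedin (unit_disc (Suc k)) {x \<in> topspace (unit_disc (Suc k)). \<phi> x \<in> sk (Suc k)}"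
      by simp
  next
    have "sk (Suc k) \<inter> lower sk (Suc k) = sk k" using sk_Suc by auto
    then show "closedin X (sk (Suc k) \<inter> lower sk (Suc k))" using Suc by simp
  qed
qed

lemma closedin_lower: "closedin X (lower sk k)"
  using closedin_sk by (cases k) auto

lemma cell_cover:
  assumes "y \<in> lower sk k"
  obtains j \<phi> x where "j < k" "\<phi> \<in> \<Phi> j" "x \<in> open_disc j" "y = \<phi> x"
proof -
  define j where "j = (LEAST j. y \<in> sk j)"
  have ex: "\<exists>j<k. y \<in> sk j" using assms by (cases k) auto
  then have j: "y \<in> sk j" "j < k"
    unfolding j_def by (auto intro: LeastI order.strict_trans1[OF Least_le])
  have "y \<notin> lower sk j"
  proof (cases j)
    case (Suc i)
    then show ?thesis using not_less_Least[of i "\<lambda>j. y \<in> sk j"] by (simp add: j_def)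
  qed simp
  then show ?thesis using that j cell_cases by metis
qed

lemma closedin_lower_coherent:
  assumes "S \<subseteq> lower sk k"
    "\<And>j \<phi>. \<lbrakk>j < k; \<phi> \<in> \<Phi> j\<rbrakk> \<Longrightarrow> closedin (unit_disc j) {x \<in> topspace (unit_disc j). \<phi> x \<in> S}"
  shows "closedin X S"
  using assms
proof (induction k arbitrary: S)
  case 0
  then show ?case by simp
next
  case (Suc k)
  show ?case
  proof (rule closedin_stage)
    show "S \<subseteq> sk k" using Suc.prems by simp
    show "closedin X (S \<inter> lower sk k)"
    proof (rule Suc.IH)
      fix j \<phi> assume j: "j < k" "\<phi> \<in> \<Phi> j"
      then have "{x \<in> topspace (unit_disc j). \<phi> x \<in> S \<inter> lower sk k}
          = {x \<in> topspace (unit_disc j). \<phi> x \<in> S}"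
        using cell_in_sk sk_subset_lower by blast
      then show "closedin (unit_disc j) {x \<in> topspace (unit_disc j). \<phi> x \<in> S \<inter> lower sk k}"
        using Suc.prems(2) j by simp
    qed simp
  qed (use Suc.prems in simp)
qed

text \<open>The finite-stage version of \<open>coherent_cells\<close>, for maps that are constructed
  one skeleton at a time.\<close>

lemma coherent_lower:
  "coherent (subtopology X (lower sk k)) {(unit_disc j, \<phi>) | j \<phi>. j < k \<and> \<phi> \<in> \<Phi> j}"
proof (rule coherentI_closedin)
  fix Z g assume "(Z, g) \<in> {(unit_disc j, \<phi>) | j \<phi>. j < k \<and> \<phi> \<in> \<Phi> j}"
  then obtain j where "Z = unit_disc j" "j < k" "g \<in> \<Phi> j" by blast
  then show "continuous_map Z (subtopology X (lower sk k)) g"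
    using cell_continuous cell_in_sk sk_subset_lower
    by (auto simp: continuous_map_in_subtopology subset_iff)
next
  fix x assume "x \<in> topspace (subtopology X (lower sk k))"
  then obtain j \<phi> z where "j < k" "\<phi> \<in> \<Phi> j" "z \<in> open_disc j" "x = \<phi> z"
    using cell_cover by (metis IntD2 topspace_subtopology)
  then show "\<exists>(Z, g)\<in>{(unit_disc j, \<phi>) | j \<phi>. j < k \<and> \<phi> \<in> \<Phi> j}. x \<in> g ` topspace Z"
    by (intro bexI[of _ "(unit_disc j, \<phi>)"]) (auto simp: unit_disc_cases)
next
  fix S assume "S \<subseteq> topspace (subtopology X (lower sk k))"
    and cl: "\<And>Z g. (Z, g) \<in> {(unit_disc j, \<phi>) | j \<phi>. j < k \<and> \<phi> \<in> \<Phi> j} \<Longrightarrow>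
      closedin Z {z \<in> topspace Z. g z \<in> S}"
  then have S: "S \<subseteq> lower sk k" by simp
  have "closedin X S"
    using S by (rule closedin_lower_coherent) (use cl in blast)
  then show "closedin (subtopology X (lower sk k)) S"
    using S by (rule closedin_subset_topspace)
qed

lemma coherent_cells: "coherent X {(unit_disc j, \<phi>) | j \<phi>. \<phi> \<in> \<Phi> j}"
proof (rule coherentI_closedin)
  fix Z g assume "(Z, g) \<in> {(unit_disc j, \<phi>) | j \<phi>. \<phi> \<in> \<Phi> j}"
  then show "continuous_map Z X g" using cell_continuous by blast
next
  fix x assume "x \<in> topspace X"
  then obtain k where "x \<in> lower sk (Suc k)" using Union_sk by auto
  then obtain j \<phi> z where "\<phi> \<in> \<Phi> j" "z \<in> open_disc j" "x = \<phi> z"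
    using cell_cover by metis
  then show "\<exists>(Z, g)\<in>{(unit_disc j, \<phi>) | j \<phi>. \<phi> \<in> \<Phi> j}. x \<in> g ` topspace Z"
    by (intro bexI[of _ "(unit_disc j, \<phi>)"]) (auto simp: unit_disc_cases)
next
  fix S assume S: "S \<subseteq> topspace X"
    and cl: "\<And>Z g. (Z, g) \<in> {(unit_disc j, \<phi>) | j \<phi>. \<phi> \<in> \<Phi> j} \<Longrightarrow>
      closedin Z {z \<in> topspace Z. g z \<in> S}"
  show "closedin X S"
  proof (rule closedin_weak[OF S])
    fix k
    show "closedin X (S \<inter> sk k)"
    proof (rule closedin_lower_coherent[of _ "Suc k"])
      fix j \<phi> assume j: "j < Suc k" "\<phi> \<in> \<Phi> j"
      then have "{x \<in> topspace (unit_disc j). \<phi> x \<in> S \<inter> sk k} = {x \<in> topspace (unit_disc j). \<phi> x \<in> S}"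
        using cell_in_sk[OF j(2)] sk_subset_lower[OF j(1)] by auto
      then show "closedin (unit_disc j) {x \<in> topspace (unit_disc j). \<phi> x \<in> S \<inter> sk k}"
        using cl j by auto
    qed simp
  qed
qed

text \<open>The complement is closed when tested on cells: no other \<open>k\<close>-cell meets the
  image of \<open>U\<close>, and boundary points go to the lower skeleton, so the only proper
  preimage is the complement of \<open>U\<close> in the disc of \<open>\<phi>\<close>
  itself.\<close>

lemma openin_cell_image:
  assumes \<phi>: "\<phi> \<in> \<Phi> k" and U: "openin (unit_disc k) U" "U \<subseteq> open_disc k"
  shows "openin (subtopology X (sk k)) (\<phi> ` U)"
proof -
  have sub: "\<phi> ` U \<subseteq> sk k" using cell_open(1)[OF \<phi>] U by auto
  have "closedin X (sk k - \<phi> ` U)"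
  proof (rule closedin_stage)
    have "(sk k - \<phi> ` U) \<inter> lower sk k = lower sk k"
      using cell_open(2)[OF \<phi>] U lower_subset by auto
    then show "closedin X ((sk k - \<phi> ` U) \<inter> lower sk k)" using closedin_lower by simp
    fix \<psi> assume \<psi>: "\<psi> \<in> \<Phi> k"
    show "closedin (unit_disc k) {x \<in> topspace (unit_disc k). \<psi> x \<in> sk k - \<phi> ` U}"
    proof (cases "\<psi> = \<phi>")
      case True
      have "x \<in> U" if "x \<in> topspace (unit_disc k)" "\<phi> x = \<phi> y" "y \<in> U" for x y
      proof -
        have "y \<in> open_disc k" using that U by auto
        then have "x \<in> open_disc k"
          using that cell_open(2)[OF \<phi>] cell_boundary[OF \<phi>] unit_disc_cases(1) by metis
        then show ?thesis using cell_inj(2)[OF \<phi> \<phi>] that U by blast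
      qed
      then have "{x \<in> topspace (unit_disc k). \<psi> x \<in> sk k - \<phi> ` U} = topspace (unit_disc k) - U"
        using True cell_in_sk[OF \<phi>] by auto
      then show ?thesis using closedin_diff[OF closedin_topspace U(1)] by simp
    next
      case False
      have "\<psi> x \<noteq> \<phi> y" if "x \<in> topspace (unit_disc k)" "y \<in> U" for x y
        using that False U cell_inj(1)[OF \<psi> \<phi>] cell_boundary[OF \<psi>] cell_open(2)[OF \<phi>]
          unit_disc_cases(1) by (metis subsetD)
      then have "{x \<in> topspace (unit_disc k). \<psi> x \<in> sk k - \<phi> ` U} = topspace (unit_disc k)"
        using cell_in_sk[OF \<psi>] by auto
      then show ?thesis by simp
    qed
  qed auto
  then have "closedin (subtopology X (sk k)) (sk k - \<phi> ` U)"
    by (rule closedin_subset_topspace) auto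
  then show ?thesis
    using sub sk_subset by (simp add: openin_closedin_eq Int_absorb1)
qed

lemma closedin_cell_image:
  assumes \<phi>: "\<phi> \<in> \<Phi> k" and L: "closedin (unit_disc k) L" "L \<subseteq> open_disc k"
  shows "closedin X (\<phi> ` L)"
proof (rule closedin_stage)
  show "\<phi> ` L \<subseteq> sk k" using cell_open(1)[OF \<phi>] L by auto
  have "\<phi> ` L \<inter> lower sk k = {}" using cell_open(2)[OF \<phi>] L by auto
  then show "closedin X (\<phi> ` L \<inter> lower sk k)" by simp
  fix \<psi> assume \<psi>: "\<psi> \<in> \<Phi> k"
  have *: "\<psi> = \<phi> \<and> x \<in> L" if "x \<in> topspace (unit_disc k)" "\<psi> x = \<phi> y" "y \<in> L" for x y
  proof -
    have y: "y \<in> open_disc k" using that L by auto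
    then have "x \<in> open_disc k"
      using that cell_open(2)[OF \<phi>] cell_boundary[OF \<psi>] unit_disc_cases(1) by metis
    then show ?thesis using cell_inj[OF \<psi> \<phi> _ y] that by blast
  qed
  show "closedin (unit_disc k) {x \<in> topspace (unit_disc k). \<psi> x \<in> \<phi> ` L}"
  proof (cases "\<psi> = \<phi>")
    case True
    then have "{x \<in> topspace (unit_disc k). \<psi> x \<in> \<phi> ` L} = L"
      using * closedin_subset[OF L(1)] by auto
    then show ?thesis using L by simp
  next
    case False
    then have "{x \<in> topspace (unit_disc k). \<psi> x \<in> \<phi> ` L} = {}"
      using * by auto
    then show ?thesis by (simp only: closedin_empty)
  qed
qed

text \<open>Together with \<open>openin_cell_image\<close> this makes every open
  \<open>k\<close>-cell both open and closed in the \<open>k\<close>-skeleton without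
  \<open>lower sk k\<close>, so a connected set there stays within one cell.\<close>

lemma closedin_lower_Un_cell:
  assumes \<phi>: "\<phi> \<in> \<Phi> k"
  shows "closedin X (lower sk k \<union> \<phi> ` open_disc k)"
proof (rule closedin_stage)
  show "lower sk k \<union> \<phi> ` open_disc k \<subseteq> sk k"
    using cell_open(1)[OF \<phi>] lower_subset by auto
  show "closedin X ((lower sk k \<union> \<phi> ` open_disc k) \<inter> lower sk k)"
    by (simp add: Int_absorb1 closedin_lower)
  fix \<psi> assume \<psi>: "\<psi> \<in> \<Phi> k"
  show "closedin (unit_disc k) {x \<in> topspace (unit_disc k). \<psi> x \<in> lower sk k \<union> \<phi> ` open_disc k}"
  proof (cases "\<psi> = \<phi>")
    case True
    then have "{x \<in> topspace (unit_disc k). \<psi> x \<in> lower sk k \<union> \<phi> ` open_disc k} = topspace (unit_disc k)"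
      using cell_boundary[OF \<phi>] by (auto simp: unit_disc_cases)
    then show ?thesis by simp
  next
    case False
    then have "{x \<in> topspace (unit_disc k). \<psi> x \<in> lower sk k \<union> \<phi> ` open_disc k} = disc_boundary k"
      using cell_boundary[OF \<psi>] cell_open(2)[OF \<psi>] cell_inj(1)[OF \<psi> \<phi>]
      by (auto simp: unit_disc_cases)
    then show ?thesis by (simp add: closedin_disc_boundary)
  qed
qed

end

text \<open>The definition tests closedness inside skeleta, the locale inside \<open>X\<close>; the
  bridge is that skeleta are closed. Each is closed in the next one, because its preimage in every
  attached disc is the boundary sphere; by transitivity it is closed in all later ones, and hence in
  \<open>X\<close>.\<close>

lemma CW_complex_cells:
  assumes "CW_complex (X, sk)"
  obtains \<Phi> where "cell_complex X sk \<Phi>"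
proof -
  have Un: "(\<Union>k. sk k) = topspace X"
    and disc: "subtopology X (sk 0) = discrete_topology (sk 0)"
    and Suc: "\<And>k. sk k \<subseteq> sk (Suc k)"
    and att: "\<And>k. arises_by_attaching_cells (Suc k) (subtopology X (sk (Suc k))) (sk k)"
    and weak: "\<And>S. S \<subseteq> topspace X \<Longrightarrow>
      closedin X S \<longleftrightarrow> (\<forall>k. closedin (subtopology X (sk k)) (S \<inter> sk k))"
    using assms unfolding CW_complex_def by auto
  have sub: "sk k \<subseteq> topspace X" for k using Un by blast
  have top: "topspace (subtopology X (sk k)) = sk k" for k
    using sub by (simp add: Int_absorb1)
  have subsub: "subtopology (subtopology X (sk (Suc k))) (sk k) = subtopology X (sk k)" for k
    using Suc[of k] by (simp add: subtopology_subtopology Int_absorb1)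
  let ?Q = "\<lambda>k \<Psi>. (\<forall>\<phi> \<in> \<Psi>. continuous_map (unit_disc (Suc k)) (subtopology X (sk (Suc k))) \<phi> \<and>
          \<phi> ` disc_boundary (Suc k) \<subseteq> sk k) \<and>
        bij_betw (\<lambda>(\<phi>, x). \<phi> x) (\<Psi> \<times> open_disc (Suc k)) (sk (Suc k) - sk k) \<and>
        (\<forall>S \<subseteq> sk (Suc k).
           closedin (subtopology X (sk (Suc k))) S \<longleftrightarrow>
             closedin (subtopology X (sk k)) (S \<inter> sk k) \<and>
             (\<forall>\<phi> \<in> \<Psi>. closedin (unit_disc (Suc k)) {x \<in> topspace (unit_disc (Suc k)). \<phi> x \<in> S}))"
  have "\<forall>k. \<exists>\<Psi>. ?Q k \<Psi>"
  proof
    fix k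
    show "\<exists>\<Psi>. ?Q k \<Psi>"
      using att[of k] unfolding arises_by_attaching_cells_def top subsub by (rule conjunct2)
  qed
  from choice[OF this] obtain \<Psi> where Q: "\<forall>k. ?Q k (\<Psi> k)" ..
  have \<Psi>: "continuous_map (unit_disc (Suc k)) (subtopology X (sk (Suc k))) \<phi>"
      "\<phi> ` disc_boundary (Suc k) \<subseteq> sk k" if "\<phi> \<in> \<Psi> k" for k \<phi>
    using Q[rule_format, of k] that by blast+
  have \<Psi>_bij: "bij_betw (\<lambda>(\<phi>, x). \<phi> x) (\<Psi> k \<times> open_disc (Suc k)) (sk (Suc k) - sk k)" for k
    using Q[rule_format, of k] by blast
  have \<Psi>_closed: "closedin (subtopology X (sk (Suc k))) S \<longleftrightarrow>
        closedin (subtopology X (sk k)) (S \<inter> sk k) \<and>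
        (\<forall>\<phi> \<in> \<Psi> k. closedin (unit_disc (Suc k)) {x \<in> topspace (unit_disc (Suc k)). \<phi> x \<in> S})"
    if "S \<subseteq> sk (Suc k)" for k S
    using Q[rule_format, of k] that by blast
  have step: "closedin (subtopology X (sk (Suc k))) (sk k)" for k
  proof -
    have "{x \<in> topspace (unit_disc (Suc k)). \<phi> x \<in> sk k} = disc_boundary (Suc k)" if "\<phi> \<in> \<Psi> k" for \<phi>
    proof -
      have "\<phi> x \<notin> sk k" if "x \<in> open_disc (Suc k)" for x
        using bij_betwE[OF \<Psi>_bij[of k]] that \<open>\<phi> \<in> \<Psi> k\<close> by auto
      then show ?thesis using \<Psi>(2)[OF that] by (auto simp: unit_disc_cases)
    qed
    moreover have "closedin (subtopology X (sk k)) (sk k \<inter> sk k)"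
      using closedin_topspace[of "subtopology X (sk k)"] unfolding top by simp
    ultimately show ?thesis
      using \<Psi>_closed[OF Suc[of k]] by (simp add: closedin_disc_boundary)
  qed
  have up: "closedin (subtopology X (sk (k + j))) (sk k)" for k j
  proof (induction j)
    case 0
    then show ?case using closedin_topspace[of "subtopology X (sk k)"] unfolding top by simp
  next
    case (Suc j)
    then show ?case
      using closedin_trans_full[of "subtopology X (sk (Suc (k + j)))" "sk (k + j)" "sk k"]
        step[of "k + j"] by (simp add: subsub)
  qed
  have mono: "sk i \<subseteq> sk j" if "i \<le> j" for i j
    using Suc that by (rule lift_Suc_mono_le)
  have cl: "closedin X (sk k)" for k
    unfolding weak[OF sub]
  proof
    fix j
    show "closedin (subtopology X (sk j)) (sk k \<inter> sk j)"
    proof (cases "j \<le> k")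
      case True
      then show ?thesis
        using closedin_topspace[of "subtopology X (sk j)"] mono[OF True] unfolding top
        by (simp add: Int_absorb1)
    next
      case False
      then obtain i where i: "j = k + i" by (metis le_iff_add nat_le_linear)
      have "sk k \<subseteq> sk j" using mono False by simp
      then show ?thesis using up[of k i] i by (simp add: Int_absorb2)
    qed
  qed
  have clsub: "closedin (subtopology X (sk k)) S \<longleftrightarrow> closedin X S \<and> S \<subseteq> sk k" for k S
    using closedin_closed_subtopology[OF cl] .
  \<comment> \<open>Each point of the 0-skeleton becomes a 0-cell with a constant characteristic
    map: the disc of dimension 0 is a single point and has empty boundary.\<close>
  define \<Phi> where "\<Phi> k = (case k of 0 \<Rightarrow> (\<lambda>x _. x) ` sk 0 | Suc j \<Rightarrow> \<Psi> j)" for k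
  have disc0: "open_disc 0 = {\<lambda>_. 0}" "disc_boundary 0 = {}" "topspace (unit_disc 0) = {\<lambda>_. 0}"
    by (auto simp: open_disc_eq disc_boundary_eq topspace_unit_disc)
  have "cell_complex X sk \<Phi>"
  proof
    show "(\<Union>k. sk k) = topspace X" by fact
    fix k
    show "sk k \<subseteq> sk (Suc k)" by fact
    show "bij_betw (\<lambda>(\<phi>, x). \<phi> x) (\<Phi> k \<times> open_disc k) (sk k - lower sk k)"
    proof (cases k)
      case 0
      have "inj_on (\<lambda>(\<phi>, x). \<phi> x) (((\<lambda>x _. x) ` sk 0) \<times> {\<lambda>_. 0 :: real})"
        by (auto simp: inj_on_def)
      moreover have "(\<lambda>(\<phi>, x). \<phi> x) ` (((\<lambda>x _. x) ` sk 0) \<times> {\<lambda>_. 0 :: real}) = sk 0"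
        by force
      ultimately show ?thesis
        by (simp add: 0 \<Phi>_def disc0 bij_betw_def)
    qed (use \<Psi>_bij in \<open>simp add: \<Phi>_def\<close>)
  next
    fix k \<phi> assume "\<phi> \<in> \<Phi> k"
    then show "continuous_map (unit_disc k) X \<phi>"
      using \<Psi>(1) by (cases k) (auto simp: \<Phi>_def continuous_map_in_subtopology dest: subsetD[OF sub])
  next
    fix k \<phi> x assume "\<phi> \<in> \<Phi> k" "x \<in> disc_boundary k"
    then show "\<phi> x \<in> lower sk k"
      using \<Psi>(2) by (cases k) (auto simp: \<Phi>_def disc0)
  next
    fix S k assume S: "S \<subseteq> sk k" "closedin X (S \<inter> lower sk k)"
      "\<And>\<phi>. \<phi> \<in> \<Phi> k \<Longrightarrow> closedin (unit_disc k) {x \<in> topspace (unit_disc k). \<phi> x \<in> S}"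
    show "closedin X S"
    proof (cases k)
      case 0
      then have "closedin (subtopology X (sk 0)) S" using disc S(1) by simp
      then show ?thesis by (simp add: clsub)
    next
      case (Suc j)
      then have "closedin (subtopology X (sk (Suc j))) S"
        using S \<Psi>_closed[of S j] by (simp add: clsub \<Phi>_def)
      then show ?thesis by (simp add: clsub)
    qed
  next
    fix S assume "S \<subseteq> topspace X" "\<And>k. closedin X (S \<inter> sk k)"
    then show "closedin X S" using weak by (simp add: clsub)
  qed
  then show ?thesis by (rule that)
qed

text \<open>The way back, which makes the glued space an object of \<open>CW\<close>. In dimension 0
  the discs are points, so every subset of the 0-skeleton is closed, and the 0-skeleton is
  discrete.\<close>

lemma (in cell_complex) CW_complex: "CW_complex (X, sk)"
  unfolding CW_complex_def fst_conv snd_conv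
proof (intro conjI allI impI)
  show "(\<Union>k. sk k) = topspace X" by (rule Union_sk)
  have cl0: "closedin X S" if "S \<subseteq> sk 0" for S
  proof (rule closedin_stage[OF that])
    fix \<phi> assume "\<phi> \<in> \<Phi> 0"
    have "topspace (unit_disc 0) = {\<lambda>_. 0}" by (auto simp: topspace_unit_disc)
    then have "{x \<in> topspace (unit_disc 0). \<phi> x \<in> S} = {} \<or>
        {x \<in> topspace (unit_disc 0). \<phi> x \<in> S} = topspace (unit_disc 0)"
      by auto
    then show "closedin (unit_disc 0) {x \<in> topspace (unit_disc 0). \<phi> x \<in> S}"
      by (elim disjE) (simp_all only: closedin_empty closedin_topspace)
  qed simp
  have "openin (subtopology X (sk 0)) {x}" if "x \<in> sk 0" for x
  proof -
    have "closedin (subtopology X (sk 0)) (sk 0 - {x})"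
      by (rule closedin_subset_topspace[OF cl0]) auto
    then show ?thesis using that sk_subset[of 0]
      by (simp add: openin_closedin_eq Int_absorb1)
  qed
  then have "discrete_topology (sk 0) = subtopology X (sk 0)"
    using sk_subset[of 0] by (simp add: discrete_topology_unique Int_absorb1)
  then show "subtopology X (sk 0) = discrete_topology (sk 0)" ..
  fix k
  show "sk k \<subseteq> sk (Suc k)" by (rule sk_Suc)
  have top: "topspace (subtopology X (sk j)) = sk j" for j
    using sk_subset by (simp add: Int_absorb1)
  have subsub: "subtopology (subtopology X (sk (Suc k))) (sk k) = subtopology X (sk k)"
    using sk_Suc[of k] by (simp add: subtopology_subtopology Int_absorb1)
  have clsub: "closedin (subtopology X (sk j)) S \<longleftrightarrow> closedin X S \<and> S \<subseteq> sk j" for j S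
    using closedin_closed_subtopology[OF closedin_sk] .
  show "arises_by_attaching_cells (Suc k) (subtopology X (sk (Suc k))) (sk k)"
    unfolding arises_by_attaching_cells_def top subsub
  proof (intro conjI exI[of _ "\<Phi> (Suc k)"] ballI allI impI)
    show "sk k \<subseteq> sk (Suc k)" by (rule sk_Suc)
    show "bij_betw (\<lambda>(\<phi>, x). \<phi> x) (\<Phi> (Suc k) \<times> open_disc (Suc k)) (sk (Suc k) - sk k)"
      using cell_bij[of "Suc k"] by simp
    fix \<phi> assume \<phi>: "\<phi> \<in> \<Phi> (Suc k)"
    show "continuous_map (unit_disc (Suc k)) (subtopology X (sk (Suc k))) \<phi>"
      using cell_continuous[OF \<phi>] cell_in_sk[OF \<phi>] by (auto simp: continuous_map_in_subtopology)
    show "\<phi> ` disc_boundary (Suc k) \<subseteq> sk k"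
      using cell_boundary[OF \<phi>] by auto
  next
    fix S assume S: "S \<subseteq> sk (Suc k)"
    have "closedin (unit_disc (Suc k)) {x \<in> topspace (unit_disc (Suc k)). \<phi> x \<in> S}"
      if "closedin X S" "\<phi> \<in> \<Phi> (Suc k)" for \<phi>
      using closedin_continuous_map_preimage[OF cell_continuous] that by blast
    then show "closedin (subtopology X (sk (Suc k))) S \<longleftrightarrow>
        closedin (subtopology X (sk k)) (S \<inter> sk k) \<and>
        (\<forall>\<phi>\<in>\<Phi> (Suc k). closedin (unit_disc (Suc k)) {x \<in> topspace (unit_disc (Suc k)). \<phi> x \<in> S})"
      using S closedin_stage[of S "Suc k"] closedin_sk[of k] by (auto simp: clsub)
  qed
next
  fix S assume S: "S \<subseteq> topspace X"
  have clsub: "closedin (subtopology X (sk j)) T \<longleftrightarrow> closedin X T \<and> T \<subseteq> sk j" for j T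
    using closedin_closed_subtopology[OF closedin_sk] .
  show "closedin X S \<longleftrightarrow> (\<forall>k. closedin (subtopology X (sk k)) (S \<inter> sk k))"
    using closedin_weak[OF S] closedin_sk by (auto simp: clsub)
qed


section \<open>Homotopy extension for subcomplexes\<close>

context cell_complex
begin

text \<open>A retraction of the cylinder onto its bottom together with the cylinder over
  \<open>C\<close>, so far only over \<open>lower sk k\<close>. Values elsewhere are unconstrained,
  which leaves room for the next stage.\<close>

definition partial_cylinder_retraction :: "'a set \<Rightarrow> nat \<Rightarrow> (real \<times> 'a \<Rightarrow> real \<times> 'a) \<Rightarrow> bool" where
  "partial_cylinder_retraction C k R \<longleftrightarrow>
     continuous_map (prod_topology unit_interval (subtopology X (lower sk k))) (prod_topology unit_interval X) R \<and>
     (\<forall>y \<in> lower sk k. R (0, y) = (0, y)) \<and>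
     (\<forall>t \<in> {0..1}. \<forall>y \<in> lower sk k \<inter> C. R (t, y) = (t, y)) \<and>
     (\<forall>t \<in> {0..1}. \<forall>y \<in> lower sk k. fst (R (t, y)) = 0 \<or> snd (R (t, y)) \<in> C)"

lemma cell_prod_continuous:
  assumes "continuous_map Z Y \<phi>"
  shows "continuous_map (prod_topology unit_interval Z) (prod_topology unit_interval Y) (\<lambda>(t, z). (t, \<phi> z))"
  using continuous_map_compose[OF continuous_map_snd assms]
  by (auto simp: continuous_map_pairwise o_def case_prod_unfold continuous_map_fst)

text \<open>Since \<open>\<rho>\<close> lands in the bottom or the side of the cylinder over the
  disc, the two formulas can be pasted there. Where bottom and side meet they agree, as
  \<open>R\<close> fixes the bottom.\<close>

lemma cell_extension_continuous:
  assumes R: "partial_cylinder_retraction C k R" and \<phi>: "\<phi> \<in> \<Phi> k"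
    and \<rho>: "continuous_map (prod_topology unit_interval (unit_disc k)) (prod_topology unit_interval (unit_disc k)) \<rho>"
      "\<And>t x. \<lbrakk>t \<in> {0..1}; x \<in> topspace (unit_disc k)\<rbrakk> \<Longrightarrow>
         fst (\<rho> (t, x)) = 0 \<or> snd (\<rho> (t, x)) \<in> disc_boundary k"
  shows "continuous_map (prod_topology unit_interval (unit_disc k)) (prod_topology unit_interval X)
    (\<lambda>p. if fst (\<rho> p) = 0 then (0, \<phi> (snd (\<rho> p))) else R (fst (\<rho> p), \<phi> (snd (\<rho> p))))"
proof -
  let ?P = "prod_topology unit_interval (unit_disc k)"
  let ?F = "\<lambda>p. if fst p = 0 then (0, \<phi> (snd p)) else R (fst p, \<phi> (snd p))"
  define T where "T = {p \<in> topspace ?P. fst p = 0 \<or> snd p \<in> disc_boundary k}"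
  define T0 where "T0 = {p \<in> topspace ?P. fst p = 0}"
  define T1 where "T1 = {p \<in> topspace ?P. snd p \<in> disc_boundary k}"
  have cT0: "closedin ?P T0"
  proof -
    have "closedin ?P {p \<in> topspace ?P. fst p \<in> {0}}"
      by (rule closedin_continuous_map_preimage[OF continuous_map_fst]) (simp add: closedin_subset_topspace)
    then show ?thesis by (simp add: T0_def)
  qed
  have cT1: "closedin ?P T1"
    unfolding T1_def by (rule closedin_continuous_map_preimage[OF continuous_map_snd closedin_disc_boundary])
  have T: "T = T0 \<union> T1" by (auto simp: T_def T0_def T1_def)
  have subsub: "subtopology (subtopology ?P T) T0 = subtopology ?P T0"
      "subtopology (subtopology ?P T) T1 = subtopology ?P T1"
    by (simp_all add: subtopology_subtopology T Int_absorb1)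
  have top: "topspace (subtopology ?P T0) = T0" "topspace (subtopology ?P T1) = T1"
    using closedin_subset[OF cT0] closedin_subset[OF cT1] by (simp_all add: Int_absorb1)
  have F0: "continuous_map (subtopology ?P T0) (prod_topology unit_interval X) ?F"
  proof (rule continuous_map_eq)
    show "continuous_map (subtopology ?P T0) (prod_topology unit_interval X) (\<lambda>(t, z). (t, \<phi> z))"
      by (intro continuous_map_from_subtopology cell_prod_continuous cell_continuous \<phi>)
    show "(\<lambda>(t, z). (t, \<phi> z)) p = ?F p" if "p \<in> topspace (subtopology ?P T0)" for p
      using that unfolding top by (simp add: T0_def case_prod_unfold)
  qed
  have R_cont: "continuous_map (prod_topology unit_interval (subtopology X (lower sk k))) (prod_topology unit_interval X) R"
    and R0: "\<And>y. y \<in> lower sk k \<Longrightarrow> R (0, y) = (0, y)"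
    using R unfolding partial_cylinder_retraction_def by auto
  have F1: "continuous_map (subtopology ?P T1) (prod_topology unit_interval X) ?F"
  proof (rule continuous_map_eq)
    have "continuous_map (subtopology ?P T1) (prod_topology unit_interval X) (\<lambda>(t, z). (t, \<phi> z))"
      by (intro continuous_map_from_subtopology cell_prod_continuous cell_continuous \<phi>)
    then have "continuous_map (subtopology ?P T1) (prod_topology unit_interval (subtopology X (lower sk k)))
        (\<lambda>(t, z). (t, \<phi> z))"
      using cell_boundary[OF \<phi>]
      by (auto simp: continuous_map_pairwise continuous_map_in_subtopology o_def case_prod_unfold T1_def)
    from continuous_map_compose[OF this R_cont]
    show "continuous_map (subtopology ?P T1) (prod_topology unit_interval X) (R \<circ> (\<lambda>(t, z). (t, \<phi> z)))" .
    show "(R \<circ> (\<lambda>(t, z). (t, \<phi> z))) p = ?F p" if "p \<in> topspace (subtopology ?P T1)" for p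
      using that R0 cell_boundary[OF \<phi>] unfolding top by (auto simp: T1_def case_prod_unfold)
  qed
  have "continuous_map (subtopology ?P T) (prod_topology unit_interval X) ?F"
  proof (rule continuous_map_paste[where S = T0 and T = T1])
    show "closedin (subtopology ?P T) T0" "closedin (subtopology ?P T) T1"
      using cT0 cT1 by (auto intro: closedin_subset_topspace simp: T)
    show "topspace (subtopology ?P T) \<subseteq> T0 \<union> T1" by (simp add: T)
  qed (use F0 F1 in \<open>simp_all add: subsub\<close>)
  moreover have "continuous_map ?P (subtopology ?P T) \<rho>"
  proof -
    have "\<rho> p \<in> T" if "p \<in> topspace ?P" for p
      using \<rho>(2)[of "fst p" "snd p"] that funcset_mem[OF continuous_map_funspace[OF \<rho>(1)] that]
      by (auto simp: T_def)
    then show ?thesis using \<rho>(1) by (simp add: continuous_map_in_subtopology)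
  qed
  ultimately show ?thesis
    using continuous_map_compose[of ?P "subtopology ?P T" \<rho> _ ?F] by (simp add: o_def)
qed

text \<open>Over a cell inside \<open>C\<close> nothing may move. Over any other cell
  \<open>\<rho>\<close> pushes the cylinder over the disc to its bottom and side; the bottom is
  mapped by the characteristic map and the side by \<open>R\<close>, which is already defined there.
  By \<open>coherent_prod\<close>, continuity can be checked over each disc.\<close>

lemma partial_cylinder_retraction_step:
  assumes C: "closedin X C"
    and cells: "\<And>k \<phi>. \<phi> \<in> \<Phi> k \<Longrightarrow> \<phi> ` open_disc k \<subseteq> C \<or> \<phi> ` open_disc k \<inter> C = {}"
    and R: "partial_cylinder_retraction C k R"
  shows "\<exists>R'. partial_cylinder_retraction C (Suc k) R' \<and>
    (\<forall>t \<in> {0..1}. \<forall>y \<in> lower sk k. R' (t, y) = R (t, y))"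
proof -
  obtain \<rho> where \<rho>:
    "continuous_map (prod_topology unit_interval (unit_disc k)) (prod_topology unit_interval (unit_disc k)) \<rho>"
    "\<And>x. x \<in> topspace (unit_disc k) \<Longrightarrow> \<rho> (0, x) = (0, x)"
    "\<And>t x. \<lbrakk>t \<in> {0..1}; x \<in> disc_boundary k\<rbrakk> \<Longrightarrow> \<rho> (t, x) = (t, x)"
    "\<And>t x. \<lbrakk>t \<in> {0..1}; x \<in> topspace (unit_disc k)\<rbrakk> \<Longrightarrow>
       fst (\<rho> (t, x)) = 0 \<or> snd (\<rho> (t, x)) \<in> disc_boundary k"
    by (rule disc_cylinder_retraction[of k]) (rule that)
  define E where "E \<phi> p = (if fst (\<rho> p) = 0 then (0, \<phi> (snd (\<rho> p))) else R (fst (\<rho> p), \<phi> (snd (\<rho> p))))"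
    for \<phi> p
  \<comment> \<open>Recovers from a point of an open \<open>k\<close>-cell the cell and the
    parameter in its disc.\<close>
  define coord where "coord = inv_into (\<Phi> k \<times> open_disc k) (\<lambda>(\<phi>, x). \<phi> x)"
  define R' where "R' p = (if snd p \<in> lower sk k then R p else if snd p \<in> C then p
      else E (fst (coord (snd p))) (fst p, snd (coord (snd p))))" for p
  have R_cont: "continuous_map (prod_topology unit_interval (subtopology X (lower sk k))) (prod_topology unit_interval X) R"
    and R0: "\<And>y. y \<in> lower sk k \<Longrightarrow> R (0, y) = (0, y)"
    and RC: "\<And>t y. \<lbrakk>t \<in> {0..1}; y \<in> lower sk k; y \<in> C\<rbrakk> \<Longrightarrow> R (t, y) = (t, y)"
    and Rim: "\<And>t y. \<lbrakk>t \<in> {0..1}; y \<in> lower sk k\<rbrakk> \<Longrightarrow> fst (R (t, y)) = 0 \<or> snd (R (t, y)) \<in> C"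
    using R unfolding partial_cylinder_retraction_def by auto
  have \<rho>top: "fst (\<rho> (t, x)) \<in> {0..1}" "snd (\<rho> (t, x)) \<in> topspace (unit_disc k)"
    if "t \<in> {0..1}" "x \<in> topspace (unit_disc k)" for t x
  proof -
    have "\<rho> (t, x) \<in> topspace (prod_topology unit_interval (unit_disc k))"
      using funcset_mem[OF continuous_map_funspace[OF \<rho>(1)], of "(t, x)"] that by simp
    then show "fst (\<rho> (t, x)) \<in> {0..1}" "snd (\<rho> (t, x)) \<in> topspace (unit_disc k)"
      by (auto simp: mem_Times_iff)
  qed
  \<comment> \<open>A closed set containing the open cell contains the image of the closed disc, as
    the open disc is dense.\<close>
  have in_C: "\<phi> x \<in> C" if \<phi>: "\<phi> \<in> \<Phi> k" "\<phi> ` open_disc k \<subseteq> C" and x: "x \<in> topspace (unit_disc k)" for \<phi> x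
  proof -
    have "{x \<in> topspace (unit_disc k). \<phi> x \<in> C} = topspace (unit_disc k)"
      by (rule closedin_unit_disc_superset[OF closedin_continuous_map_preimage[OF cell_continuous[OF \<phi>(1)] C]])
        (use \<phi>(2) unit_disc_cases(1) in blast)
    then show ?thesis using x by blast
  qed
  have coord: "coord (\<phi> x) = (\<phi>, x)" if "\<phi> \<in> \<Phi> k" "x \<in> open_disc k" for \<phi> x
    using inv_into_f_f[OF bij_betw_imp_inj_on[OF cell_bij[of k]], of "(\<phi>, x)"] that by (simp add: coord_def)
  have R'_C: "R' (t, \<phi> x) = (t, \<phi> x)"
    if "\<phi> \<in> \<Phi> k" "\<phi> ` open_disc k \<subseteq> C" "t \<in> {0..1}" "x \<in> topspace (unit_disc k)" for \<phi> t x
    using in_C[OF that(1,2,4)] RC[OF that(3)] by (simp add: R'_def)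
  have R'_E: "R' (t, \<phi> x) = E \<phi> (t, x)"
    if \<phi>: "\<phi> \<in> \<Phi> k" "\<phi> ` open_disc k \<inter> C = {}" and t: "t \<in> {0..1}" and x: "x \<in> topspace (unit_disc k)" for \<phi> t x
  proof (cases "x \<in> open_disc k")
    case True
    then have "\<phi> x \<notin> lower sk k" "\<phi> x \<notin> C" using cell_open(2)[OF \<phi>(1)] \<phi>(2) by auto
    then show ?thesis by (simp add: R'_def coord[OF \<phi>(1) True])
  next
    case False
    then have x: "x \<in> disc_boundary k" using x unit_disc_cases(1) by blast
    then have "\<phi> x \<in> lower sk k" using cell_boundary[OF \<phi>(1)] by simp
    \<comment> \<open>On the boundary \<open>\<rho>\<close> is the identity, so the new formula
      reduces to the old \<open>R\<close> there; at \<open>t = 0\<close> this uses that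
      \<open>R\<close> fixes the bottom.\<close>
    moreover have "E \<phi> (t, x) = (if t = 0 then (0, \<phi> x) else R (t, \<phi> x))"
      unfolding E_def \<rho>(3)[OF t x] by simp
    ultimately show ?thesis using R0 by (simp add: R'_def)
  qed
  have R'_low: "R' (t, y) = R (t, y)" if "y \<in> lower sk k" for t y
    using that by (simp add: R'_def)
  have point: "(t = 0 \<longrightarrow> R' (t, y) = (t, y)) \<and> (y \<in> C \<longrightarrow> R' (t, y) = (t, y)) \<and>
      (fst (R' (t, y)) = 0 \<or> snd (R' (t, y)) \<in> C)"
    if t: "t \<in> {0..1}" and y: "y \<in> sk k" for t y
  proof (cases "y \<in> lower sk k")
    case True
    then show ?thesis using R0[OF True] RC[OF t True] Rim[OF t True] by (simp add: R'_low)
  next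
    case False
    then obtain \<phi> x where \<phi>: "\<phi> \<in> \<Phi> k" and x: "x \<in> open_disc k" and yx: "y = \<phi> x"
      using cell_cases[OF y] by metis
    have xd: "x \<in> topspace (unit_disc k)" using x unit_disc_cases(1) by blast
    show ?thesis
    proof (cases "\<phi> ` open_disc k \<subseteq> C")
      case True
      then show ?thesis using R'_C[OF \<phi> True t xd] in_C[OF \<phi> True xd] by (auto simp: yx)
    next
      case False
      then have dis: "\<phi> ` open_disc k \<inter> C = {}" using cells[OF \<phi>] by blast
      have yC: "\<phi> x \<notin> C" using x dis by blast
      have E: "R' (t, y) = E \<phi> (t, x)" using R'_E[OF \<phi> dis t xd] yx by simp
      have "fst (E \<phi> (t, x)) = 0 \<or> snd (E \<phi> (t, x)) \<in> C"
      proof (cases "fst (\<rho> (t, x)) = 0")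
        case False
        then have "snd (\<rho> (t, x)) \<in> disc_boundary k" using \<rho>(4)[OF t xd] by blast
        then have "\<phi> (snd (\<rho> (t, x))) \<in> lower sk k" by (rule cell_boundary[OF \<phi>])
        then show ?thesis using Rim[OF \<rho>top(1)[OF t xd]] False by (simp add: E_def)
      qed (simp add: E_def)
      moreover have "t = 0 \<longrightarrow> E \<phi> (t, x) = (t, y)"
        using \<rho>(2)[OF xd] by (simp add: E_def yx)
      ultimately show ?thesis using E yC yx by auto
    qed
  qed
  have "continuous_map (prod_topology unit_interval (subtopology X (lower sk (Suc k)))) (prod_topology unit_interval X) R'"
  proof (rule continuous_map_coherent[OF coherent_prod[OF coherent_lower]])
    show "compact_space unit_interval" by (simp add: compact_space_subtopology)
    show "regular_space unit_interval"
      by (intro regular_space_subtopology regular_space_euclidean)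
    fix Z :: "(real \<times> (nat \<Rightarrow> real)) topology" and g :: "real \<times> (nat \<Rightarrow> real) \<Rightarrow> real \<times> 'a"
    assume "(Z, g) \<in> (\<lambda>(Z, g). (prod_topology unit_interval Z, \<lambda>(t, z). (t, g z))) `
      {(unit_disc j, \<phi>) | j \<phi>. j < Suc k \<and> \<phi> \<in> \<Phi> j}"
    then obtain j \<phi> where j: "j < Suc k" "\<phi> \<in> \<Phi> j"
      and Z: "Z = prod_topology unit_interval (unit_disc j)" "g = (\<lambda>(t, z). (t, \<phi> z))" by auto
    have cont: "continuous_map Z (prod_topology unit_interval X) g"
      unfolding Z by (intro cell_prod_continuous cell_continuous j)
    show "continuous_map Z (prod_topology unit_interval X) (R' \<circ> g)"
    proof (cases "j = k")
      case False
      then have jk: "j < k" using j by simp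
      have im: "\<phi> z \<in> lower sk k" if "z \<in> topspace (unit_disc j)" for z
        using cell_in_sk[OF j(2) that] sk_subset_lower[OF jk] by blast
      have "continuous_map (unit_disc j) (subtopology X (lower sk k)) \<phi>"
        using cell_continuous[OF j(2)] im by (auto simp: continuous_map_in_subtopology)
      then have "continuous_map Z (prod_topology unit_interval (subtopology X (lower sk k))) g"
        unfolding Z by (rule cell_prod_continuous)
      then have "continuous_map Z (prod_topology unit_interval X) (R \<circ> g)"
        using R_cont by (rule continuous_map_compose)
      then show ?thesis
        by (rule continuous_map_eq) (auto simp: Z R'_low im)
    next
      case True
      then have \<phi>: "\<phi> \<in> \<Phi> k" using j by simp
      show ?thesis
      proof (cases "\<phi> ` open_disc k \<subseteq> C")
        case True
        show ?thesis
          by (rule continuous_map_eq[OF cont]) (auto simp: Z \<open>j = k\<close> R'_C[OF \<phi> True])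
      next
        case False
        then have dis: "\<phi> ` open_disc k \<inter> C = {}" using cells[OF \<phi>] by blast
        have "continuous_map Z (prod_topology unit_interval X) (E \<phi>)"
          unfolding Z \<open>j = k\<close> E_def using R \<phi> \<rho>(1,4) by (rule cell_extension_continuous)
        then show ?thesis
          by (rule continuous_map_eq) (auto simp: Z \<open>j = k\<close> R'_E[OF \<phi> dis])
      qed
    qed
  qed
  then have "partial_cylinder_retraction C (Suc k) R'"
    unfolding partial_cylinder_retraction_def using point point[of 0] by auto
  then show ?thesis using R'_low by blast
qed

text \<open>The stages extend one another, so they have a common extension, which is continuous
  because each cell lies in a finite stage.\<close>

lemma subcomplex_cylinder_retraction:
  assumes C: "closedin X C"
    and cells: "\<And>k \<phi>. \<phi> \<in> \<Phi> k \<Longrightarrow> \<phi> ` open_disc k \<subseteq> C \<or> \<phi> ` open_disc k \<inter> C = {}"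
  obtains R where "continuous_map (prod_topology unit_interval X) (prod_topology unit_interval X) R"
    "\<And>x. x \<in> topspace X \<Longrightarrow> R (0, x) = (0, x)"
    "\<And>t x. \<lbrakk>t \<in> {0..1}; x \<in> C\<rbrakk> \<Longrightarrow> R (t, x) = (t, x)"
    "\<And>t x. \<lbrakk>t \<in> {0..1}; x \<in> topspace X\<rbrakk> \<Longrightarrow> fst (R (t, x)) = 0 \<or> snd (R (t, x)) \<in> C"
proof -
  have base: "\<exists>R. partial_cylinder_retraction C 0 R"
    unfolding partial_cylinder_retraction_def by (simp add: continuous_map_on_empty)
  have "\<exists>f. \<forall>n. partial_cylinder_retraction C n (f n) \<and>
      (\<forall>t \<in> {0..1}. \<forall>y \<in> lower sk n. f (Suc n) (t, y) = f n (t, y))"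
    by (rule dependent_nat_choice[where P = "partial_cylinder_retraction C" and
          Q = "\<lambda>n R R'. \<forall>t \<in> {0..1}. \<forall>y \<in> lower sk n. R' (t, y) = R (t, y)", OF base]) (rule partial_cylinder_retraction_step[OF C cells])
  then obtain f where f: "\<And>n. partial_cylinder_retraction C n (f n)"
      "\<And>n t y. \<lbrakk>t \<in> {0..1}; y \<in> lower sk n\<rbrakk> \<Longrightarrow> f (Suc n) (t, y) = f n (t, y)"
    by blast
  have stable: "f (n + m) (t, y) = f n (t, y)" if "t \<in> {0..1}" "y \<in> lower sk n" for n m t y
  proof (induction m)
    case (Suc m)
    have "y \<in> lower sk (n + m)" using that lower_mono[of n "n + m"] by auto
    then show ?case using f(2)[OF that(1)] Suc by simp
  qed simp
  define R where "R p = f (LEAST n. snd p \<in> lower sk n) p" for p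
  have R: "R (t, y) = f n (t, y)" if t: "t \<in> {0..1}" and y: "y \<in> lower sk n" for n t y
  proof -
    let ?m = "LEAST n. y \<in> lower sk n"
    have "y \<in> lower sk ?m" using y by (rule LeastI)
    moreover have "?m \<le> n" using y by (rule Least_le)
    ultimately show ?thesis using stable[OF t, of y ?m "n - ?m"] by (simp add: R_def)
  qed
  have cover: "\<exists>n. y \<in> lower sk n" if "y \<in> topspace X" for y
  proof -
    obtain k where "y \<in> sk k" using \<open>y \<in> topspace X\<close> Union_sk by auto
    then show ?thesis by (intro exI[of _ "Suc k"]) simp
  qed
  show ?thesis
  proof (rule that[of R])
    show "continuous_map (prod_topology unit_interval X) (prod_topology unit_interval X) R"
    proof (rule continuous_map_coherent[OF coherent_prod[OF coherent_cells]])
      show "compact_space unit_interval" by (simp add: compact_space_subtopology)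
      show "regular_space unit_interval"
        by (intro regular_space_subtopology regular_space_euclidean)
      fix Z :: "(real \<times> (nat \<Rightarrow> real)) topology" and g :: "real \<times> (nat \<Rightarrow> real) \<Rightarrow> real \<times> 'a"
      assume "(Z, g) \<in> (\<lambda>(Z, g). (prod_topology unit_interval Z, \<lambda>(t, z). (t, g z))) `
        {(unit_disc j, \<phi>) | j \<phi>. \<phi> \<in> \<Phi> j}"
      then obtain j \<phi> where \<phi>: "\<phi> \<in> \<Phi> j"
        and Z: "Z = prod_topology unit_interval (unit_disc j)" "g = (\<lambda>(t, z). (t, \<phi> z))" by auto
      have im: "\<phi> z \<in> lower sk (Suc j)" if "z \<in> topspace (unit_disc j)" for z
        using cell_in_sk[OF \<phi> that] by simp
      have "continuous_map (unit_disc j) (subtopology X (lower sk (Suc j))) \<phi>"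
        using cell_continuous[OF \<phi>] im by (auto simp: continuous_map_in_subtopology)
      then have "continuous_map Z (prod_topology unit_interval (subtopology X (lower sk (Suc j)))) g"
        unfolding Z by (rule cell_prod_continuous)
      then have "continuous_map Z (prod_topology unit_interval X) (f (Suc j) \<circ> g)"
        using f(1)[of "Suc j"] unfolding partial_cylinder_retraction_def
        by (blast intro: continuous_map_compose)
      then show "continuous_map Z (prod_topology unit_interval X) (R \<circ> g)"
        by (rule continuous_map_eq) (use R[of _ _ "Suc j"] im in \<open>auto simp: Z\<close>)
    qed
  next
    fix x assume "x \<in> topspace X"
    then obtain n where n: "x \<in> lower sk n" using cover by blast
    have "f n (0, x) = (0, x)"
      using f(1)[of n] n unfolding partial_cylinder_retraction_def by blast
    then show "R (0, x) = (0, x)" using R[OF _ n, of 0] by simp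
  next
    fix t :: real and x assume t: "t \<in> {0..1}" and x: "x \<in> C"
    then obtain n where n: "x \<in> lower sk n" using cover closedin_subset[OF C] by blast
    have "f n (t, x) = (t, x)"
      using f(1)[of n] n x t unfolding partial_cylinder_retraction_def by blast
    then show "R (t, x) = (t, x)" using R[OF t n] by simp
  next
    fix t :: real and x assume t: "t \<in> {0..1}" and x: "x \<in> topspace X"
    then obtain n where n: "x \<in> lower sk n" using cover by blast
    have "fst (f n (t, x)) = 0 \<or> snd (f n (t, x)) \<in> C"
      using f(1)[of n] n t unfolding partial_cylinder_retraction_def by blast
    then show "fst (R (t, x)) = 0 \<or> snd (R (t, x)) \<in> C" using R[OF t n] by simp
  qed
qed

text \<open>Take \<open>G = snd \<circ> R\<close>, and let \<open>N\<close> consist of the points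
  \<open>x\<close> for which \<open>R (1, x)\<close> has positive height. Not being on the bottom,
  \<open>R (1, x)\<close> then lies over \<open>C\<close>. Nothing confines \<open>G\<close> to
  \<open>N\<close> at intermediate times.\<close>

lemma subcomplex_deformation:
  assumes C: "closedin X C"
    and cells: "\<And>k \<phi>. \<phi> \<in> \<Phi> k \<Longrightarrow> \<phi> ` open_disc k \<subseteq> C \<or> \<phi> ` open_disc k \<inter> C = {}"
  obtains N G where "openin X N" "C \<subseteq> N" "continuous_map (prod_topology unit_interval X) X G"
    "\<And>x. x \<in> topspace X \<Longrightarrow> G (0, x) = x"
    "\<And>t x. \<lbrakk>t \<in> {0..1}; x \<in> C\<rbrakk> \<Longrightarrow> G (t, x) = x"
    "\<And>x. x \<in> N \<Longrightarrow> G (1, x) \<in> C"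
proof -
  obtain R where R: "continuous_map (prod_topology unit_interval X) (prod_topology unit_interval X) R"
    "\<And>x. x \<in> topspace X \<Longrightarrow> R (0, x) = (0, x)"
    "\<And>t x. \<lbrakk>t \<in> {0..1}; x \<in> C\<rbrakk> \<Longrightarrow> R (t, x) = (t, x)"
    "\<And>t x. \<lbrakk>t \<in> {0..1}; x \<in> topspace X\<rbrakk> \<Longrightarrow> fst (R (t, x)) = 0 \<or> snd (R (t, x)) \<in> C"
    using subcomplex_cylinder_retraction[OF C cells] by blast
  define N where "N = {x \<in> topspace X. (fst \<circ> (R \<circ> (\<lambda>x. (1, x)))) x \<in> {0<..}}"
  have "continuous_map X (prod_topology unit_interval X) (\<lambda>x. (1, x))"
    by (simp add: continuous_map_pairwise o_def)
  from continuous_map_compose[OF this R(1)]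
  have "continuous_map X unit_interval (fst \<circ> (R \<circ> (\<lambda>x. (1, x))))"
    using continuous_map_compose continuous_map_fst by blast
  then have "continuous_map X euclideanreal (fst \<circ> (R \<circ> (\<lambda>x. (1, x))))"
    by (rule continuous_map_into_fulltopology)
  then have "openin X N"
    unfolding N_def by (rule openin_continuous_map_preimage) simp
  moreover have "C \<subseteq> N"
    using R(3)[of 1] closedin_subset[OF C] by (auto simp: N_def)
  moreover have "continuous_map (prod_topology unit_interval X) X (snd \<circ> R)"
    using R(1) continuous_map_snd by (rule continuous_map_compose)
  moreover have "(snd \<circ> R) (0, x) = x" if "x \<in> topspace X" for x
    using R(2)[OF that] by simp
  moreover have "(snd \<circ> R) (t, x) = x" if "t \<in> {0..1}" "x \<in> C" for t x
    using R(3)[OF that] by simp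
  moreover have "(snd \<circ> R) (1, x) \<in> C" if "x \<in> N" for x
    using R(4)[of 1 x] that by (auto simp: N_def)
  ultimately show ?thesis by (rule that)
qed

text \<open>Regularity of the disc gives an open \<open>U\<close> and a closed \<open>L\<close>
  around the parameter of \<open>x\<close>, with \<open>U \<subseteq> L\<close> inside the open
  disc, such that the image of \<open>L\<close> misses \<open>y\<close>. The image of
  \<open>U\<close> and the complement of the image of \<open>L\<close> separate the points.\<close>

lemma cell_separation:
  assumes x: "x \<in> sk k" "x \<notin> lower sk k" and y: "y \<in> sk k" "x \<noteq> y"
  shows "\<exists>U V. openin (subtopology X (sk k)) U \<and> openin (subtopology X (sk k)) V \<and>
    x \<in> U \<and> y \<in> V \<and> U \<inter> V = {}"
proof -
  obtain \<phi> z where \<phi>: "\<phi> \<in> \<Phi> k" and z: "z \<in> open_disc k" "x = \<phi> z"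
    using cell_cases[OF x] by metis
  define W where "W = {z \<in> open_disc k. \<phi> z \<noteq> y}"
  have "openin (unit_disc k) W"
  proof (cases "\<exists>v\<in>open_disc k. y = \<phi> v")
    case True
    then obtain v where v: "v \<in> open_disc k" "y = \<phi> v" by blast
    have "W = open_disc k - {v}" using v cell_inj(2)[OF \<phi> \<phi>] by (auto simp: W_def)
    moreover have "closedin (unit_disc k) {v}"
      using v(1) Hausdorff_space_unit_disc by (simp add: closedin_Hausdorff_singleton unit_disc_cases)
    ultimately show ?thesis using openin_open_disc by (simp add: openin_diff)
  next
    case False
    then have "W = open_disc k" by (auto simp: W_def)
    then show ?thesis using openin_open_disc by simp
  qed
  moreover have "z \<in> W" using z y by (simp add: W_def)
  ultimately obtain U L where UL: "openin (unit_disc k) U" "closedin (unit_disc k) L" "z \<in> U" "U \<subseteq> L" "L \<subseteq> W"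
    using regular_space_unit_disc[of k] unfolding neighbourhood_base_of_closedin[symmetric] neighbourhood_base_of
    by meson
  have sub: "L \<subseteq> open_disc k" "U \<subseteq> open_disc k" using UL by (auto simp: W_def)
  have top: "topspace (subtopology X (sk k)) = sk k" using sk_subset by (simp add: Int_absorb1)
  show ?thesis
  proof (intro exI conjI)
    show "openin (subtopology X (sk k)) (\<phi> ` U)"
      using \<phi> UL(1) sub(2) by (rule openin_cell_image)
    have "\<phi> ` L \<subseteq> sk k" using cell_open(1)[OF \<phi>] sub by auto
    then have "closedin (subtopology X (sk k)) (\<phi> ` L)"
      using closedin_cell_image[OF \<phi> UL(2) sub(1)] by (intro closedin_subset_topspace)
    then have "openin (subtopology X (sk k)) (topspace (subtopology X (sk k)) - \<phi> ` L)"
      by (rule openin_diff[OF openin_topspace])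
    then show "openin (subtopology X (sk k)) (sk k - \<phi> ` L)"
      unfolding top .
    show "x \<in> \<phi> ` U" using UL z by blast
    show "y \<in> sk k - \<phi> ` L" using y UL(5) by (auto simp: W_def)
    show "\<phi> ` U \<inter> (sk k - \<phi> ` L) = {}" using UL(4) by auto
  qed
qed

text \<open>The points are separated in the first skeleton that contains both, and the separation is
  pulled back along the time-one map of a neighbourhood deformation into that skeleton.\<close>

theorem Hausdorff: "Hausdorff_space X"
  unfolding Hausdorff_space_def
proof (intro allI impI)
  fix x y assume xy: "x \<in> topspace X \<and> y \<in> topspace X \<and> x \<noteq> y"
  obtain i j where "x \<in> sk i" "y \<in> sk j" using xy Union_sk by blast
  then have ex: "x \<in> sk (max i j) \<and> y \<in> sk (max i j)"
    using sk_mono[of i "max i j"] sk_mono[of j "max i j"] by auto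
  define k where "k = (LEAST k. x \<in> sk k \<and> y \<in> sk k)"
  have k: "x \<in> sk k" "y \<in> sk k" using LeastI[of "\<lambda>k. x \<in> sk k \<and> y \<in> sk k", OF ex] by (auto simp: k_def)
  have "x \<notin> lower sk k \<or> y \<notin> lower sk k"
  proof (cases k)
    case (Suc l)
    then show ?thesis using not_less_Least[of l "\<lambda>k. x \<in> sk k \<and> y \<in> sk k"] by (simp add: k_def)
  qed simp
  then have "\<exists>U V. openin (subtopology X (sk k)) U \<and> openin (subtopology X (sk k)) V \<and>
    x \<in> U \<and> y \<in> V \<and> U \<inter> V = {}"
  proof
    assume "x \<notin> lower sk k"
    with xy k show ?thesis by (intro cell_separation) auto
  next
    assume "y \<notin> lower sk k"
    with xy k have "\<exists>V U. openin (subtopology X (sk k)) V \<and> openin (subtopology X (sk k)) U \<and>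
        y \<in> V \<and> x \<in> U \<and> V \<inter> U = {}"
      by (intro cell_separation) auto
    then show ?thesis by (metis Int_commute)
  qed
  then obtain U V where UV: "openin (subtopology X (sk k)) U" "openin (subtopology X (sk k)) V"
    "x \<in> U" "y \<in> V" "U \<inter> V = {}"
    by blast
  have cells: "\<phi> ` open_disc j \<subseteq> sk k \<or> \<phi> ` open_disc j \<inter> sk k = {}" if "\<phi> \<in> \<Phi> j" for j \<phi>
  proof (cases "j \<le> k")
    case True
    then show ?thesis using cell_open(1)[OF that] sk_mono by blast
  next
    case False
    then show ?thesis using cell_open(2)[OF that] sk_subset_lower[of k j] by auto
  qed
  obtain N G where N: "openin X N" "sk k \<subseteq> N" and G: "continuous_map (prod_topology unit_interval X) X G"
    "\<And>t x. \<lbrakk>t \<in> {0..1}; x \<in> sk k\<rbrakk> \<Longrightarrow> G (t, x) = x" "\<And>x. x \<in> N \<Longrightarrow> G (1, x) \<in> sk k"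
    by (rule subcomplex_deformation[OF closedin_sk cells]) (assumption, rule that)
  have "continuous_map X (prod_topology unit_interval X) (\<lambda>x. (1, x))"
    by (simp add: continuous_map_pairwise o_def)
  from continuous_map_compose[OF this G(1)] have "continuous_map X X (\<lambda>x. G (1, x))"
    by (simp add: o_def)
  then have cont: "continuous_map (subtopology X N) (subtopology X (sk k)) (\<lambda>x. G (1, x))"
    using G(3) by (auto simp: continuous_map_in_subtopology continuous_map_from_subtopology)
  have op: "openin X {z \<in> N. G (1, z) \<in> S}" if "openin (subtopology X (sk k)) S" for S
  proof -
    have "topspace (subtopology X N) = N" using openin_subset[OF N(1)] by (simp add: Int_absorb1)
    then have "openin (subtopology X N) {z \<in> N. G (1, z) \<in> S}"
      using openin_continuous_map_preimage[OF cont that] by simp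
    then show ?thesis using N(1) by (simp add: openin_open_subtopology)
  qed
  show "\<exists>U V. openin X U \<and> openin X V \<and> x \<in> U \<and> y \<in> V \<and> disjnt U V"
  proof (intro exI conjI)
    show "openin X {z \<in> N. G (1, z) \<in> U}" "openin X {z \<in> N. G (1, z) \<in> V}"
      using op UV by auto
    show "x \<in> {z \<in> N. G (1, z) \<in> U}" "y \<in> {z \<in> N. G (1, z) \<in> V}"
      using UV N k G(2)[of 1] by auto
    show "disjnt {z \<in> N. G (1, z) \<in> U} {z \<in> N. G (1, z) \<in> V}"
      using UV(5) by (auto simp: disjnt_def)
  qed
qed

end


section \<open>Cellular retracts are subcomplexes\<close>

text \<open>As \<open>r\<close> and \<open>s\<close> preserve skeleta, the point over
  \<open>\<phi> z\<close> lies in an open cell \<open>\<psi>\<close> of the same dimension.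
  Connectedness keeps the image of this cell under \<open>r\<close> inside the cell of
  \<open>\<phi>\<close>, so in coordinates \<open>r\<close> becomes a self-map \<open>h\<close> of
  the open disc. It is injective because of \<open>s\<close>, and by invariance of domain its image
  is open.\<close>

lemma (in cell_complex) retract_cell_absorbed:
  assumes B: "cell_complex Y tk \<Psi>"
    and r: "continuous_map Y X r" "\<And>k. r ` tk k \<subseteq> sk k"
    and s: "\<And>k. s ` sk k \<subseteq> tk k" "\<And>y. y \<in> topspace Y \<Longrightarrow> s (r y) = y"
    and \<phi>: "\<phi> \<in> \<Phi> k" and z: "z \<in> open_disc k" "\<phi> z \<in> r ` topspace Y"
  shows "\<exists>U. openin (unit_disc k) U \<and> z \<in> U \<and> U \<subseteq> open_disc k \<and> \<phi> ` U \<subseteq> r ` topspace Y"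
proof -
  interpret B: cell_complex Y tk \<Psi> by fact
  have low: "r ` lower tk k \<subseteq> lower sk k" "s ` lower sk k \<subseteq> lower tk k"
    using r(2) s(1) by (cases k; simp)+
  obtain b where b: "b \<in> topspace Y" "\<phi> z = r b" using z by blast
  have "b = s (\<phi> z)" using b s(2) by simp
  then have "b \<in> tk k" using cell_open(1)[OF \<phi> z(1)] s(1) by blast
  moreover have "b \<notin> lower tk k"
    using cell_open(2)[OF \<phi> z(1)] low(1) b(2) by auto
  ultimately obtain \<psi> w where \<psi>: "\<psi> \<in> \<Psi> k" and w: "w \<in> open_disc k" "b = \<psi> w"
    using B.cell_cases by metis
  have disc: "v \<in> topspace (unit_disc k)" if "v \<in> open_disc k" for v
    using that by (simp add: unit_disc_cases)
  have \<psi>Y: "\<psi> v \<in> topspace Y" if "v \<in> topspace (unit_disc k)" for v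
    using B.cell_in_sk[OF \<psi> that] B.sk_subset by blast
  have g_sk: "r (\<psi> v) \<in> sk k" if "v \<in> topspace (unit_disc k)" for v
    using B.cell_in_sk[OF \<psi> that] r(2) by blast
  have g_low: "r (\<psi> v) \<notin> lower sk k" if v: "v \<in> open_disc k" for v
  proof
    assume "r (\<psi> v) \<in> lower sk k"
    then have "\<psi> v \<in> lower tk k" using s(2)[OF \<psi>Y[OF disc[OF v]]] low(2) by force
    then show False using B.cell_open(2)[OF \<psi> v] by blast
  qed
  have "continuous_map (unit_disc k) X (r \<circ> \<psi>)"
    using B.cell_continuous[OF \<psi>] r(1) by (rule continuous_map_compose)
  then have g: "continuous_map (unit_disc k) (subtopology X (sk k)) (\<lambda>v. r (\<psi> v))"
    using g_sk by (auto simp: continuous_map_in_subtopology o_def)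
  \<comment> \<open>A splitting of the open disc into two open parts: \<open>r (\<psi> v)\<close>
    avoids the lower skeleton, and the cell of \<open>\<phi>\<close> is open and closed in what
    remains. The parameter \<open>w\<close> decides which part is everything.\<close>
  define O1 where "O1 = {v \<in> topspace (unit_disc k). r (\<psi> v) \<in> \<phi> ` open_disc k}"
  define O2 where "O2 = {v \<in> topspace (unit_disc k). r (\<psi> v) \<in> sk k - (lower sk k \<union> \<phi> ` open_disc k)}"
  have "openin (unit_disc k) O1"
    unfolding O1_def
    by (rule openin_continuous_map_preimage[OF g openin_cell_image[OF \<phi> openin_open_disc subset_refl]])
  moreover have "openin (unit_disc k) O2"
    unfolding O2_def
  proof (rule openin_continuous_map_preimage[OF g])
    have top: "topspace (subtopology X (sk k)) = sk k" using sk_subset by (simp add: Int_absorb1)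
    have "lower sk k \<union> \<phi> ` open_disc k \<subseteq> sk k"
      using cell_open(1)[OF \<phi>] lower_subset by auto
    then have "closedin (subtopology X (sk k)) (lower sk k \<union> \<phi> ` open_disc k)"
      by (rule closedin_subset_topspace[OF closedin_lower_Un_cell[OF \<phi>]])
    then show "openin (subtopology X (sk k)) (sk k - (lower sk k \<union> \<phi> ` open_disc k))"
      using openin_diff[OF openin_topspace[of "subtopology X (sk k)"]] unfolding top by blast
  qed
  moreover have "open_disc k \<subseteq> O1 \<union> O2"
    using g_sk g_low disc by (auto simp: O1_def O2_def)
  moreover have "O1 \<inter> O2 \<inter> open_disc k = {}" by (auto simp: O1_def O2_def)
  moreover have "w \<in> O1 \<inter> open_disc k"
  proof -
    have "r (\<psi> w) = \<phi> z" using b w by simp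
    then show ?thesis using w(1) z(1) disc by (auto simp: O1_def)
  qed
  ultimately have "O2 \<inter> open_disc k = {}"
    using connectedinD[OF connectedin_open_disc, of k O1 O2] by blast
  then have g_im: "r (\<psi> v) \<in> \<phi> ` open_disc k" if "v \<in> open_disc k" for v
    using that \<open>open_disc k \<subseteq> O1 \<union> O2\<close> by (auto simp: O1_def)
  define h where "h v = inv_into (open_disc k) \<phi> (r (\<psi> v))" for v
  have h: "h v \<in> open_disc k" "\<phi> (h v) = r (\<psi> v)" if "v \<in> open_disc k" for v
    using g_im[OF that] by (auto simp: h_def inv_into_into f_inv_into_f)
  have h_uniq: "h v = u" if "v \<in> open_disc k" "u \<in> open_disc k" "\<phi> u = r (\<psi> v)" for u v
    using cell_inj(2)[OF \<phi> \<phi> h(1)[OF that(1)] that(2)] h(2)[OF that(1)] that(3) by simp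
  have top: "topspace (subtopology (unit_disc k) (open_disc k)) = open_disc k"
    using disc by auto
  have "continuous_map (subtopology (unit_disc k) (open_disc k)) (unit_disc k) h"
    unfolding continuous_map_def top
  proof (intro conjI allI impI)
    show "h \<in> open_disc k \<rightarrow> topspace (unit_disc k)" using h(1) disc by auto
    fix U assume U: "openin (unit_disc k) U"
    \<comment> \<open>Continuity of the coordinate map \<open>h\<close> follows from
      \<open>\<phi>\<close> being open on the open disc.\<close>
    have "{v \<in> open_disc k. h v \<in> U} = {v \<in> open_disc k. r (\<psi> v) \<in> \<phi> ` (U \<inter> open_disc k)}"
    proof -
      have "h v \<in> U \<longleftrightarrow> r (\<psi> v) \<in> \<phi> ` (U \<inter> open_disc k)" if v: "v \<in> open_disc k" for v
      proof
        assume "h v \<in> U"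
        then show "r (\<psi> v) \<in> \<phi> ` (U \<inter> open_disc k)"
          unfolding h(2)[OF v, symmetric] using h(1)[OF v] by blast
      next
        assume "r (\<psi> v) \<in> \<phi> ` (U \<inter> open_disc k)"
        then show "h v \<in> U"
        proof (elim imageE IntE)
          fix u assume u: "r (\<psi> v) = \<phi> u" "u \<in> U" "u \<in> open_disc k"
          have "h v = u" by (rule h_uniq[OF v u(3) u(1)[symmetric]])
          with u(2) show ?thesis by simp
        qed
      qed
      then show ?thesis by blast
    qed
    moreover have "openin (subtopology X (sk k)) (\<phi> ` (U \<inter> open_disc k))"
      by (rule openin_cell_image[OF \<phi> openin_Int[OF U openin_open_disc]]) simp
    then have "openin (subtopology (unit_disc k) (open_disc k))
        {v \<in> topspace (subtopology (unit_disc k) (open_disc k)). r (\<psi> v) \<in> \<phi> ` (U \<inter> open_disc k)}"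
      by (rule openin_continuous_map_preimage[OF continuous_map_from_subtopology[OF g]])
    ultimately show "openin (subtopology (unit_disc k) (open_disc k)) {v \<in> open_disc k. h v \<in> U}"
      unfolding top by (simp only:)
  qed
  then have "continuous_map (subtopology (Euclidean_space k) (open_disc k)) (Euclidean_space k) h"
    unfolding openin_Euclidean_open_disc(2) unit_disc_def by (rule continuous_map_into_fulltopology)
  moreover have "inj_on h (open_disc k)"
  proof (rule inj_onI)
    fix u v assume uv: "u \<in> open_disc k" "v \<in> open_disc k" "h u = h v"
    have "\<psi> u = s (\<phi> (h u))"
      unfolding h(2)[OF uv(1)] by (rule s(2)[OF \<psi>Y[OF disc[OF uv(1)]], symmetric])
    also have "\<dots> = \<psi> v"
      unfolding uv(3) h(2)[OF uv(2)] by (rule s(2)[OF \<psi>Y[OF disc[OF uv(2)]]])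
    finally have "\<psi> u = \<psi> v" .
    then show "u = v" using B.cell_inj(2)[OF \<psi> \<psi>] uv by blast
  qed
  ultimately have "openin (Euclidean_space k) (h ` open_disc k)"
    using invariance_of_domain_Euclidean_space[OF openin_Euclidean_open_disc(1)] by blast
  moreover have "h ` open_disc k \<subseteq> open_disc k" using h(1) by blast
  ultimately have "openin (subtopology (Euclidean_space k) (open_disc k)) (h ` open_disc k)"
    using openin_Euclidean_open_disc(1) by (simp add: openin_open_subtopology)
  then have "openin (unit_disc k) (h ` open_disc k)"
    unfolding openin_Euclidean_open_disc(2) using openin_open_disc by (simp add: openin_open_subtopology)
  moreover have "z \<in> h ` open_disc k"
    using h_uniq[OF w(1) z(1)] b w by auto
  moreover have "\<phi> ` h ` open_disc k \<subseteq> r ` topspace Y"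
    using h(2) \<psi>Y disc by auto
  ultimately show ?thesis using \<open>h ` open_disc k \<subseteq> open_disc k\<close> by blast
qed

text \<open>By invariance of domain the part of an open cell that lies in a cellular retract is open;
  as it is closed too, it is everything or empty.\<close>

lemma (in cell_complex) retract_is_subcomplex:
  assumes B: "cell_complex Y tk \<Psi>"
    and r: "continuous_map Y X r" "\<And>k. r ` tk k \<subseteq> sk k"
    and s: "continuous_map X Y s" "\<And>k. s ` sk k \<subseteq> tk k" "\<And>y. y \<in> topspace Y \<Longrightarrow> s (r y) = y"
  shows "closedin X (r ` topspace Y)"
    and "\<phi> \<in> \<Phi> k \<Longrightarrow> \<phi> ` open_disc k \<subseteq> r ` topspace Y \<or> \<phi> ` open_disc k \<inter> r ` topspace Y = {}"
proof -
  have "r ` topspace Y = {x \<in> topspace X. (r \<circ> s) x = id x}"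
  proof -
    have "r (s x) = x \<and> x \<in> topspace X" if "x \<in> r ` topspace Y" for x
      using that s(3) continuous_map_funspace[OF r(1)] by auto
    moreover have "x \<in> r ` topspace Y" if "x \<in> topspace X" "r (s x) = x" for x
      using that continuous_map_funspace[OF s(1)] by (intro image_eqI[of _ _ "s x"]) auto
    ultimately show ?thesis by auto
  qed
  moreover have "closedin X {x \<in> topspace X. (r \<circ> s) x = id x}"
    by (rule closedin_continuous_maps_eq[OF Hausdorff continuous_map_compose[OF s(1) r(1)] continuous_map_id])
  ultimately show C: "closedin X (r ` topspace Y)" by simp
  assume \<phi>: "\<phi> \<in> \<Phi> k"
  define Z where "Z = {z \<in> open_disc k. \<phi> z \<in> r ` topspace Y}"
  have opZ: "openin (unit_disc k) Z"
  proof (subst openin_subopen, intro ballI)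
    fix z assume "z \<in> Z"
    then obtain U where "openin (unit_disc k) U" "z \<in> U" "U \<subseteq> open_disc k" "\<phi> ` U \<subseteq> r ` topspace Y"
      using retract_cell_absorbed[OF B r s(2,3) \<phi>] unfolding Z_def by blast
    then show "\<exists>T. openin (unit_disc k) T \<and> z \<in> T \<and> T \<subseteq> Z"
      by (intro exI[of _ U]) (auto simp: Z_def)
  qed
  have "openin (unit_disc k) (open_disc k - {z \<in> topspace (unit_disc k). \<phi> z \<in> r ` topspace Y})"
    by (rule openin_diff[OF openin_open_disc closedin_continuous_map_preimage[OF cell_continuous[OF \<phi>] C]])
  moreover have "open_disc k - {z \<in> topspace (unit_disc k). \<phi> z \<in> r ` topspace Y} = open_disc k - Z"
    by (auto simp: Z_def unit_disc_cases)
  ultimately have op: "openin (unit_disc k) (open_disc k - Z)" by simp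
  have "Z = {} \<or> open_disc k - Z = {}"
  proof (rule ccontr)
    assume "\<not> (Z = {} \<or> open_disc k - Z = {})"
    then show False
      by (intro connectedinD[OF connectedin_open_disc opZ op]) (auto simp: Z_def)
  qed
  then show "\<phi> ` open_disc k \<subseteq> r ` topspace Y \<or> \<phi> ` open_disc k \<inter> r ` topspace Y = {}"
    by (auto simp: Z_def)
qed

section \<open>The space glued from two maps, with the final topology\<close>

definition weak_topology :: "'a topology \<Rightarrow> ('a \<Rightarrow> 'b) \<Rightarrow> 'a topology \<Rightarrow> ('a \<Rightarrow> 'b) \<Rightarrow> 'b topology" where
  "weak_topology X p Y q = topology (\<lambda>S. S \<subseteq> p ` topspace X \<union> q ` topspace Y \<and>
     openin X {x \<in> topspace X. p x \<in> S} \<and> openin Y {y \<in> topspace Y. q y \<in> S})"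

lemma openin_weak_topology:
  fixes X Y :: "'a topology" and p q :: "'a \<Rightarrow> 'b"
  shows "openin (weak_topology X p Y q) S \<longleftrightarrow> S \<subseteq> p ` topspace X \<union> q ` topspace Y \<and>
     openin X {x \<in> topspace X. p x \<in> S} \<and> openin Y {y \<in> topspace Y. q y \<in> S}"
proof -
  have int: "{x \<in> topspace Z. g x \<in> S \<inter> T} = {x \<in> topspace Z. g x \<in> S} \<inter> {x \<in> topspace Z. g x \<in> T}"
    for Z :: "'a topology" and g :: "'a \<Rightarrow> 'b" and S T by blast
  have un: "{x \<in> topspace Z. g x \<in> \<Union>\<K>} = (\<Union>S\<in>\<K>. {x \<in> topspace Z. g x \<in> S})"
    for Z :: "'a topology" and g :: "'a \<Rightarrow> 'b" and \<K> by blast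
  have "istopology (\<lambda>S. S \<subseteq> p ` topspace X \<union> q ` topspace Y \<and>
     openin X {x \<in> topspace X. p x \<in> S} \<and> openin Y {y \<in> topspace Y. q y \<in> S})"
    unfolding istopology_def
  proof (rule conjI; intro allI impI)
    fix S T
    assume "S \<subseteq> p ` topspace X \<union> q ` topspace Y \<and>
       openin X {x \<in> topspace X. p x \<in> S} \<and> openin Y {y \<in> topspace Y. q y \<in> S}"
      and "T \<subseteq> p ` topspace X \<union> q ` topspace Y \<and>
       openin X {x \<in> topspace X. p x \<in> T} \<and> openin Y {y \<in> topspace Y. q y \<in> T}"
    then show "S \<inter> T \<subseteq> p ` topspace X \<union> q ` topspace Y \<and>
       openin X {x \<in> topspace X. p x \<in> S \<inter> T} \<and> openin Y {y \<in> topspace Y. q y \<in> S \<inter> T}"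
      unfolding int by (simp add: openin_Int le_infI1)
  next
    fix \<K>
    assume K: "\<forall>S\<in>\<K>. S \<subseteq> p ` topspace X \<union> q ` topspace Y \<and>
       openin X {x \<in> topspace X. p x \<in> S} \<and> openin Y {y \<in> topspace Y. q y \<in> S}"
    have "openin X (\<Union>S\<in>\<K>. {x \<in> topspace X. p x \<in> S})"
      "openin Y (\<Union>S\<in>\<K>. {y \<in> topspace Y. q y \<in> S})"
      using K by (auto intro!: openin_Union)
    moreover have "\<Union>\<K> \<subseteq> p ` topspace X \<union> q ` topspace Y" using K by blast
    ultimately show "\<Union>\<K> \<subseteq> p ` topspace X \<union> q ` topspace Y \<and>
       openin X {x \<in> topspace X. p x \<in> \<Union>\<K>} \<and> openin Y {y \<in> topspace Y. q y \<in> \<Union>\<K>}"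
      unfolding un by blast
  qed
  then show ?thesis unfolding weak_topology_def by (simp only: topology_inverse')
qed

lemma topspace_weak_topology:
  "topspace (weak_topology X p Y q) = p ` topspace X \<union> q ` topspace Y"
proof
  show "topspace (weak_topology X p Y q) \<subseteq> p ` topspace X \<union> q ` topspace Y"
    using openin_topspace[of "weak_topology X p Y q"] unfolding openin_weak_topology by (rule conjunct1)
  have "{x \<in> topspace X. p x \<in> p ` topspace X \<union> q ` topspace Y} = topspace X"
    "{x \<in> topspace Y. q x \<in> p ` topspace X \<union> q ` topspace Y} = topspace Y" by auto
  then have "openin (weak_topology X p Y q) (p ` topspace X \<union> q ` topspace Y)"
    unfolding openin_weak_topology by (simp only: openin_topspace subset_refl simp_thms)
  then show "p ` topspace X \<union> q ` topspace Y \<subseteq> topspace (weak_topology X p Y q)"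
    by (rule openin_subset)
qed

lemma closedin_weak_topology:
  "closedin (weak_topology X p Y q) S \<longleftrightarrow> S \<subseteq> p ` topspace X \<union> q ` topspace Y \<and>
     closedin X {x \<in> topspace X. p x \<in> S} \<and> closedin Y {y \<in> topspace Y. q y \<in> S}"
proof -
  let ?T = "p ` topspace X \<union> q ` topspace Y"
  have "{x \<in> topspace X. p x \<in> ?T - S} = topspace X - {x \<in> topspace X. p x \<in> S}"
    "{x \<in> topspace Y. q x \<in> ?T - S} = topspace Y - {x \<in> topspace Y. q x \<in> S}" by auto
  then show ?thesis
    unfolding closedin_def topspace_weak_topology openin_weak_topology by auto
qed

lemma continuous_map_weak_topology:
  "continuous_map X (weak_topology X p Y q) p" "continuous_map Y (weak_topology X p Y q) q"
  unfolding continuous_map_def topspace_weak_topology openin_weak_topology by auto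


section \<open>Pushouts along split monomorphisms\<close>

text \<open>A span of cellular maps whose leg \<open>r\<close> has the cellular left inverse
  \<open>s\<close>. The injections \<open>\<alpha>\<close> and \<open>\<beta>\<close> with disjoint
  ranges make room inside \<open>'a\<close> for the two pieces of the pushout.\<close>

locale cellular_pushout =
  A: cell_complex X sk \<Phi> + B: cell_complex Y tk \<Psi> + D: cell_complex Z uk \<Theta>
  for X Y Z :: "'a topology" and sk tk uk :: "nat \<Rightarrow> 'a set"
    and \<Phi> \<Psi> \<Theta> :: "nat \<Rightarrow> ((nat \<Rightarrow> real) \<Rightarrow> 'a) set" +
  fixes r s f \<alpha> \<beta> :: "'a \<Rightarrow> 'a"
  assumes r: "continuous_map Y X r" "r ` tk k \<subseteq> sk k"
    and s: "continuous_map X Y s" "s ` sk k \<subseteq> tk k"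
    and s_r: "y \<in> topspace Y \<Longrightarrow> s (r y) = y"
    and f: "continuous_map Y Z f" "f ` tk k \<subseteq> uk k"
    and inj_\<alpha>: "inj \<alpha>" and inj_\<beta>: "inj \<beta>" and \<alpha>_neq_\<beta>: "\<alpha> x \<noteq> \<beta> z"
begin

text \<open>The pushout consists of a copy of \<open>Z\<close>, embedded by \<open>\<beta>\<close>, and a disjoint copy of \<open>X - C\<close>, embedded
  by \<open>\<alpha>\<close>.\<close>

definition C where "C = r ` topspace Y"

text \<open>A point \<open>x\<close> of \<open>C\<close> is \<open>r y\<close> for
  \<open>y = s x\<close>, so the pushout has to identify it with \<open>f y\<close>.\<close>

definition p where "p x = (if x \<in> C then \<beta> (f (s x)) else \<alpha> x)"

definition W where "W = weak_topology X p Z \<beta>"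

definition wk where "wk k = p ` sk k \<union> \<beta> ` uk k"

text \<open>Cells of \<open>X\<close> inside \<open>C\<close> contribute nothing new, since
  \<open>p\<close> sends them into the copy of \<open>Z\<close>.\<close>

definition \<Omega> where
  "\<Omega> k = (\<lambda>\<theta>. \<beta> \<circ> \<theta>) ` \<Theta> k \<union> (\<lambda>\<phi>. p \<circ> \<phi>) ` {\<phi> \<in> \<Phi> k. \<phi> ` open_disc k \<inter> C = {}}"

lemma closedin_C: "closedin X C"
  unfolding C_def by (rule A.retract_is_subcomplex(1)[OF B.cell_complex_axioms r s s_r])

lemma cells_C: "\<phi> \<in> \<Phi> k \<Longrightarrow> \<phi> ` open_disc k \<subseteq> C \<or> \<phi> ` open_disc k \<inter> C = {}"
  unfolding C_def by (rule A.retract_is_subcomplex(2)[OF B.cell_complex_axioms r s s_r])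

lemma C_subset: "C \<subseteq> topspace X"
  using closedin_C by (rule closedin_subset)

lemma C_iff: "x \<in> C \<longleftrightarrow> x \<in> topspace X \<and> r (s x) = x"
proof
  assume "x \<in> C"
  then show "x \<in> topspace X \<and> r (s x) = x" using C_subset s_r by (auto simp: C_def)
next
  assume "x \<in> topspace X \<and> r (s x) = x"
  then show "x \<in> C"
    using funcset_mem[OF continuous_map_funspace[OF s(1)], of x]
    unfolding C_def by (intro image_eqI[of _ _ "s x"]) auto
qed

lemma fs_continuous: "continuous_map X Z (f \<circ> s)"
  using s(1) f(1) by (rule continuous_map_compose)

lemma p_C: "x \<in> C \<Longrightarrow> p x = \<beta> (f (s x))"
  by (simp add: p_def)

lemma p_not_C: "x \<notin> C \<Longrightarrow> p x = \<alpha> x"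
  by (simp add: p_def)

lemma p_r: "y \<in> topspace Y \<Longrightarrow> p (r y) = \<beta> (f y)"
  using s_r by (simp add: p_def C_def)

lemma p_eq_\<beta>_iff: "p x = \<beta> z \<longleftrightarrow> x \<in> C \<and> z = f (s x)"
  using inj_\<beta> \<alpha>_neq_\<beta> by (auto simp: p_def inj_eq)

lemma p_eq_\<alpha>: "x' \<notin> C \<Longrightarrow> p x = p x' \<longleftrightarrow> x = x'"
  using inj_\<alpha> \<alpha>_neq_\<beta> by (auto simp: p_def inj_eq) (metis \<alpha>_neq_\<beta>)

lemma topspace_W: "topspace W = p ` topspace X \<union> \<beta> ` topspace Z"
  unfolding W_def by (rule topspace_weak_topology)

lemma closedin_W: "closedin W S \<longleftrightarrow> S \<subseteq> topspace W \<and>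
     closedin X {x \<in> topspace X. p x \<in> S} \<and> closedin Z {z \<in> topspace Z. \<beta> z \<in> S}"
  unfolding topspace_W unfolding W_def by (rule closedin_weak_topology)

lemma openin_W: "openin W S \<longleftrightarrow> S \<subseteq> topspace W \<and>
     openin X {x \<in> topspace X. p x \<in> S} \<and> openin Z {z \<in> topspace Z. \<beta> z \<in> S}"
  unfolding topspace_W unfolding W_def by (rule openin_weak_topology)

lemma p_continuous: "continuous_map X W p" and \<beta>_continuous: "continuous_map Z W \<beta>"
  unfolding W_def by (rule continuous_map_weak_topology)+

lemma lower_wk: "lower wk k = p ` lower sk k \<union> \<beta> ` lower uk k"
  by (cases k) (simp_all add: wk_def)

text \<open>Points glued onto the copy of \<open>Z\<close> do not enlarge its skeleta, because
  \<open>f\<close> and \<open>s\<close> are cellular.\<close>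

lemma \<beta>_in_wk: "\<beta> z \<in> wk k \<longleftrightarrow> z \<in> uk k"
proof
  assume "\<beta> z \<in> wk k"
  then consider x where "x \<in> sk k" "p x = \<beta> z" | "\<beta> z \<in> \<beta> ` uk k" unfolding wk_def by force
  then show "z \<in> uk k"
  proof cases
    case 1
    then show ?thesis using s(2)[of k] f(2)[of k] p_eq_\<beta>_iff[of x z] by blast
  next
    case 2
    then show ?thesis using inj_\<beta> by (simp add: inj_image_mem_iff)
  qed
qed (simp add: wk_def)

lemma \<beta>_in_lower_wk: "\<beta> z \<in> lower wk k \<longleftrightarrow> z \<in> lower uk k"
  using \<beta>_in_wk by (cases k) simp_all

lemma \<alpha>_in_wk:
  assumes "x \<notin> C"
  shows "p x \<in> wk k \<longleftrightarrow> x \<in> sk k"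
proof
  assume "p x \<in> wk k"
  then consider x' where "x' \<in> sk k" "p x' = p x" | z where "p x = \<beta> z" unfolding wk_def by force
  then show "x \<in> sk k"
  proof cases
    case 1
    then show ?thesis using p_eq_\<alpha>[OF assms, of x'] by simp
  next
    case 2
    then show ?thesis using p_eq_\<beta>_iff[of x z] assms by simp
  qed
qed (simp add: wk_def)

lemma \<alpha>_in_lower_wk: "x \<notin> C \<Longrightarrow> p x \<in> lower wk k \<longleftrightarrow> x \<in> lower sk k"
  using \<alpha>_in_wk by (cases k) simp_all

lemma cell_in_C:
  assumes "\<phi> \<in> \<Phi> k" "\<phi> ` open_disc k \<subseteq> C" "x \<in> topspace (unit_disc k)"
  shows "\<phi> x \<in> C"
proof -
  have "{x \<in> topspace (unit_disc k). \<phi> x \<in> C} = topspace (unit_disc k)"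
    by (rule closedin_unit_disc_superset[OF
          closedin_continuous_map_preimage[OF A.cell_continuous[OF assms(1)] closedin_C]])
      (use assms(2) unit_disc_cases(1) in blast)
  then show ?thesis using assms(3) by blast
qed

lemma \<Omega>_cases:
  assumes "\<omega> \<in> \<Omega> k"
  obtains \<theta> where "\<theta> \<in> \<Theta> k" "\<omega> = \<beta> \<circ> \<theta>"
    | \<phi> where "\<phi> \<in> \<Phi> k" "\<phi> ` open_disc k \<inter> C = {}" "\<omega> = p \<circ> \<phi>"
  using assms unfolding \<Omega>_def by blast

lemma wk_cell_bij: "bij_betw (\<lambda>(\<omega>, x). \<omega> x) (\<Omega> k \<times> open_disc k) (wk k - lower wk k)"
proof (rule bij_betw_imageI)
  show "inj_on (\<lambda>(\<omega>, x). \<omega> x) (\<Omega> k \<times> open_disc k)"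
  proof (rule inj_onI, clarify)
    fix \<omega> \<omega>' x x' assume *: "\<omega> \<in> \<Omega> k" "\<omega>' \<in> \<Omega> k" "x \<in> open_disc k" "x' \<in> open_disc k" "\<omega> x = \<omega>' x'"
    have out: "\<phi> v \<notin> C" if "\<phi> ` open_disc k \<inter> C = {}" "v \<in> open_disc k" for \<phi> :: "(nat \<Rightarrow> real) \<Rightarrow> 'a" and v
      using that by blast
    from *(1) show "\<omega> = \<omega>' \<and> x = x'"
    proof (rule \<Omega>_cases)
      fix \<theta> assume \<theta>: "\<theta> \<in> \<Theta> k" "\<omega> = \<beta> \<circ> \<theta>"
      from *(2) show ?thesis
      proof (rule \<Omega>_cases)
        fix \<theta>' assume \<theta>': "\<theta>' \<in> \<Theta> k" "\<omega>' = \<beta> \<circ> \<theta>'"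
        have "\<theta> x = \<theta>' x'" using *(5) inj_\<beta> by (simp add: \<theta>(2) \<theta>'(2) inj_eq)
        from D.cell_inj[OF \<theta>(1) \<theta>'(1) *(3,4) this] show ?thesis by (simp add: \<theta>(2) \<theta>'(2))
      next
        fix \<phi>' assume \<phi>': "\<phi>' \<in> \<Phi> k" "\<phi>' ` open_disc k \<inter> C = {}" "\<omega>' = p \<circ> \<phi>'"
        have "p (\<phi>' x') = \<beta> (\<theta> x)" using *(5) by (simp add: \<theta>(2) \<phi>'(3))
        then show ?thesis using out[OF \<phi>'(2) *(4)] by (simp add: p_eq_\<beta>_iff)
      qed
    next
      fix \<phi> assume \<phi>: "\<phi> \<in> \<Phi> k" "\<phi> ` open_disc k \<inter> C = {}" "\<omega> = p \<circ> \<phi>"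
      from *(2) show ?thesis
      proof (rule \<Omega>_cases)
        fix \<theta>' assume \<theta>': "\<theta>' \<in> \<Theta> k" "\<omega>' = \<beta> \<circ> \<theta>'"
        have "p (\<phi> x) = \<beta> (\<theta>' x')" using *(5) by (simp add: \<theta>'(2) \<phi>(3))
        then show ?thesis using out[OF \<phi>(2) *(3)] by (simp add: p_eq_\<beta>_iff)
      next
        fix \<phi>' assume \<phi>': "\<phi>' \<in> \<Phi> k" "\<phi>' ` open_disc k \<inter> C = {}" "\<omega>' = p \<circ> \<phi>'"
        have "\<phi> x = \<phi>' x'"
          using *(5) out[OF \<phi>'(2) *(4)] by (simp add: \<phi>(3) \<phi>'(3) p_eq_\<alpha>)
        from A.cell_inj[OF \<phi>(1) \<phi>'(1) *(3,4) this] show ?thesis by (simp add: \<phi>(3) \<phi>'(3))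
      qed
    qed
  qed
  show "(\<lambda>(\<omega>, x). \<omega> x) ` (\<Omega> k \<times> open_disc k) = wk k - lower wk k"
  proof (intro subset_antisym subsetI)
    fix w assume "w \<in> (\<lambda>(\<omega>, x). \<omega> x) ` (\<Omega> k \<times> open_disc k)"
    then obtain \<omega> x where \<omega>: "\<omega> \<in> \<Omega> k" "x \<in> open_disc k" "w = \<omega> x" by auto
    from \<omega>(1) show "w \<in> wk k - lower wk k"
    proof (rule \<Omega>_cases)
      fix \<theta> assume "\<theta> \<in> \<Theta> k" "\<omega> = \<beta> \<circ> \<theta>"
      then show ?thesis using D.cell_open[OF _ \<omega>(2)] \<omega>(3) by (simp add: \<beta>_in_wk \<beta>_in_lower_wk)
    next
      fix \<phi> assume \<phi>: "\<phi> \<in> \<Phi> k" "\<phi> ` open_disc k \<inter> C = {}" "\<omega> = p \<circ> \<phi>"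
      then have "\<phi> x \<notin> C" using \<omega>(2) by blast
      then show ?thesis
        using A.cell_open[OF \<phi>(1) \<omega>(2)] \<omega>(3) \<phi>(3) by (simp add: \<alpha>_in_wk \<alpha>_in_lower_wk)
    qed
  next
    fix w assume w: "w \<in> wk k - lower wk k"
    then consider z where "w = \<beta> z" | x where "x \<in> sk k" "x \<notin> C" "w = p x"
      unfolding wk_def using p_C by blast
    then show "w \<in> (\<lambda>(\<omega>, x). \<omega> x) ` (\<Omega> k \<times> open_disc k)"
    proof cases
      case 1
      then have "z \<in> uk k" "z \<notin> lower uk k" using w by (simp_all add: \<beta>_in_wk \<beta>_in_lower_wk)
      then obtain \<theta> x where \<theta>: "\<theta> \<in> \<Theta> k" "x \<in> open_disc k" "z = \<theta> x" by (rule D.cell_cases)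
      then have "\<beta> \<circ> \<theta> \<in> \<Omega> k" by (simp add: \<Omega>_def)
      then show ?thesis using 1 \<theta> by (intro image_eqI[of _ _ "(\<beta> \<circ> \<theta>, x)"]) auto
    next
      case 2
      then have "x \<notin> lower sk k" using w by (simp add: \<alpha>_in_lower_wk)
      with 2(1) obtain \<phi> y where \<phi>: "\<phi> \<in> \<Phi> k" "y \<in> open_disc k" "x = \<phi> y" by (rule A.cell_cases)
      then have "\<phi> ` open_disc k \<inter> C = {}" using cells_C[OF \<phi>(1)] 2(2) by blast
      then have "p \<circ> \<phi> \<in> \<Omega> k" using \<phi>(1) by (simp add: \<Omega>_def)
      then show ?thesis using 2 \<phi> by (intro image_eqI[of _ _ "(p \<circ> \<phi>, y)"]) auto
    qed
  qed
qed

text \<open>Closedness in \<open>W\<close> means closedness of the preimages \<open>T\<close> in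
  \<open>Z\<close> and \<open>U\<close> in \<open>X\<close>. Cells of \<open>X\<close> inside
  \<open>C\<close> are not cells of \<open>W\<close>; on them \<open>U\<close> is controlled by
  \<open>T\<close> through \<open>f \<circ> s\<close>, so \<open>T\<close> is settled before
  \<open>U\<close>.\<close>

lemma W_stage:
  assumes S: "S \<subseteq> wk k" and low: "closedin W (S \<inter> lower wk k)"
    and cl: "\<And>\<omega>. \<omega> \<in> \<Omega> k \<Longrightarrow> closedin (unit_disc k) {x \<in> topspace (unit_disc k). \<omega> x \<in> S}"
  shows "closedin W S"
proof -
  define T where "T = {z \<in> topspace Z. \<beta> z \<in> S}"
  define U where "U = {x \<in> topspace X. p x \<in> S}"
  have T: "closedin Z T"
  proof (rule D.closedin_stage)
    show "T \<subseteq> uk k" using S by (auto simp: T_def \<beta>_in_wk subset_iff)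
    have "T \<inter> lower uk k = {z \<in> topspace Z. \<beta> z \<in> S \<inter> lower wk k}"
      by (auto simp: T_def \<beta>_in_lower_wk)
    then show "closedin Z (T \<inter> lower uk k)" using low unfolding closedin_W by simp
    fix \<theta> assume \<theta>: "\<theta> \<in> \<Theta> k"
    have eq: "{x \<in> topspace (unit_disc k). \<theta> x \<in> T} = {x \<in> topspace (unit_disc k). (\<beta> \<circ> \<theta>) x \<in> S}"
      using D.cell_in_sk[OF \<theta>] D.sk_subset by (auto simp: T_def)
    have "\<beta> \<circ> \<theta> \<in> \<Omega> k" using \<theta> by (simp add: \<Omega>_def)
    then show "closedin (unit_disc k) {x \<in> topspace (unit_disc k). \<theta> x \<in> T}"
      unfolding eq by (rule cl)
  qed
  have "closedin X (U \<inter> sk k)"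
  proof (rule A.closedin_stage)
    have "U \<inter> sk k \<inter> lower sk k = {x \<in> topspace X. p x \<in> S \<inter> lower wk k} \<inter> lower sk k"
      using A.lower_subset by (auto simp: U_def lower_wk)
    moreover have "closedin X \<dots>"
      using low A.closedin_lower unfolding closedin_W by (blast intro: closedin_Int)
    ultimately show "closedin X (U \<inter> sk k \<inter> lower sk k)" by (simp only:)
    fix \<phi> assume \<phi>: "\<phi> \<in> \<Phi> k"
    have \<phi>X: "\<phi> x \<in> topspace X" "\<phi> x \<in> sk k" if "x \<in> topspace (unit_disc k)" for x
      using A.cell_in_sk[OF \<phi> that] A.sk_subset by auto
    show "closedin (unit_disc k) {x \<in> topspace (unit_disc k). \<phi> x \<in> U \<inter> sk k}"
    proof (cases "\<phi> ` open_disc k \<subseteq> C")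
      case True
      have "{x \<in> topspace (unit_disc k). \<phi> x \<in> U \<inter> sk k} = {x \<in> topspace (unit_disc k). ((f \<circ> s) \<circ> \<phi>) x \<in> T}"
        using \<phi>X cell_in_C[OF \<phi> True] funcset_mem[OF continuous_map_funspace[OF fs_continuous]]
        by (auto simp: U_def T_def p_C)
      moreover have "closedin (unit_disc k) \<dots>"
        by (rule closedin_continuous_map_preimage[OF
              continuous_map_compose[OF A.cell_continuous[OF \<phi>] fs_continuous] T])
      ultimately show ?thesis by (simp only:)
    next
      case False
      then have "p \<circ> \<phi> \<in> \<Omega> k" using \<phi> cells_C[OF \<phi>] by (simp add: \<Omega>_def)
      then have "closedin (unit_disc k) {x \<in> topspace (unit_disc k). (p \<circ> \<phi>) x \<in> S}" by (rule cl)
      moreover have "{x \<in> topspace (unit_disc k). \<phi> x \<in> U \<inter> sk k} = {x \<in> topspace (unit_disc k). (p \<circ> \<phi>) x \<in> S}"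
        using \<phi>X by (auto simp: U_def)
      ultimately show ?thesis by (simp only:)
    qed
  qed simp
  moreover have "closedin X (C \<inter> {x \<in> topspace X. (f \<circ> s) x \<in> T})"
    by (rule closedin_Int[OF closedin_C closedin_continuous_map_preimage[OF fs_continuous T]])
  ultimately have "closedin X ((U \<inter> sk k) \<union> (C \<inter> {x \<in> topspace X. (f \<circ> s) x \<in> T}))"
    by (rule closedin_Un)
  \<comment> \<open>\<open>U\<close> need not lie in \<open>sk k\<close>: points of \<open>C\<close>
    of higher dimension may be sent into the \<open>k\<close>-skeleton of \<open>Z\<close> by
    \<open>f \<circ> s\<close>. These make up the second part; off \<open>C\<close> only points of
    \<open>sk k\<close> occur.\<close>
  moreover have "U = (U \<inter> sk k) \<union> (C \<inter> {x \<in> topspace X. (f \<circ> s) x \<in> T})"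
  proof -
    have "x \<in> sk k \<or> (x \<in> C \<and> (f \<circ> s) x \<in> T)" if x: "x \<in> U" for x
    proof (cases "x \<in> C")
      case True
      then show ?thesis
        using x funcset_mem[OF continuous_map_funspace[OF fs_continuous], of x]
        by (auto simp: U_def T_def p_C)
    next
      case False
      then show ?thesis using x S \<alpha>_in_wk[OF False, of k] by (auto simp: U_def)
    qed
    moreover have "x \<in> U" if "x \<in> C" "(f \<circ> s) x \<in> T" for x
      using that C_subset by (auto simp: U_def T_def p_C)
    ultimately show ?thesis by (auto simp: U_def)
  qed
  ultimately have "closedin X U" by (simp only:)
  moreover have "S \<subseteq> topspace W"
    using S A.sk_subset[of k] D.sk_subset[of k] unfolding wk_def topspace_W by blast
  ultimately show ?thesis using T unfolding closedin_W U_def T_def by blast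
qed

lemma W_weak:
  assumes S: "S \<subseteq> topspace W" and cl: "\<And>k. closedin W (S \<inter> wk k)"
  shows "closedin W S"
  unfolding closedin_W
proof (intro conjI S)
  show "closedin X {x \<in> topspace X. p x \<in> S}"
  proof (rule A.closedin_weak)
    fix k
    have "closedin X ({x \<in> topspace X. p x \<in> S \<inter> wk k} \<inter> sk k)"
      using cl[of k] A.closedin_sk unfolding closedin_W by (blast intro: closedin_Int)
    moreover have "{x \<in> topspace X. p x \<in> S \<inter> wk k} \<inter> sk k = {x \<in> topspace X. p x \<in> S} \<inter> sk k"
      by (auto simp: wk_def)
    ultimately show "closedin X ({x \<in> topspace X. p x \<in> S} \<inter> sk k)" by (simp only:)
  qed auto
  show "closedin Z {z \<in> topspace Z. \<beta> z \<in> S}"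
  proof (rule D.closedin_weak)
    fix k
    have "closedin Z ({x \<in> topspace Z. \<beta> x \<in> S \<inter> wk k} \<inter> uk k)"
      using cl[of k] D.closedin_sk unfolding closedin_W by (blast intro: closedin_Int)
    moreover have "{x \<in> topspace Z. \<beta> x \<in> S \<inter> wk k} \<inter> uk k = {x \<in> topspace Z. \<beta> x \<in> S} \<inter> uk k"
      by (auto simp: wk_def)
    ultimately show "closedin Z ({z \<in> topspace Z. \<beta> z \<in> S} \<inter> uk k)" by (simp only:)
  qed auto
qed

sublocale W: cell_complex W wk \<Omega>
proof
  show "(\<Union>k. wk k) = topspace W"
    unfolding wk_def topspace_W A.Union_sk[symmetric] D.Union_sk[symmetric] by blast
  show "wk k \<subseteq> wk (Suc k)" for k
    using A.sk_Suc[of k] D.sk_Suc[of k] by (auto simp: wk_def)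
  show "continuous_map (unit_disc k) W \<omega>" if "\<omega> \<in> \<Omega> k" for \<omega> k
    using that A.cell_continuous[of _ k] D.cell_continuous[of _ k]
    by (elim \<Omega>_cases)
      (simp_all add: continuous_map_compose[OF _ p_continuous] continuous_map_compose[OF _ \<beta>_continuous])
  show "\<omega> x \<in> lower wk k" if "\<omega> \<in> \<Omega> k" "x \<in> disc_boundary k" for \<omega> k x
    using that A.cell_boundary D.cell_boundary unfolding \<Omega>_def lower_wk by auto
qed (fact wk_cell_bij W_stage W_weak)+

section \<open>Maps out of the pushout and deformations of it\<close>

lemma continuous_map_from_W:
  assumes u: "continuous_map X Q u" and v: "continuous_map Z Q v"
    and w: "\<And>x. x \<in> topspace X \<Longrightarrow> w (p x) = u x" "\<And>z. z \<in> topspace Z \<Longrightarrow> w (\<beta> z) = v z"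
  shows "continuous_map W Q w"
  unfolding continuous_map_def
proof (intro conjI allI impI)
  show "w \<in> topspace W \<rightarrow> topspace Q"
    using w continuous_map_funspace[OF u] continuous_map_funspace[OF v]
    by (auto simp: topspace_W)
  fix U assume U: "openin Q U"
  have "{x \<in> topspace X. p x \<in> {y \<in> topspace W. w y \<in> U}} = {x \<in> topspace X. u x \<in> U}"
    "{z \<in> topspace Z. \<beta> z \<in> {y \<in> topspace W. w y \<in> U}} = {z \<in> topspace Z. v z \<in> U}"
    by (simp_all add: w topspace_W cong: conj_cong)
  then show "openin W {y \<in> topspace W. w y \<in> U}"
    unfolding openin_W using openin_continuous_map_preimage[OF u U] openin_continuous_map_preimage[OF v U]
    by simp
qed

text \<open>The set-level half of the universal property; continuity is supplied by
  \<open>continuous_map_from_W\<close>. The hypothesis is exactly what makes the prescriptions agree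
  on \<open>C\<close>.\<close>

lemma W_factor:
  assumes "\<And>y. y \<in> topspace Y \<Longrightarrow> u (r y) = v (f y)"
  obtains w where "\<And>x. x \<in> topspace X \<Longrightarrow> w (p x) = u x" "\<And>z. z \<in> topspace Z \<Longrightarrow> w (\<beta> z) = v z"
proof
  let ?w = "\<lambda>y. if y \<in> range \<beta> then v (inv_into UNIV \<beta> y) else u (inv_into UNIV \<alpha> y)"
  show "?w (\<beta> z) = v z" for z using inj_\<beta> by simp
  fix x assume x: "x \<in> topspace X"
  show "?w (p x) = u x"
  proof (cases "x \<in> C")
    case True
    then obtain y where y: "y \<in> topspace Y" "x = r y" by (auto simp: C_def)
    then show ?thesis using inj_\<beta> assms[OF y(1)] p_r[OF y(1)] by simp
  next
    case False
    then show ?thesis using inj_\<alpha> \<alpha>_neq_\<beta> by (auto simp: p_not_C)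
  qed
qed

text \<open>Puts \<open>W\<close> into the form required by \<open>coherent_prod\<close>, so that
  homotopies on \<open>W\<close> can be prescribed over \<open>X\<close> and over
  \<open>Z\<close>.\<close>

lemma coherent_W: "coherent W {(X, p), (Z, \<beta>)}"
proof (rule coherentI_closedin)
  show "continuous_map T W g" if "(T, g) \<in> {(X, p), (Z, \<beta>)}" for T g
    using that p_continuous \<beta>_continuous by auto
  show "\<exists>(T, g)\<in>{(X, p), (Z, \<beta>)}. x \<in> g ` topspace T" if "x \<in> topspace W" for x
    using that by (auto simp: topspace_W)
  show "closedin W S" if "S \<subseteq> topspace W"
    "\<And>T g. (T, g) \<in> {(X, p), (Z, \<beta>)} \<Longrightarrow> closedin T {z \<in> topspace T. g z \<in> S}" for S
    unfolding closedin_W using that(1) that(2)[of X p] that(2)[of Z \<beta>] by simp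
qed

text \<open>\<open>G\<close> fixes \<open>C\<close> pointwise at all times, so it descends to a
  homotopy on \<open>W\<close> that is constant on the copy of \<open>Z\<close>.\<close>

lemma pair_deformation:
  obtains N G G' where "openin X N" "C \<subseteq> N"
    "continuous_map (prod_topology unit_interval X) X G"
    "\<And>x. x \<in> topspace X \<Longrightarrow> G (0, x) = x"
    "\<And>t x. \<lbrakk>t \<in> {0..1}; x \<in> C\<rbrakk> \<Longrightarrow> G (t, x) = x"
    "\<And>x. x \<in> N \<Longrightarrow> G (1, x) \<in> C"
    "continuous_map (prod_topology unit_interval W) W G'"
    "\<And>t x. \<lbrakk>t \<in> {0..1}; x \<in> topspace X\<rbrakk> \<Longrightarrow> G' (t, p x) = p (G (t, x))"
    "\<And>t z. \<lbrakk>t \<in> {0..1}; z \<in> topspace Z\<rbrakk> \<Longrightarrow> G' (t, \<beta> z) = \<beta> z"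
proof -
  obtain N G where N: "openin X N" "C \<subseteq> N" and G: "continuous_map (prod_topology unit_interval X) X G"
    "\<And>x. x \<in> topspace X \<Longrightarrow> G (0, x) = x"
    "\<And>t x. \<lbrakk>t \<in> {0..1}; x \<in> C\<rbrakk> \<Longrightarrow> G (t, x) = x" "\<And>x. x \<in> N \<Longrightarrow> G (1, x) \<in> C"
    by (rule A.subcomplex_deformation[OF closedin_C cells_C]) (assumption, rule that)
  define G' where "G' q = (if snd q \<in> range \<beta> then snd q else p (G (fst q, inv_into UNIV \<alpha> (snd q))))" for q
  have G'X: "G' (t, p x) = p (G (t, x))" if "t \<in> {0..1}" "x \<in> topspace X" for t x
  proof (cases "x \<in> C")
    case True
    then show ?thesis using G(3)[OF that(1) True] by (simp add: G'_def p_C)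
  next
    case False
    then show ?thesis using inj_\<alpha> \<alpha>_neq_\<beta> by (auto simp: G'_def p_not_C)
  qed
  have G'Z: "G' (t, \<beta> z) = \<beta> z" for t z by (simp add: G'_def)
  have "continuous_map (prod_topology unit_interval W) W G'"
  proof (rule continuous_map_coherent[OF coherent_prod[OF coherent_W]])
    show "compact_space unit_interval" by (simp add: compact_space_subtopology)
    show "regular_space unit_interval"
      by (intro regular_space_subtopology regular_space_euclidean)
    fix T :: "(real \<times> 'a) topology" and g :: "real \<times> 'a \<Rightarrow> real \<times> 'a"
    assume "(T, g) \<in> (\<lambda>(Z, g). (prod_topology unit_interval Z, \<lambda>(t, z). (t, g z))) ` {(X, p), (Z, \<beta>)}"
    then consider "T = prod_topology unit_interval X" "g = (\<lambda>(t, x). (t, p x))"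
      | "T = prod_topology unit_interval Z" "g = (\<lambda>(t, z). (t, \<beta> z))" by auto
    then show "continuous_map T W (G' \<circ> g)"
    proof cases
      case 1
      have "continuous_map T W (p \<circ> G)"
        unfolding 1 using G(1) p_continuous by (rule continuous_map_compose)
      then show ?thesis by (rule continuous_map_eq) (auto simp: 1 G'X)
    next
      case 2
      have "continuous_map T W (\<beta> \<circ> snd)"
        unfolding 2 using continuous_map_snd \<beta>_continuous by (rule continuous_map_compose)
      then show ?thesis by (rule continuous_map_eq) (auto simp: 2 G'Z)
    qed
  qed
  then show ?thesis using N G G'X G'Z by (intro that)
qed

lemma closedin_\<beta>: "closedin W (\<beta> ` topspace Z)"
proof -
  have "{x \<in> topspace X. p x \<in> \<beta> ` topspace Z} = C"
    using C_subset funcset_mem[OF continuous_map_funspace[OF fs_continuous]]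
    by (auto simp: p_eq_\<beta>_iff image_iff)
  moreover have "{z \<in> topspace Z. \<beta> z \<in> \<beta> ` topspace Z} = topspace Z" by auto
  ultimately show ?thesis
    unfolding closedin_W topspace_W using closedin_C by simp
qed

text \<open>As \<open>U\<close> contains \<open>C\<close>, the preimages of this set are just
  \<open>U\<close> in \<open>X\<close> and all of \<open>Z\<close>.\<close>

lemma openin_p_image:
  assumes "openin X U" "C \<subseteq> U"
  shows "openin W (\<beta> ` topspace Z \<union> p ` U)"
proof -
  have "{x \<in> topspace X. p x \<in> \<beta> ` topspace Z \<union> p ` U} = U"
  proof (intro subset_antisym subsetI)
    fix x assume x: "x \<in> {x \<in> topspace X. p x \<in> \<beta> ` topspace Z \<union> p ` U}"
    show "x \<in> U"
    proof (cases "x \<in> C")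
      case False
      then have "p x \<in> p ` U" using x p_eq_\<beta>_iff by auto
      then obtain x' where x': "x' \<in> U" "p x' = p x" by (metis imageE)
      then show ?thesis using p_eq_\<alpha>[OF False, of x'] by simp
    qed (use assms in blast)
  qed (use openin_subset[OF assms(1)] in auto)
  moreover have "{z \<in> topspace Z. \<beta> z \<in> \<beta> ` topspace Z \<union> p ` U} = topspace Z" by auto
  ultimately show ?thesis
    unfolding openin_W topspace_W using assms openin_subset[OF assms(1)] by auto
qed

text \<open>Identifies what is left after excising \<open>C\<close> from \<open>X\<close> and the
  copy of \<open>Z\<close> from \<open>W\<close>. Off \<open>C\<close> the map \<open>p\<close>
  glues nothing, so open subsets of \<open>X - C\<close> are preimages of their images, which makes
  \<open>p\<close> open there.\<close>

lemma p_homeomorphism: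
  "homeomorphic_map (subtopology X (topspace X - C)) (subtopology W (topspace W - \<beta> ` topspace Z)) p"
proof (rule bijective_open_imp_homeomorphic_map)
  have top: "topspace (subtopology X (topspace X - C)) = topspace X - C"
    "topspace (subtopology W (topspace W - \<beta> ` topspace Z)) = topspace W - \<beta> ` topspace Z" by auto
  have im: "p ` (topspace X - C) = topspace W - \<beta> ` topspace Z"
  proof (intro subset_antisym subsetI)
    fix w assume "w \<in> topspace W - \<beta> ` topspace Z"
    then obtain x where "x \<in> topspace X" "w = p x" "w \<notin> \<beta> ` topspace Z" by (auto simp: topspace_W)
    moreover from this have "x \<notin> C"
      using p_C funcset_mem[OF continuous_map_funspace[OF fs_continuous]] by auto
    ultimately show "w \<in> p ` (topspace X - C)" by blast
  qed (auto simp: topspace_W p_eq_\<beta>_iff)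
  show "p ` topspace (subtopology X (topspace X - C)) = topspace (subtopology W (topspace W - \<beta> ` topspace Z))"
    unfolding top by (rule im)
  show "continuous_map (subtopology X (topspace X - C)) (subtopology W (topspace W - \<beta> ` topspace Z)) p"
    unfolding continuous_map_in_subtopology top
    using im continuous_map_from_subtopology[OF p_continuous] by blast
  show "inj_on p (topspace (subtopology X (topspace X - C)))"
    unfolding top using p_eq_\<alpha> by (auto simp: inj_on_def)
  show "open_map (subtopology X (topspace X - C)) (subtopology W (topspace W - \<beta> ` topspace Z)) p"
    unfolding open_map_def
  proof (intro allI impI)
    fix U assume "openin (subtopology X (topspace X - C)) U"
    then have U: "openin X U" "U \<subseteq> topspace X - C"
      by (simp_all add: openin_open_subtopology openin_diff[OF openin_topspace closedin_C])
    have "{x \<in> topspace X. p x \<in> p ` U} = U"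
    proof (intro subset_antisym subsetI)
      fix x assume "x \<in> {x \<in> topspace X. p x \<in> p ` U}"
      then have "p x \<in> p ` U" by simp
      then show "x \<in> U"
      proof
        fix u assume u: "p x = p u" "u \<in> U"
        then have "u \<notin> C" using U(2) by blast
        then show "x \<in> U" using p_eq_\<alpha>[of u x] u by simp
      qed
    qed (use U(2) in auto)
    moreover have "{z \<in> topspace Z. \<beta> z \<in> p ` U} = {}"
    proof -
      have "\<beta> z \<notin> p ` U" for z
      proof
        assume "\<beta> z \<in> p ` U"
        then show False
        proof
          fix u assume "\<beta> z = p u" "u \<in> U"
          then show False using U(2) p_eq_\<beta>_iff[of u z] by auto
        qed
      qed
      then show ?thesis by blast
    qed
    moreover have "p ` U \<subseteq> topspace W" using U(2) by (auto simp: topspace_W)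
    ultimately have "openin W (p ` U)" unfolding openin_W by (simp only: U(1) openin_empty simp_thms)
    moreover have "p ` U \<subseteq> topspace W - \<beta> ` topspace Z" using U(2) im by blast
    ultimately show "openin (subtopology W (topspace W - \<beta> ` topspace Z)) (p ` U)"
      by (simp add: openin_open_subtopology openin_diff[OF openin_topspace closedin_\<beta>])
  qed
qed

end


section \<open>Homology of pushouts\<close>

context homology_theory
begin

lemma ind_closed: "\<lbrakk>pair_map X S Y T f; c \<in> carrier (H p X S)\<rbrakk> \<Longrightarrow> ind p X S Y T f c \<in> carrier (H p Y T)"
  by (rule hom_in_carrier[OF ind_hom])

text \<open>The functoriality axioms do not say that values of a map outside the space are
  irrelevant. Maps that agree on the space are homotopic, so the homotopy axiom gives this.\<close>

lemma ind_cong: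
  assumes "pair_map X S Y T f" "\<And>x. x \<in> topspace X \<Longrightarrow> f x = g x" "c \<in> carrier (H p X S)"
  shows "ind p X S Y T f c = ind p X S Y T g c"
proof (rule homotopy)
  show "S \<subseteq> topspace X" "T \<subseteq> topspace Y" using assms(1) by (auto simp: pair_map_def)
  show "homotopic_with (\<lambda>h. h \<in> S \<rightarrow> T) X Y f g"
  proof (rule homotopic_with_equal)
    show "f \<in> S \<rightarrow> T" "continuous_map X Y f" using assms(1) by (auto simp: pair_map_def)
    show "g \<in> S \<rightarrow> T"
    proof
      fix x assume "x \<in> S"
      then have "f x \<in> T" "x \<in> topspace X" using assms(1) by (auto simp: pair_map_def)
      then show "g x \<in> T" using assms(2)[of x] by simp
    qed
  qed (use assms in auto)
qed fact

lemma ind_left_inverse: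
  assumes f: "pair_map X S Y T f" and g: "pair_map Y T X S g"
    and gf: "\<And>x. x \<in> topspace X \<Longrightarrow> g (f x) = x" and c: "c \<in> carrier (H p X S)"
  shows "ind p Y T X S g (ind p X S Y T f c) = c"
proof -
  have S: "S \<subseteq> topspace X" using f by (simp add: pair_map_def)
  then have "pair_map X S X S id" by (simp add: pair_map_def)
  then have "ind p X S X S id c = ind p X S X S (g \<circ> f) c"
    by (rule ind_cong) (use gf c in auto)
  then show ?thesis
    using ind_compose[OF f g c] ind_id[OF S c] by simp
qed

lemma ind_iso:
  assumes f: "pair_map X S Y T f" and g: "pair_map Y T X S g"
    and gf: "\<And>x. x \<in> topspace X \<Longrightarrow> g (f x) = x" and fg: "\<And>y. y \<in> topspace Y \<Longrightarrow> f (g y) = y"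
  shows "ind p X S Y T f \<in> iso (H p X S) (H p Y T)"
proof -
  have "bij_betw (ind p X S Y T f) (carrier (H p X S)) (carrier (H p Y T))"
    by (rule bij_betw_byWitness[where f' = "ind p Y T X S g"])
      (use ind_left_inverse[OF f g gf] ind_left_inverse[OF g f fg] ind_closed[OF f] ind_closed[OF g] in blast)+
  then show ?thesis using ind_hom[OF f] by (simp add: iso_def)
qed

lemma group_rank_homeomorphic:
  assumes "continuous_map X Y f" "continuous_map Y X g"
    and "\<And>x. x \<in> topspace X \<Longrightarrow> g (f x) = x" "\<And>y. y \<in> topspace Y \<Longrightarrow> f (g y) = y"
  shows "group_rank (H p X {}) = group_rank (H p Y {})"
proof (rule group_rank_iso)
  show "ind p X {} Y {} f \<in> iso (H p X {}) (H p Y {})"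
    by (rule ind_iso[where g = g]) (use assms in \<open>auto simp: pair_map_def\<close>)
qed (simp_all add: abelian)

text \<open>The retraction makes the inclusion of \<open>C\<close> injective on homology in every
  degree. In degree \<open>p - 1\<close> this forces the boundary map to vanish, so the map to
  relative homology is onto and the long exact sequence breaks into short ones.\<close>

lemma group_rank_retract:
  assumes C: "C \<subseteq> topspace X" and \<rho>: "continuous_map X (subtopology X C) \<rho>" "\<And>c. c \<in> C \<Longrightarrow> \<rho> c = c"
  shows "group_rank (H p X {}) = group_rank (H p (subtopology X C) {}) + group_rank (H p X C)"
proof (rule group_rank_short_exact)
  \<comment> \<open>The degree stays a parameter, as injectivity is used in degrees \<open>p\<close>
    and \<open>p - 1\<close>.\<close>
  let ?i = "\<lambda>p. ind p (subtopology X C) {} X {} id"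
  let ?j = "ind p X {} X C id"
  have pm: "pair_map (subtopology X C) {} X {} id" "pair_map X {} (subtopology X C) {} \<rho>"
    "pair_map X {} X C id"
    using C \<rho>(1) by (auto simp: pair_map_def continuous_map_from_subtopology)
  have left: "ind p X {} (subtopology X C) {} \<rho> (?i p c) = c"
    if "c \<in> carrier (H p (subtopology X C) {})" for p c
    by (rule ind_left_inverse[OF pm(1,2) _ that]) (use \<rho>(2) in auto)
  have inj: "inj_on (?i p) (carrier (H p (subtopology X C) {}))" for p
    by (rule inj_on_inverseI) (rule left)
  then show "inj_on (?i p) (carrier (H p (subtopology X C) {}))" .
  show "?i p \<in> hom (H p (subtopology X C) {}) (H p X {})" "?j \<in> hom (H p X {}) (H p X C)"
    using pm by (simp_all add: ind_hom)
  show cg: "comm_group (H p (subtopology X C) {})" "comm_group (H p X {})" "comm_group (H p X C)"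
    using C by (simp_all add: abelian)
  show "kernel (H p X {}) (H p X C) ?j = ?i p ` carrier (H p (subtopology X C) {})"
    using exact_space[OF C, of p] by simp
  have bd: "bd p X C c = \<one>\<^bsub>H (p - 1) (subtopology X C) {}\<^esub>" if c: "c \<in> carrier (H p X C)" for c
  proof -
    let ?K = "H (p - 1) (subtopology X C) {}"
    have "kernel ?K (H (p - 1) X {}) (?i (p - 1)) = bd p X C ` carrier (H p X C)"
      using exact_boundary[OF C, of p] by simp
    then have *: "bd p X C c \<in> carrier ?K" "?i (p - 1) (bd p X C c) = \<one>\<^bsub>H (p - 1) X {}\<^esub>"
      using c unfolding kernel_def by blast+
    have grp: "group ?K" "group (H (p - 1) X {})"
      using abelian[of "{}"] by (simp_all add: comm_group.axioms(2))
    have "?i (p - 1) \<one>\<^bsub>?K\<^esub> = \<one>\<^bsub>H (p - 1) X {}\<^esub>"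
      by (rule hom_one[OF ind_hom[OF pm(1)] grp])
    then show ?thesis
      using inj_onD[OF inj[of "p - 1"], of "bd p X C c" "\<one>\<^bsub>?K\<^esub>"] * monoid.one_closed[OF group.is_monoid[OF grp(1)]]
      by simp
  qed
  have "kernel (H p X C) (H (p - 1) (subtopology X C) {}) (bd p X C) = ?j ` carrier (H p X {})"
    using exact_pair[OF C, of p] by simp
  moreover have "kernel (H p X C) (H (p - 1) (subtopology X C) {}) (bd p X C) = carrier (H p X C)"
    using bd by (auto simp: kernel_def)
  ultimately show "?j ` carrier (H p X {}) = carrier (H p X C)" by simp
qed

text \<open>The deformation \<open>G\<close> may leave \<open>N\<close>, so it only shows that \<open>H\<^sub>n(X, C) \<rightarrow> H\<^sub>n(X, N)\<close> has a left inverse.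
  Together with the compatible deformation \<open>G'\<close> of \<open>W\<close> and excision this is enough: injectivity comes
  from the left inverse over \<open>X\<close>, surjectivity by applying both left inverses to a class lifted
  to \<open>H\<^sub>n(X, N)\<close>.\<close>

lemma relative_homeomorphism_iso:
  assumes C: "closedin X C" and E: "closedin W E" and N: "openin X N" "C \<subseteq> N" and M: "openin W M" "E \<subseteq> M"
    and p: "continuous_map X W p" "p ` C \<subseteq> E" "p ` N \<subseteq> M" "M - E \<subseteq> p ` (N - C)"
    and homeo: "homeomorphic_map (subtopology X (topspace X - C)) (subtopology W (topspace W - E)) p"
    and G: "continuous_map (prod_topology unit_interval X) X G"
      "\<And>x. x \<in> topspace X \<Longrightarrow> G (0, x) = x" "\<And>t x. \<lbrakk>t \<in> {0..1}; x \<in> C\<rbrakk> \<Longrightarrow> G (t, x) = x"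
      "\<And>x. x \<in> N \<Longrightarrow> G (1, x) \<in> C"
    and G': "continuous_map (prod_topology unit_interval W) W G'"
      "\<And>x. x \<in> topspace W \<Longrightarrow> G' (0, x) = x" "\<And>t x. \<lbrakk>t \<in> {0..1}; x \<in> E\<rbrakk> \<Longrightarrow> G' (t, x) = x"
      "\<And>x. x \<in> M \<Longrightarrow> G' (1, x) \<in> E"
    and G'_p: "\<And>x. x \<in> topspace X \<Longrightarrow> G' (1, p x) = p (G (1, x))"
  shows "ind n X C W E p \<in> iso (H n X C) (H n W E)"
proof -
  have sub: "C \<subseteq> topspace X" "N \<subseteq> topspace X" "E \<subseteq> topspace W" "M \<subseteq> topspace W"
    using closedin_subset[OF C] openin_subset[OF N(1)] closedin_subset[OF E] openin_subset[OF M(1)] by auto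
  let ?X' = "subtopology X (topspace X - C)" and ?W' = "subtopology W (topspace W - E)"
  \<comment> \<open>Stated for general pairs because it is applied in \<open>X\<close> and in
    \<open>W\<close>. The time-one map sends \<open>N'\<close> into \<open>C'\<close> and, as a map
    of the pair \<open>(T, C')\<close>, is homotopic to the identity.\<close>
  have retract: "ind n T N' T C' (\<lambda>x. K (1, x)) (ind n T C' T N' id c) = c"
    "pair_map T N' T C' (\<lambda>x. K (1, x))"
    if T: "C' \<subseteq> N'" "N' \<subseteq> topspace T" and K: "continuous_map (prod_topology unit_interval T) T K"
      "\<And>x. x \<in> topspace T \<Longrightarrow> K (0, x) = x" "\<And>t x. \<lbrakk>t \<in> {0..1}; x \<in> C'\<rbrakk> \<Longrightarrow> K (t, x) = x"
      "\<And>x. x \<in> N' \<Longrightarrow> K (1, x) \<in> C'" and c: "c \<in> carrier (H n T C')"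
    for T N' C' c and K :: "real \<times> 'a \<Rightarrow> 'a"
  proof -
    have "continuous_map T (prod_topology unit_interval T) (\<lambda>x. (1, x))"
      by (simp add: continuous_map_pairwise o_def)
    from continuous_map_compose[OF this K(1)]
    have cont: "continuous_map T T (\<lambda>x. K (1, x))" by (simp add: o_def)
    then show pm: "pair_map T N' T C' (\<lambda>x. K (1, x))"
      using T K(4) by (auto simp: pair_map_def)
    have C': "C' \<subseteq> topspace T" using T by blast
    have pm': "pair_map T C' T N' id" using T by (auto simp: pair_map_def)
    have "homotopic_with (\<lambda>h. h \<in> C' \<rightarrow> C') T T id (\<lambda>x. K (1, x))"
    proof (subst homotopic_with)
      show "(\<lambda>h. h \<in> C' \<rightarrow> C') h = (\<lambda>h. h \<in> C' \<rightarrow> C') k" if "\<And>x. x \<in> topspace T \<Longrightarrow> h x = k x" for h k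
        using that C' by (auto simp: Pi_iff subset_iff)
      show "\<exists>h. continuous_map (prod_topology unit_interval T) T h \<and>
          (\<forall>x\<in>topspace T. h (0, x) = id x) \<and> (\<forall>x\<in>topspace T. h (1, x) = K (1, x)) \<and>
          (\<forall>t\<in>{0..1}. (\<lambda>x. h (t, x)) \<in> C' \<rightarrow> C')"
        by (rule exI[of _ K]) (use K in auto)
    qed
    from homotopy[OF C' C' this c]
    have "ind n T C' T C' ((\<lambda>x. K (1, x)) \<circ> id) c = c"
      using ind_id[OF C' c] by simp
    then show "ind n T N' T C' (\<lambda>x. K (1, x)) (ind n T C' T N' id c) = c"
      using ind_compose[OF pm' pm c] by simp
  qed
  have exX: "ind n ?X' (N - C) X N id \<in> iso (H n ?X' (N - C)) (H n X N)"
    by (rule excision) (use N sub in \<open>simp_all add: closure_of_closedin[OF C] interior_of_openin\<close>)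
  have exW: "ind n ?W' (M - E) W M id \<in> iso (H n ?W' (M - E)) (H n W M)"
    by (rule excision) (use M sub in \<open>simp_all add: closure_of_closedin[OF E] interior_of_openin\<close>)
  obtain p' where p': "homeomorphic_maps ?X' ?W' p p'"
    using homeo homeomorphic_map_maps by blast
  then have p'_cont: "continuous_map ?X' ?W' p" "continuous_map ?W' ?X' p'"
    and p'p: "\<And>x. x \<in> topspace ?X' \<Longrightarrow> p' (p x) = x" and pp': "\<And>y. y \<in> topspace ?W' \<Longrightarrow> p (p' y) = y"
    by (auto simp: homeomorphic_maps_def)
  have pm_p: "pair_map X C W E p" "pair_map X N W M p"
    using p sub by (auto simp: pair_map_def)
  have pm_id: "pair_map ?X' (N - C) X N id" "pair_map ?W' (M - E) W M id"
    "pair_map X C X N id" "pair_map W E W M id"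
    using sub N M by (auto simp: pair_map_def continuous_map_from_subtopology)
  have pm_p': "pair_map ?X' (N - C) ?W' (M - E) p"
  proof -
    have "p x \<in> M - E" if "x \<in> N - C" for x
      using p(3) that funcset_mem[OF continuous_map_funspace[OF p'_cont(1)], of x] sub by auto
    then show ?thesis using sub p'_cont(1) unfolding pair_map_def by auto
  qed
  have "pair_map ?W' (M - E) ?X' (N - C) p'"
  proof -
    have "p' y \<in> N - C" if "y \<in> M - E" for y
    proof -
      from p(4) that have "y \<in> p ` (N - C)" by (rule subsetD)
      then obtain x where x: "y = p x" "x \<in> N - C" by (rule imageE)
      then have "p' y = x" using p'p[of x] sub by auto
      then show ?thesis using x by simp
    qed
    then show ?thesis using sub p'_cont(2) unfolding pair_map_def by auto
  qed
  from ind_iso[OF pm_p' this p'p pp']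
  have iso_p': "ind n ?X' (N - C) ?W' (M - E) p \<in> iso (H n ?X' (N - C)) (H n ?W' (M - E))" .
  have square: "ind n X N W M p (ind n ?X' (N - C) X N id c)
      = ind n ?W' (M - E) W M id (ind n ?X' (N - C) ?W' (M - E) p c)"
    if "c \<in> carrier (H n ?X' (N - C))" for c
    using ind_compose[OF pm_id(1) pm_p(2) that] ind_compose[OF pm_p' pm_id(2) that] by simp
  \<comment> \<open>In the excision square three sides are bijective, hence so is the fourth, the
    map \<open>(X, N) \<rightarrow> (W, M)\<close>.\<close>
  have bij: "bij_betw (ind n X N W M p) (carrier (H n X N)) (carrier (H n W M))"
  proof -
    have "bij_betw (ind n ?W' (M - E) W M id \<circ> ind n ?X' (N - C) ?W' (M - E) p)
        (carrier (H n ?X' (N - C))) (carrier (H n W M))"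
      using iso_p' exW by (intro bij_betw_trans) (auto simp: iso_def)
    then have "bij_betw (ind n X N W M p \<circ> ind n ?X' (N - C) X N id)
        (carrier (H n ?X' (N - C))) (carrier (H n W M))"
      by (rule bij_betw_cong[THEN iffD1, rotated]) (simp add: square)
    moreover have "bij_betw (ind n ?X' (N - C) X N id) (carrier (H n ?X' (N - C))) (carrier (H n X N))"
      using exX by (simp add: iso_def)
    ultimately show ?thesis
      by (rule bij_betw_comp_iff[THEN iffD2, rotated])
  qed
  let ?\<phi> = "ind n X C W E p" and ?iX = "ind n X C X N id" and ?iW = "ind n W E W M id"
  let ?kX = "ind n X N X C (\<lambda>x. G (1, x))" and ?kW = "ind n W M W E (\<lambda>x. G' (1, x))"
  have kX: "?kX (?iX c) = c" if "c \<in> carrier (H n X C)" for c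
    by (rule retract(1)[OF N(2) sub(2) G that])
  have kW: "?kW (?iW c) = c" if "c \<in> carrier (H n W E)" for c
    by (rule retract(1)[OF M(2) sub(4) G' that])
  \<comment> \<open>A class in each relative group, to instantiate \<open>retract\<close> where its
    second conclusion is wanted.\<close>
  have one: "\<one>\<^bsub>H n X C\<^esub> \<in> carrier (H n X C)" "\<one>\<^bsub>H n W E\<^esub> \<in> carrier (H n W E)"
    using abelian[OF sub(1)] abelian[OF sub(3)]
    by (simp_all add: comm_group.axioms(2) group.is_monoid monoid.one_closed)
  have pm_kX: "pair_map X N X C (\<lambda>x. G (1, x))"
    by (rule retract(2)[OF N(2) sub(2) G one(1)])
  have pm_kW: "pair_map W M W E (\<lambda>x. G' (1, x))"
    by (rule retract(2)[OF M(2) sub(4) G' one(2)])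
  have sq_i: "?iW (?\<phi> c) = ind n X N W M p (?iX c)" if "c \<in> carrier (H n X C)" for c
    using ind_compose[OF pm_p(1) pm_id(4) that] ind_compose[OF pm_id(3) pm_p(2) that] by simp
  \<comment> \<open>Compatibility of the two deformations at time one makes the left inverses
    commute with the maps induced by \<open>p\<close>.\<close>
  have sq_k: "?kW (ind n X N W M p a) = ?\<phi> (?kX a)" if a: "a \<in> carrier (H n X N)" for a
  proof -
    have "pair_map X N W E (p \<circ> (\<lambda>x. G (1, x)))"
      using pm_kX pm_p(1) unfolding pair_map_def by (auto intro: continuous_map_compose)
    then have "ind n X N W E (p \<circ> (\<lambda>x. G (1, x))) a = ind n X N W E ((\<lambda>x. G' (1, x)) \<circ> p) a"
      by (rule ind_cong) (use G'_p a in auto)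
    then show ?thesis
      using ind_compose[OF pm_p(2) pm_kW a] ind_compose[OF pm_kX pm_p(1) a] by simp
  qed
  have "inj_on ?\<phi> (carrier (H n X C))"
  proof (rule inj_onI)
    fix c d assume c: "c \<in> carrier (H n X C)" and d: "d \<in> carrier (H n X C)" and eq: "?\<phi> c = ?\<phi> d"
    have "ind n X N W M p (?iX c) = ind n X N W M p (?iX d)"
      unfolding sq_i[OF c, symmetric] sq_i[OF d, symmetric] eq ..
    from inj_onD[OF bij_betw_imp_inj_on[OF bij] this ind_closed[OF pm_id(3) c] ind_closed[OF pm_id(3) d]]
    have "?iX c = ?iX d" .
    then have "?kX (?iX c) = ?kX (?iX d)" by (rule arg_cong)
    then show "c = d" unfolding kX[OF c] kX[OF d] .
  qed
  moreover have "?\<phi> ` carrier (H n X C) = carrier (H n W E)"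
  proof (intro subset_antisym subsetI)
    fix c assume c: "c \<in> carrier (H n W E)"
    then have "?iW c \<in> ind n X N W M p ` carrier (H n X N)"
      unfolding bij_betw_imp_surj_on[OF bij] by (rule ind_closed[OF pm_id(4)])
    then obtain a where a: "?iW c = ind n X N W M p a" "a \<in> carrier (H n X N)" by (rule imageE)
    have "c = ?kW (?iW c)" by (rule kW[OF c, symmetric])
    also have "\<dots> = ?\<phi> (?kX a)" unfolding a(1) by (rule sq_k[OF a(2)])
    finally have "c = ?\<phi> (?kX a)" .
    then show "c \<in> ?\<phi> ` carrier (H n X C)"
      using ind_closed[OF pm_kX a(2)] by (rule image_eqI)
  qed (use ind_closed[OF pm_p(1)] in auto)
  ultimately show ?thesis
    using ind_hom[OF pm_p(1)] by (simp add: iso_def bij_betw_def)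
qed

end

lemma (in cellular_pushout) group_rank_pushout:
  assumes "homology_theory H ind bd"
  shows "group_rank (H n W {}) + group_rank (H n Y {}) = group_rank (H n X {}) + group_rank (H n Z {})"
proof -
  interpret homology_theory H ind bd by fact
  let ?E = "\<beta> ` topspace Z"
  have fsZ: "f (s x) \<in> topspace Z" if "x \<in> topspace X" for x
    using funcset_mem[OF continuous_map_funspace[OF fs_continuous] that] by simp
  have sY: "s x \<in> topspace Y" if "x \<in> topspace X" for x
    using funcset_mem[OF continuous_map_funspace[OF s(1)] that] .
  have EW: "?E \<subseteq> topspace W" by (auto simp: topspace_W)
  \<comment> \<open>A left inverse of \<open>\<beta>\<close>: the composite
    \<open>f \<circ> s\<close> on \<open>X\<close> and the identity on \<open>Z\<close>.\<close>
  obtain t where t: "\<And>x. x \<in> topspace X \<Longrightarrow> t (p x) = (f \<circ> s) x" "\<And>z. z \<in> topspace Z \<Longrightarrow> t (\<beta> z) = id z"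
    by (rule W_factor[of "f \<circ> s" id]) (simp add: s_r, rule that)
  have t_cont: "continuous_map W Z t"
    by (rule continuous_map_from_W[OF fs_continuous continuous_map_id t])
  have "group_rank (H n X {}) = group_rank (H n (subtopology X C) {}) + group_rank (H n X C)"
  proof (rule group_rank_retract[OF C_subset])
    show "continuous_map X (subtopology X C) (r \<circ> s)"
      using continuous_map_compose[OF s(1) r(1)] sY
      by (auto simp: continuous_map_in_subtopology C_def)
  qed (simp add: C_iff)
  moreover have "group_rank (H n (subtopology X C) {}) = group_rank (H n Y {})"
  proof (rule group_rank_homeomorphic)
    show "continuous_map (subtopology X C) Y s"
      by (rule continuous_map_from_subtopology[OF s(1)])
    show "continuous_map Y (subtopology X C) r"
      using r(1) by (auto simp: continuous_map_in_subtopology C_def)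
  qed (auto simp: C_iff s_r)
  moreover have "group_rank (H n W {}) = group_rank (H n (subtopology W ?E) {}) + group_rank (H n W ?E)"
  proof (rule group_rank_retract[OF EW])
    show "continuous_map W (subtopology W ?E) (\<beta> \<circ> t)"
      using continuous_map_compose[OF t_cont \<beta>_continuous] funcset_mem[OF continuous_map_funspace[OF t_cont]]
      by (auto simp: continuous_map_in_subtopology)
  qed (use t in auto)
  moreover have "group_rank (H n (subtopology W ?E) {}) = group_rank (H n Z {})"
  proof (rule group_rank_homeomorphic)
    show "continuous_map (subtopology W ?E) Z t"
      by (rule continuous_map_from_subtopology[OF t_cont])
    show "continuous_map Z (subtopology W ?E) \<beta>"
      using \<beta>_continuous by (auto simp: continuous_map_in_subtopology)
  qed (use t in auto)
  moreover have "group_rank (H n X C) = group_rank (H n W ?E)"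
  proof -
    obtain N G G' where N: "openin X N" "C \<subseteq> N"
      and G: "continuous_map (prod_topology unit_interval X) X G"
        "\<And>x. x \<in> topspace X \<Longrightarrow> G (0, x) = x" "\<And>t x. \<lbrakk>t \<in> {0..1}; x \<in> C\<rbrakk> \<Longrightarrow> G (t, x) = x"
        "\<And>x. x \<in> N \<Longrightarrow> G (1, x) \<in> C"
      and G': "continuous_map (prod_topology unit_interval W) W G'"
      and G'X: "\<And>t x. \<lbrakk>t \<in> {0..1}; x \<in> topspace X\<rbrakk> \<Longrightarrow> G' (t, p x) = p (G (t, x))"
      and G'Z: "\<And>t z. \<lbrakk>t \<in> {0..1}; z \<in> topspace Z\<rbrakk> \<Longrightarrow> G' (t, \<beta> z) = \<beta> z"
      by (rule pair_deformation) (rule that)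
    have pC: "p x \<in> ?E" if "x \<in> C" for x
      using that C_subset fsZ[of x] by (auto simp: p_C)
    have NX: "N \<subseteq> topspace X" using N by (simp add: openin_subset)
    have "ind n X C W ?E p \<in> iso (H n X C) (H n W ?E)"
    proof (rule relative_homeomorphism_iso[OF closedin_C closedin_\<beta> N openin_p_image[OF N] _ p_continuous _ _ _
            p_homeomorphism G G'])
      show "p ` C \<subseteq> ?E" using pC by blast
      show "?E \<union> p ` N - ?E \<subseteq> p ` (N - C)" using pC by blast
      show "G' (0, w) = w" if "w \<in> topspace W" for w
        using that G'X[of 0] G'Z[of 0] G(2) by (auto simp: topspace_W)
      show "G' (t, w) = w" if "t \<in> {0..1}" "w \<in> ?E" for t w
        using that G'Z by auto
      show "G' (1, w) \<in> ?E" if "w \<in> ?E \<union> p ` N" for w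
        using that
      proof
        assume "w \<in> p ` N"
        then obtain x where x: "w = p x" "x \<in> N" by (rule imageE)
        then have "G' (1, w) = p (G (1, x))" using G'X[of 1 x] NX by auto
        then show ?thesis using pC[OF G(4)[OF x(2)]] by simp
      qed (use G'Z[of 1] in auto)
      show "G' (1, p x) = p (G (1, x))" if "x \<in> topspace X" for x
        using G'X[of 1 x] that by simp
    qed auto
    then show ?thesis
      by (rule group_rank_iso[rotated -1]) (use C_subset EW in \<open>simp_all add: abelian\<close>)
  qed
  \<comment> \<open>Both sides are the sum of the ranks for \<open>Y\<close>, \<open>Z\<close> and
    the pair \<open>(X, C)\<close>. No subtraction occurs, so infinite values do no harm.\<close>
  ultimately show ?thesis by (simp add: ac_simps)
qed


section \<open>Betti numbers of categorical pushouts\<close>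

text \<open>An infinite type has the same cardinality as its sum with itself; the two summands give
  the two injections.\<close>

lemma two_disjoint_injections:
  assumes "infinite (UNIV :: 'a set)"
  obtains \<alpha> \<beta> :: "'a \<Rightarrow> 'a" where "inj \<alpha>" "inj \<beta>" "\<And>x y. \<alpha> x \<noteq> \<beta> y"
proof -
  have "|(UNIV :: 'a set) <+> (UNIV :: 'a set)| =o |UNIV :: 'a set|"
    by (rule card_of_Plus_infinite1) (use assms in auto)
  then have "|(UNIV :: 'a set) <+> (UNIV :: 'a set)| \<le>o |UNIV :: 'a set|"
    by (rule ordIso_imp_ordLeq)
  then have "\<exists>h :: 'a + 'a \<Rightarrow> 'a. inj_on h (UNIV <+> UNIV) \<and> h ` (UNIV <+> UNIV) \<subseteq> UNIV"
    by (simp only: card_of_ordLeq)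
  then obtain h :: "'a + 'a \<Rightarrow> 'a" where h: "inj h"
    unfolding UNIV_Plus_UNIV by (elim exE conjE)
  show ?thesis
  proof (rule that[of "h \<circ> Inl" "h \<circ> Inr"])
    show "inj (h \<circ> Inl)" "inj (h \<circ> Inr)"
      using h by (auto simp: inj_def)
    show "(h \<circ> Inl) x \<noteq> (h \<circ> Inr) y" for x y
      using h by (simp add: inj_eq)
  qed
qed

lemma cellular_mapsD:
  assumes "f \<in> cellular_maps K L"
  shows "continuous_map (space K) (space L) f" "f ` skeleton K k \<subseteq> skeleton L k"
  using assms by (auto simp: cellular_maps_def)

text \<open>Morphisms of \<open>CW\<close> are extensional, whereas the construction yields total
  maps; restriction passes from these to those.\<close>

lemma restrict_cellular_map:
  assumes "CW_complex K" "continuous_map (space K) (space L) f" "\<And>k. f ` skeleton K k \<subseteq> skeleton L k"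
  shows "restrict f (topspace (space K)) \<in> cellular_maps K L"
proof -
  have "continuous_map (space K) (space L) (restrict f (topspace (space K)))"
    by (rule continuous_map_eq[OF assms(2)]) simp
  moreover have "restrict f (topspace (space K)) ` skeleton K k \<subseteq> skeleton L k" for k
    using assms(3)[of k] CW_complex_skeleton_subset[OF assms(1), of k] by auto
  ultimately show ?thesis by (simp add: cellular_maps_def)
qed

lemma compose_cellular_maps:
  assumes "CW_complex K" "f \<in> cellular_maps K L" "g \<in> cellular_maps L M"
  shows "compose (topspace (space K)) g f \<in> cellular_maps K M"
proof -
  have "(\<lambda>x. g (f x)) ` skeleton K k \<subseteq> skeleton M k" for k
    using cellular_mapsD(2)[OF assms(2), of k] cellular_mapsD(2)[OF assms(3), of k] by blast
  moreover have "continuous_map (space K) (space M) (\<lambda>x. g (f x))"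
    using continuous_map_compose[OF cellular_mapsD(1)[OF assms(2)] cellular_mapsD(1)[OF assms(3)]]
    by (simp add: o_def)
  ultimately show ?thesis
    unfolding compose_def by (intro restrict_cellular_map assms(1))
qed

lemma (in homology_theory) Betti_eq:
  assumes f: "f \<in> cellular_maps K L" and g: "g \<in> cellular_maps L K"
    and "\<And>x. x \<in> topspace (space K) \<Longrightarrow> g (f x) = x" "\<And>y. y \<in> topspace (space L) \<Longrightarrow> f (g y) = y"
  shows "Betti H n K = Betti H n L"
  unfolding Betti_def
  by (rule group_rank_homeomorphic[OF cellular_mapsD(1)[OF f] cellular_mapsD(1)[OF g] assms(3,4)])

lemma compose_eq_restrict_id:
  "compose S g f = restrict id S \<Longrightarrow> x \<in> S \<Longrightarrow> g (f x) = x"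
  by (metis compose_eq id_apply restrict_apply')

text \<open>The assumptions spell out a pushout square in \<open>CW\<close>. \<open>P\<close> is
  compared with the constructed complex \<open>L\<close> in both directions: \<open>h\<close> comes
  from the universal property of \<open>P\<close>, and \<open>k\<close> from the description of
  \<open>L\<close> by points. That \<open>h\<close> after \<open>k\<close> is the identity is
  checked on points, since \<open>A\<close> and \<open>D\<close> cover \<open>L\<close>; the other
  composite needs the uniqueness clause for \<open>P\<close>.\<close>

lemma Betti_pushout:
  fixes H :: "int \<Rightarrow> 'a topology \<Rightarrow> 'a set \<Rightarrow> 'g monoid" and A B D P :: "'a filtered_space"
  assumes inf: "infinite (UNIV :: 'a set)" and ES: "homology_theory H ind bd"
    and CW: "CW_complex A" "CW_complex B" "CW_complex D" "CW_complex P"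
    and r: "r \<in> cellular_maps B A" and s: "s \<in> cellular_maps A B"
    and sr: "compose (topspace (space B)) s r = restrict id (topspace (space B))"
    and f: "f \<in> cellular_maps B D" and p: "p \<in> cellular_maps A P" and q: "q \<in> cellular_maps D P"
    and comm: "compose (topspace (space B)) p r = compose (topspace (space B)) q f"
    and univ: "\<And>Q u v. \<lbrakk>CW_complex Q; u \<in> cellular_maps A Q; v \<in> cellular_maps D Q;
        compose (topspace (space B)) u r = compose (topspace (space B)) v f\<rbrakk> \<Longrightarrow>
        \<exists>!w. w \<in> cellular_maps P Q \<and> compose (topspace (space A)) w p = u \<and>
             compose (topspace (space D)) w q = v"
  shows "Betti H n P + Betti H n B = Betti H n A + Betti H n D"
proof -
  interpret homology_theory H ind bd by fact
  obtain \<Phi> where \<Phi>: "cell_complex (space A) (skeleton A) \<Phi>"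
    using CW_complex_cells[of "space A" "skeleton A"] CW(1) by auto
  obtain \<Psi> where \<Psi>: "cell_complex (space B) (skeleton B) \<Psi>"
    using CW_complex_cells[of "space B" "skeleton B"] CW(2) by auto
  obtain \<Theta> where \<Theta>: "cell_complex (space D) (skeleton D) \<Theta>"
    using CW_complex_cells[of "space D" "skeleton D"] CW(3) by auto
  obtain \<alpha> \<beta> :: "'a \<Rightarrow> 'a" where \<alpha>\<beta>: "inj \<alpha>" "inj \<beta>" "\<And>x y. \<alpha> x \<noteq> \<beta> y"
    by (rule two_disjoint_injections[OF inf]) (rule that)
  interpret po: cellular_pushout "space A" "space B" "space D" "skeleton A" "skeleton B" "skeleton D"
      \<Phi> \<Psi> \<Theta> r s f \<alpha> \<beta>
    by (intro cellular_pushout.intro cellular_pushout_axioms.intro \<Phi> \<Psi> \<Theta> \<alpha>\<beta>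
        cellular_mapsD[OF r] cellular_mapsD[OF s] cellular_mapsD[OF f] compose_eq_restrict_id[OF sr])
  define L where "L = (po.W, po.wk)"
  have L: "CW_complex L" unfolding L_def by (rule po.W.CW_complex)
  have spL: "space L = po.W" "skeleton L = po.wk" by (simp_all add: L_def)
  define p0 where "p0 = restrict po.p (topspace (space A))"
  define q0 where "q0 = restrict \<beta> (topspace (space D))"
  have p0: "p0 \<in> cellular_maps A L"
    unfolding p0_def by (rule restrict_cellular_map[OF CW(1)]) (auto simp: spL po.p_continuous po.wk_def)
  have q0: "q0 \<in> cellular_maps D L"
    unfolding q0_def by (rule restrict_cellular_map[OF CW(3)]) (auto simp: spL po.\<beta>_continuous po.wk_def)
  have rA: "r y \<in> topspace (space A)" and fD: "f y \<in> topspace (space D)" if "y \<in> topspace (space B)" for y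
    using that funcset_mem[OF continuous_map_funspace[OF po.r(1)]]
      funcset_mem[OF continuous_map_funspace[OF po.f(1)]] by auto
  have "compose (topspace (space B)) p0 r = compose (topspace (space B)) q0 f"
    using rA fD po.p_r by (auto simp: compose_def p0_def q0_def intro!: restrict_ext)
  from ex1_implies_ex[OF univ[OF L p0 q0 this]] obtain h where h: "h \<in> cellular_maps P L"
    "compose (topspace (space A)) h p = p0" "compose (topspace (space D)) h q = q0"
    by (elim exE conjE)
  have hp: "h (p x) = po.p x" if "x \<in> topspace (space A)" for x
    using fun_cong[OF h(2), of x] that by (simp add: compose_def p0_def)
  have hq: "h (q z) = \<beta> z" if "z \<in> topspace (space D)" for z
    using fun_cong[OF h(3), of z] that by (simp add: compose_def q0_def)
  have "p (r y) = q (f y)" if "y \<in> topspace (space B)" for y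
    using fun_cong[OF comm, of y] that by (simp add: compose_def)
  then obtain w where w: "\<And>x. x \<in> topspace (space A) \<Longrightarrow> w (po.p x) = p x"
    "\<And>z. z \<in> topspace (space D) \<Longrightarrow> w (\<beta> z) = q z"
    by (rule po.W_factor) (assumption, rule that)
  have w_cont: "continuous_map po.W (space P) w"
    by (rule po.continuous_map_from_W[OF cellular_mapsD(1)[OF p] cellular_mapsD(1)[OF q] w])
  have w_cell: "w ` po.wk k \<subseteq> skeleton P k" for k
  proof
    fix y assume "y \<in> w ` po.wk k"
    then consider x where "x \<in> skeleton A k" "y = w (po.p x)" | z where "z \<in> skeleton D k" "y = w (\<beta> z)"
      unfolding po.wk_def by blast
    then show "y \<in> skeleton P k"
    proof cases
      case 1
      then have "y = p x" using w(1) po.A.sk_subset by blast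
      then show ?thesis using 1(1) cellular_mapsD(2)[OF p, of k] by blast
    next
      case 2
      then have "y = q z" using w(2) po.D.sk_subset by blast
      then show ?thesis using 2(1) cellular_mapsD(2)[OF q, of k] by blast
    qed
  qed
  define k where "k = restrict w (topspace po.W)"
  have k: "k \<in> cellular_maps L P"
    using restrict_cellular_map[OF L, of P w] w_cont w_cell by (simp add: spL k_def)
  have kp: "k (po.p x) = p x" if "x \<in> topspace (space A)" for x
    using that w(1) by (simp add: k_def po.topspace_W)
  have kq: "k (\<beta> z) = q z" if "z \<in> topspace (space D)" for z
    using that w(2) by (simp add: k_def po.topspace_W)
  have hk: "h (k y) = y" if "y \<in> topspace (space L)" for y
    using that kp kq hp hq by (auto simp: spL po.topspace_W)
  have pP: "p x \<in> topspace (space P)" if "x \<in> topspace (space A)" for x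
    using funcset_mem[OF continuous_map_funspace[OF cellular_mapsD(1)[OF p]] that] .
  have qP: "q z \<in> topspace (space P)" if "z \<in> topspace (space D)" for z
    using funcset_mem[OF continuous_map_funspace[OF cellular_mapsD(1)[OF q]] that] .
  have pe: "p \<in> extensional (topspace (space A))" and qe: "q \<in> extensional (topspace (space D))"
    using p q by (auto simp: cellular_maps_def)
  have 1: "compose (topspace (space P)) k h \<in> cellular_maps P P \<and>
      compose (topspace (space A)) (compose (topspace (space P)) k h) p = p \<and>
      compose (topspace (space D)) (compose (topspace (space P)) k h) q = q"
  proof (intro conjI)
    show "compose (topspace (space P)) k h \<in> cellular_maps P P"
      by (rule compose_cellular_maps[OF CW(4) h(1) k])
    show "compose (topspace (space A)) (compose (topspace (space P)) k h) p = p"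
      by (rule extensionalityI[OF compose_extensional pe]) (simp add: compose_eq pP hp kp)
    show "compose (topspace (space D)) (compose (topspace (space P)) k h) q = q"
      by (rule extensionalityI[OF compose_extensional qe]) (simp add: compose_eq qP hq kq)
  qed
  have 2: "restrict id (topspace (space P)) \<in> cellular_maps P P \<and>
      compose (topspace (space A)) (restrict id (topspace (space P))) p = p \<and>
      compose (topspace (space D)) (restrict id (topspace (space P))) q = q"
  proof (intro conjI)
    show "restrict id (topspace (space P)) \<in> cellular_maps P P"
      by (rule restrict_cellular_map[OF CW(4)]) auto
    show "compose (topspace (space A)) (restrict id (topspace (space P))) p = p"
      by (rule extensionalityI[OF compose_extensional pe]) (simp add: compose_eq pP)
    show "compose (topspace (space D)) (restrict id (topspace (space P))) q = q"
      by (rule extensionalityI[OF compose_extensional qe]) (simp add: compose_eq qP)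
  qed
  \<comment> \<open>Both sides are endomorphisms of \<open>P\<close> compatible with
    \<open>p\<close> and \<open>q\<close>, and there is only one.\<close>
  have "compose (topspace (space P)) k h = restrict id (topspace (space P))"
    using univ[OF CW(4) p q comm] 1 2 by (elim ex1E) metis
  then have kh: "k (h y) = y" if "y \<in> topspace (space P)" for y
    using that by (rule compose_eq_restrict_id)
  have "Betti H n P = Betti H n L"
    by (rule Betti_eq[OF h(1) k kh hk])
  then show ?thesis
    using po.group_rank_pushout[OF ES, of n] by (simp add: Betti_def spL)
qed

theorem proposition8p4:
  fixes H :: "int \<Rightarrow> 'a topology \<Rightarrow> 'a set \<Rightarrow> 'g monoid"
    and ind :: "int \<Rightarrow> 'a topology \<Rightarrow> 'a set \<Rightarrow> 'a topology \<Rightarrow> 'a set \<Rightarrow> ('a \<Rightarrow> 'a) \<Rightarrow> 'g \<Rightarrow> 'g"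
    and bd :: "int \<Rightarrow> 'a topology \<Rightarrow> 'a set \<Rightarrow> 'g \<Rightarrow> 'g"
    and n :: nat
  assumes "infinite (UNIV :: 'a set)"
    and "homology_theory H ind bd"
  shows "valued_dimension (opposite (CW :: ('a filtered_space, 'a \<Rightarrow> 'a) cat)) (Betti H n)"
  unfolding valued_dimension_def
proof (intro conjI allI ballI impI)
  fix K L :: "'a filtered_space"
  assume "isomorphic_objects (opposite CW) K L"
  then obtain f g where f: "f \<in> cellular_maps L K" and g: "g \<in> cellular_maps K L"
    and fg: "compose (topspace (space K)) f g = restrict id (topspace (space K))"
    and gf: "compose (topspace (space L)) g f = restrict id (topspace (space L))"
    by (auto simp: isomorphic_objects_def opposite_def CW_def)
  show "Betti H n K = Betti H n L"
    by (rule homology_theory.Betti_eq[OF assms(2) g f compose_eq_restrict_id[OF fg] compose_eq_restrict_id[OF gf]])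
next
  fix A B D P :: "'a filtered_space" and r f p q
  assume *: "is_pullback (opposite CW) A B D r f P p q \<and> is_retraction (opposite CW) A B r \<and>
    (is_retraction (opposite CW) D B f \<or> is_section (opposite CW) D B f)"
  then have po: "is_pullback (opposite CW) A B D r f P p q" by blast
  \<comment> \<open>With arrows reversed, the section of \<open>r\<close> that
    \<open>is_retraction\<close> provides becomes a left inverse of
    \<open>r : B \<rightarrow> A\<close>.\<close>
  from * obtain s where s: "s \<in> cellular_maps A B"
    "compose (topspace (space B)) s r = restrict id (topspace (space B))"
    by (auto simp: is_retraction_def opposite_def CW_def)
  show "Betti H n P + Betti H n B = Betti H n A + Betti H n D"
  proof (rule Betti_pushout[OF assms _ _ _ _ _ s])
    show "CW_complex A" "CW_complex B" "CW_complex D" "CW_complex P"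
      "r \<in> cellular_maps B A" "f \<in> cellular_maps B D" "p \<in> cellular_maps A P" "q \<in> cellular_maps D P"
      "compose (topspace (space B)) p r = compose (topspace (space B)) q f"
      using po by (simp_all add: is_pullback_def opposite_def CW_def)
    fix Q u v assume "CW_complex Q" "u \<in> cellular_maps A Q" "v \<in> cellular_maps D Q"
      "compose (topspace (space B)) u r = compose (topspace (space B)) v f"
    then show "\<exists>!w. w \<in> cellular_maps P Q \<and> compose (topspace (space A)) w p = u \<and>
             compose (topspace (space D)) w q = v"
      using po by (cases Q) (simp add: is_pullback_def opposite_def CW_def)
  qed
qed

end
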